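(* Let $d\ge 1$, $d<\beta<2d$, and let $f$ be a probability density on $\mathbb{R}_+$ such that $f(r)\sim C_\beta r^{-\beta-1}$ as $r\to+\infty$ for some constant $C_\beta>0$, and $r^{\beta+1}f(r)\le C_0$ for all $r$ for some constant $C_0$. For every $\rho>0$ let $\phi_\rho$ be a stationary determinantal point process on $\mathbb{R}^d$ with kernel $K_\rho(x,y)=K_\rho(x-y)$ with respect to Lebesgue measure, and assume: (a) the operator $\mathbf{K}_\rho g(x)=\int_{\mathbb{R}^d}K_\rho(x,y)g(y)\,dy$ is a bounded symmetric integral operator on $L^2(\mathbb{R}^d,dx)$ with spectrum included in $[0,1[$, and it is locally trace-class (for every compact $\Lambda\subset\mathbb{R}^d$ its restriction to $L^2(\Lambda,dx)$ is trace-class); (b) $K_\rho(0)=\lambda(\rho)K(0)$ with $\lim_{\rho\to0}\lambda(\rho)=+\infty$; (c) $\int_{\mathbb{R}^d}|K_\rho(x)|^2\,dx=\mathcal{O}(\lambda(\rho))$ as $\rho\to0$. Suppose $\lambda(\rho)\rho^\beta\to+\infty$ as $\rho\to0$, and set $n(\rho)=(\lambda(\rho)\rho^\beta)^{1/2}$. Then, as $\rho\to0$, the field $n(\rho)^{-1}\widetilde M_\rho(\cdot)$ converges in the sense of finite-dimensional distributions on the space $\mathcal{M}_\beta^+$ to $W(\cdot)$, where $$W(\mu)=\int_{\mathbb{R}^d\times\mathbb{R}_+}\mu\big(B(x,r)\big)\,M_2(dx,dr)$$ and $M_2$ is a centered Gaussian random measure on $\mathbb{R}^d\times\mathbb{R}_+$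 with control measure $K(0)C_\beta r^{-\beta-1}\,dx\,dr$.
   Context: $B(x,r)=\{y\in\mathbb{R}^d:\|y-x\|\le r\}$ is the Euclidean ball. Determinantal point process (Dpp): a simple point process $\xi$ on a Polish space $E$ is a Dpp with kernel $K$ with respect to a Radon measure $\lambda$ if for all $k\ge1$ and all mutually disjoint Borel sets $D_1,\dots,D_k\subset E$, $\mathbb{E}[\prod_{i=1}^k\xi(D_i)]=\int_{\prod_i D_i}\rho_k(x_1,\dots,x_k)\,\lambda(dx_1)\cdots\lambda(dx_k)$ with $\rho_k(x_1,\dots,x_k)=\det(K(x_i,x_j))_{1\le i,j\le k}$. $K(0)$ is the value at $0$ of the kernel $K(x,y)=K(x-y)$ of a fixed (unscaled) stationary Dpp $\phi$ on $\mathbb{R}^d$; the same letter denotes the two-variable kernel and the one-variable function. $\Phi_\rho$ is the marked point process on $\mathbb{R}^d\times\mathbb{R}_+$ obtained by attaching to the points of $\phi_\rho$ i.i.d. marks (radii), independent of $\phi_\rho$, with density $r\mapsto f(r/\rho)/\rho$. It is identified with the random measure $\sum_{(X,R)\in\Phi_\rho}\delta_{(X,R)}$. It is a Dpp with kernel $\widehat K_\rho((x,r),(y,s))=\sqrt{f(r/\rho)/\rho}\,K_\rho(x,y)\sqrt{f(s/\rho)/\rho}$ with respect to Lebesgue measure. Put $$M_\rho(\mu)=\int_{\mathbb{R}^d\times\mathbb{R}_+}\mu(B(x,r))\,\Phi_\rho(dx,dr),\qquad \widetilde M_\rho(\mu)=M_\rho(\mu)-\mathbb{E}[M_\rho(\mu)].$$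 $\mathcal{M}_\beta^+$ is the set of finite positive compactly supported measures $\mu$ on $\mathbb{R}^d$ for which there exist real numbers $p,q$ with $0<p<\beta<q\le 2d$ and a constant $C_\mu>0$ such that $\int_{\mathbb{R}^d}\mu(B(x,r))^2\,dx\le C_\mu\,\min(r^p,r^q)$ for all $r$. A centered Gaussian random measure with control measure $m$ is such that $\int g\,dM_2$ is defined for $g\in L^2(m)$, is linear in $g$, and is centered Gaussian with variance $\int g^2\,dm$. *)

theory Defs
  imports
    "HOL-Probability.Probability"
    "HOL-Library.Landau_Symbols"
    "Jordan_Normal_Form.Determinant"
begin

section \<open>Simple point processes as random locally finite sets\<close>

text \<open>
  A simple point process is identified with its random set of atoms, so a realisation is a
  locally finite set \<open>S\<close>, and the associated counting measure (the sum of the Dirac masses at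
  the points of \<open>S\<close>) is \<^term>\<open>count_space S\<close>.
\<close>

definition locally_finite_set :: "'a::euclidean_space set \<Rightarrow> bool" where
  "locally_finite_set S \<longleftrightarrow> (\<forall>B. bounded B \<longrightarrow> finite (S \<inter> B))"

definition config_space :: "'a::euclidean_space set measure" where
  "config_space = sigma {S. locally_finite_set S}
     {{S. locally_finite_set S \<and> card (S \<inter> B) = n} | B n. B \<in> sets borel \<and> bounded B}"

definition simple_point_process ::
    "'w measure \<Rightarrow> ('w \<Rightarrow> 'a::euclidean_space set) \<Rightarrow> bool" where
  "simple_point_process P \<xi> \<longleftrightarrow> prob_space P \<and> \<xi> \<in> P \<rightarrow>\<^sub>M config_space"

definition number_of_points :: "'a set \<Rightarrow> 'a set \<Rightarrow> ennreal" where
  "number_of_points S D = emeasure (count_space UNIV) (S \<inter> D)"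

definition stationary_process ::
    "'w measure \<Rightarrow> ('w \<Rightarrow> 'a::euclidean_space set) \<Rightarrow> bool" where
  "stationary_process P \<xi> \<longleftrightarrow>
     (\<forall>v. distr P config_space (\<lambda>\<omega>. (+) v ` \<xi> \<omega>) = distr P config_space \<xi>)"

section \<open>Determinantal point processes\<close>

definition correlation_det :: "('a \<Rightarrow> 'a \<Rightarrow> complex) \<Rightarrow> nat \<Rightarrow> (nat \<Rightarrow> 'a) \<Rightarrow> complex" where
  "correlation_det K k x = Determinant.det (Matrix.mat k k (\<lambda>(i, j). K (x i) (x j)))"

text \<open>
  The moment identity is an identity in \<open>[0,\<infinity>]\<close>, because the \<open>D\<^sub>i\<close> need not be bounded. Kernels are
  complex valued; the almost-everywhere clause says that the determinants are genuine (nonnegative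
  real) densities, so that the use of \<^const>\<open>Re\<close> and \<^const>\<open>ennreal\<close> does not truncate anything.
\<close>

definition dpp ::
    "'w measure \<Rightarrow> ('w \<Rightarrow> 'a::euclidean_space set) \<Rightarrow> ('a \<Rightarrow> 'a \<Rightarrow> complex) \<Rightarrow> 'a measure \<Rightarrow> bool" where
  "dpp P \<xi> K L \<longleftrightarrow>
     simple_point_process P \<xi> \<and>
     sets L = sets borel \<and> (\<forall>C. compact C \<longrightarrow> emeasure L C < \<infinity>) \<and>
     (\<lambda>(x, y). K x y) \<in> borel_measurable (L \<Otimes>\<^sub>M L) \<and>
     (\<forall>k\<ge>1.
        (AE x in (\<Pi>\<^sub>M i\<in>{..<k}. L). Im (correlation_det K k x) = 0 \<and> 0 \<le> Re (correlation_det K k x)) \<and>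
        (\<forall>D. (\<forall>i<k. D i \<in> sets borel) \<and> disjoint_family_on D {..<k} \<longrightarrow>
           (\<integral>\<^sup>+\<omega>. (\<Prod>i<k. number_of_points (\<xi> \<omega>) (D i)) \<partial>P) =
           (\<integral>\<^sup>+x\<in>(\<Pi>\<^sub>E i\<in>{..<k}. D i). ennreal (Re (correlation_det K k x)) \<partial>(\<Pi>\<^sub>M i\<in>{..<k}. L))))"

definition stationary_dpp ::
    "'w measure \<Rightarrow> ('w \<Rightarrow> 'a::euclidean_space set) \<Rightarrow> ('a \<Rightarrow> complex) \<Rightarrow> bool" where
  "stationary_dpp P \<xi> K \<longleftrightarrow> dpp P \<xi> (\<lambda>x y. K (x - y)) lborel \<and> stationary_process P \<xi>"

section \<open>Operators on complex L2 spaces\<close>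

text \<open>
  Elements of \<open>L\<^sup>2(m)\<close> are represented by functions; operators act on representatives, and all
  identities between images are almost-everywhere identities.
\<close>

definition L2 :: "'a measure \<Rightarrow> ('a \<Rightarrow> complex) set" where
  "L2 m = {g \<in> borel_measurable m. integrable m (\<lambda>x. (norm (g x))\<^sup>2)}"

definition L2_inner :: "'a measure \<Rightarrow> ('a \<Rightarrow> complex) \<Rightarrow> ('a \<Rightarrow> complex) \<Rightarrow> complex" where
  "L2_inner m g h = (\<integral>x. g x * cnj (h x) \<partial>m)"

definition L2_norm :: "'a measure \<Rightarrow> ('a \<Rightarrow> complex) \<Rightarrow> real" where
  "L2_norm m g = sqrt (\<integral>x. (norm (g x))\<^sup>2 \<partial>m)"

text \<open>Boundedness and linearity together make the operator well defined on equivalence classes.\<close>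

definition L2_bounded_operator ::
    "'a measure \<Rightarrow> (('a \<Rightarrow> complex) \<Rightarrow> ('a \<Rightarrow> complex)) \<Rightarrow> bool" where
  "L2_bounded_operator m T \<longleftrightarrow>
     (\<forall>g\<in>L2 m. T g \<in> L2 m) \<and>
     (\<forall>g\<in>L2 m. \<forall>h\<in>L2 m. \<forall>a b. AE x in m. T (\<lambda>y. a * g y + b * h y) x = a * T g x + b * T h x) \<and>
     (\<exists>C. \<forall>g\<in>L2 m. L2_norm m (T g) \<le> C * L2_norm m g)"

definition L2_symmetric ::
    "'a measure \<Rightarrow> (('a \<Rightarrow> complex) \<Rightarrow> ('a \<Rightarrow> complex)) \<Rightarrow> bool" where
  "L2_symmetric m T \<longleftrightarrow> (\<forall>g\<in>L2 m. \<forall>h\<in>L2 m. L2_inner m (T g) h = L2_inner m g (T h))"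

text \<open>The complement of the set of \<open>z\<close> for which \<open>T - z\<close> has a bounded inverse.\<close>

definition L2_spectrum ::
    "'a measure \<Rightarrow> (('a \<Rightarrow> complex) \<Rightarrow> ('a \<Rightarrow> complex)) \<Rightarrow> complex set" where
  "L2_spectrum m T = {z. \<not> (\<exists>S. L2_bounded_operator m S \<and>
     (\<forall>g\<in>L2 m. (AE x in m. S (\<lambda>y. T g y - z * g y) x = g x) \<and>
                (AE x in m. T (S g) x - z * S g x = g x)))}"

definition L2_orthonormal_basis :: "'a measure \<Rightarrow> ('a \<Rightarrow> complex) set \<Rightarrow> bool" where
  "L2_orthonormal_basis m B \<longleftrightarrow>
     B \<subseteq> L2 m \<and>
     (\<forall>e\<in>B. \<forall>e'\<in>B. L2_inner m e e' = (if e = e' then 1 else 0)) \<and>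
     (\<forall>g\<in>L2 m. (\<forall>e\<in>B. L2_inner m g e = 0) \<longrightarrow> (AE x in m. g x = 0))"

text \<open>
  \<open>A\<close> is the absolute value \<open>|T|\<close> of \<open>T\<close>, i.e. the positive bounded operator with \<open>A\<^sup>2 = T\<^sup>* T\<close>; the
  last equation is \<open>A\<^sup>2 = T\<^sup>* T\<close> in weak form.
\<close>

definition L2_absolute_value ::
    "'a measure \<Rightarrow> (('a \<Rightarrow> complex) \<Rightarrow> ('a \<Rightarrow> complex)) \<Rightarrow> (('a \<Rightarrow> complex) \<Rightarrow> ('a \<Rightarrow> complex)) \<Rightarrow> bool" where
  "L2_absolute_value m T A \<longleftrightarrow>
     L2_bounded_operator m A \<and> L2_symmetric m A \<and>
     (\<forall>g\<in>L2 m. 0 \<le> Re (L2_inner m (A g) g)) \<and>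
     (\<forall>g\<in>L2 m. \<forall>h\<in>L2 m. L2_inner m (A g) (A h) = L2_inner m (T g) (T h))"

definition L2_trace_class ::
    "'a measure \<Rightarrow> (('a \<Rightarrow> complex) \<Rightarrow> ('a \<Rightarrow> complex)) \<Rightarrow> bool" where
  "L2_trace_class m T \<longleftrightarrow> L2_bounded_operator m T \<and>
     (\<exists>A B. L2_absolute_value m T A \<and> L2_orthonormal_basis m B \<and>
        (\<lambda>e. Re (L2_inner m (A e) e)) summable_on B)"

definition integral_operator ::
    "'a measure \<Rightarrow> ('a \<Rightarrow> 'a \<Rightarrow> complex) \<Rightarrow> ('a \<Rightarrow> complex) \<Rightarrow> ('a \<Rightarrow> complex)" where
  "integral_operator m K g x = (\<integral>y. K x y * g y \<partial>m)"

text \<open>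
  The integrability clause makes \<^const>\<open>integral_operator\<close> meaningful (Bochner integrals of
  non-integrable functions are 0 by convention). The restriction of the operator to
  \<open>L\<^sup>2(\<Lambda>)\<close> has the same kernel, integrated over \<open>\<Lambda>\<close>.
\<close>

definition admissible_kernel_operator :: "('a::euclidean_space \<Rightarrow> 'a \<Rightarrow> complex) \<Rightarrow> bool" where
  "admissible_kernel_operator K \<longleftrightarrow>
     (\<forall>g\<in>L2 lborel. AE x in lborel. integrable lborel (\<lambda>y. K x y * g y)) \<and>
     L2_bounded_operator lborel (integral_operator lborel K) \<and>
     L2_symmetric lborel (integral_operator lborel K) \<and>
     L2_spectrum lborel (integral_operator lborel K) \<subseteq> complex_of_real ` {0..<1} \<and>
     (\<forall>\<Lambda>. compact \<Lambda> \<longrightarrow>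
        L2_trace_class (restrict_space lborel \<Lambda>) (integral_operator (restrict_space lborel \<Lambda>) K))"

section \<open>Independent marking and the random-ball field\<close>

text \<open>
  \<open>\<Phi>\<close> is obtained from \<open>\<phi>\<close> by attaching i.i.d. marks with density \<open>h\<close>: for some measurable
  enumeration \<open>(X\<^sub>n)\<^sub>n\<^sub><\<^sub>N\<close> of the points of \<open>\<phi>\<close>, without repetition and with \<open>N\<close> possibly infinite, the mark
  of \<open>X\<^sub>n\<close> is \<open>R\<^sub>n\<close>, where \<open>(R\<^sub>n)\<close> is i.i.d. and independent of \<open>(N, X)\<close>.
\<close>

definition iid_marking ::
    "'w measure \<Rightarrow> ('w \<Rightarrow> 'a::euclidean_space set) \<Rightarrow> (real \<Rightarrow> ennreal) \<Rightarrow> ('w \<Rightarrow> ('a \<times> real) set) \<Rightarrow> bool" where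
  "iid_marking P \<phi> h \<Phi> \<longleftrightarrow>
     (\<exists>(N :: 'w \<Rightarrow> enat) (X :: nat \<Rightarrow> 'w \<Rightarrow> 'a) (R :: nat \<Rightarrow> 'w \<Rightarrow> real).
        N \<in> P \<rightarrow>\<^sub>M count_space UNIV \<and>
        (\<forall>n. X n \<in> borel_measurable P) \<and>
        (\<forall>\<omega>\<in>space P.
           inj_on (\<lambda>n. X n \<omega>) {n. enat n < N \<omega>} \<and>
           \<phi> \<omega> = (\<lambda>n. X n \<omega>) ` {n. enat n < N \<omega>} \<and>
           \<Phi> \<omega> = (\<lambda>n. (X n \<omega>, R n \<omega>)) ` {n. enat n < N \<omega>}) \<and>
        prob_space.indep_vars P (\<lambda>_. borel) R UNIV \<and>
        (\<forall>n. distributed P lborel (R n) h) \<and>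
        prob_space.indep_set P
          (sets (vimage_algebra (space P) (\<lambda>\<omega>. (N \<omega>, \<lambda>n. X n \<omega>))
             (count_space UNIV \<Otimes>\<^sub>M (\<Pi>\<^sub>M n\<in>UNIV. borel))))
          (sets (vimage_algebra (space P) (\<lambda>\<omega> n. R n \<omega>) (\<Pi>\<^sub>M n\<in>UNIV. borel))))"

definition scaled_radius_density :: "(real \<Rightarrow> real) \<Rightarrow> real \<Rightarrow> real \<Rightarrow> ennreal" where
  "scaled_radius_density f \<rho> r = indicator {0..} r * ennreal (f (r / \<rho>) / \<rho>)"

definition ball_field :: "('w \<Rightarrow> ('a::euclidean_space \<times> real) set) \<Rightarrow> 'a measure \<Rightarrow> 'w \<Rightarrow> real" where
  "ball_field \<Phi> \<mu> \<omega> = (\<integral>(x, r). measure \<mu> (cball x r) \<partial>count_space (\<Phi> \<omega>))"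

definition centered_ball_field ::
    "'w measure \<Rightarrow> ('w \<Rightarrow> ('a::euclidean_space \<times> real) set) \<Rightarrow> 'a measure \<Rightarrow> 'w \<Rightarrow> real" where
  "centered_ball_field P \<Phi> \<mu> \<omega> = ball_field \<Phi> \<mu> \<omega> - (\<integral>\<omega>'. ball_field \<Phi> \<mu> \<omega>' \<partial>P)"

definition M_beta_plus :: "real \<Rightarrow> 'a::euclidean_space measure set" where
  "M_beta_plus \<beta> = {\<mu>.
     sets \<mu> = sets borel \<and> finite_measure \<mu> \<and>
     (\<exists>S. compact S \<and> emeasure \<mu> (- S) = 0) \<and>
     (\<exists>p q C. 0 < p \<and> p < \<beta> \<and> \<beta> < q \<and> q \<le> 2 * real DIM('a) \<and> 0 < C \<and>
        (\<forall>r\<ge>0. (\<integral>\<^sup>+x. ennreal ((measure \<mu> (cball x r))\<^sup>2) \<partial>lborel)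
                  \<le> ennreal (C * min (r powr p) (r powr q))))}"

section \<open>Gaussian random measures\<close>

text \<open>The case split covers the degenerate law \<open>N(0,0)\<close>.\<close>

definition centered_gaussian :: "'v measure \<Rightarrow> ('v \<Rightarrow> real) \<Rightarrow> real \<Rightarrow> bool" where
  "centered_gaussian Q Y v \<longleftrightarrow>
     Y \<in> borel_measurable Q \<and>
     (if v = 0 then AE \<omega> in Q. Y \<omega> = 0
      else distributed Q lborel Y (\<lambda>x. ennreal (normal_density 0 (sqrt v) x)))"

definition square_integrable :: "'e measure \<Rightarrow> ('e \<Rightarrow> real) \<Rightarrow> bool" where
  "square_integrable m g \<longleftrightarrow> g \<in> borel_measurable m \<and> integrable m (\<lambda>z. (g z)\<^sup>2)"

text \<open>
  A Gaussian random measure is given by its stochastic integral: \<open>I g\<close> is the random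
  variable \<open>\<integral> g dM\<^sub>2\<close>, and the measure itself is \<open>M\<^sub>2(A) = I (indicator A)\<close>.
\<close>

definition centered_gaussian_random_measure ::
    "'v measure \<Rightarrow> 'e measure \<Rightarrow> (('e \<Rightarrow> real) \<Rightarrow> 'v \<Rightarrow> real) \<Rightarrow> bool" where
  "centered_gaussian_random_measure Q m I \<longleftrightarrow>
     prob_space Q \<and>
     (\<forall>g. square_integrable m g \<longrightarrow> centered_gaussian Q (I g) (\<integral>z. (g z)\<^sup>2 \<partial>m)) \<and>
     (\<forall>g h a b. square_integrable m g \<and> square_integrable m h \<longrightarrow>
        (AE \<omega> in Q. I (\<lambda>z. a * g z + b * h z) \<omega> = a * I g \<omega> + b * I h \<omega>))"

definition limit_control_measure :: "real \<Rightarrow> real \<Rightarrow> ('a::euclidean_space \<times> real) measure" where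
  "limit_control_measure c \<beta> =
     density lborel (\<lambda>(x, r). indicator {0..} r * ennreal (c * r powr (- \<beta> - 1)))"

definition gaussian_ball_field ::
    "(('a::euclidean_space \<times> real \<Rightarrow> real) \<Rightarrow> 'v \<Rightarrow> real) \<Rightarrow> 'a measure \<Rightarrow> 'v \<Rightarrow> real" where
  "gaussian_ball_field I \<mu> = I (\<lambda>(x, r). measure \<mu> (cball x r))"

section \<open>Convergence in distribution along a filter\<close>

definition converges_in_distribution ::
    "('i \<Rightarrow> 'w measure) \<Rightarrow> ('i \<Rightarrow> 'w \<Rightarrow> 'b::topological_space) \<Rightarrow> 'i filter
       \<Rightarrow> 'v measure \<Rightarrow> ('v \<Rightarrow> 'b) \<Rightarrow> bool" where
  "converges_in_distribution P X F Q Y \<longleftrightarrow>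
     (\<forall>\<^sub>F i in F. X i \<in> borel_measurable (P i)) \<and> Y \<in> borel_measurable Q \<and>
     (\<forall>u :: 'b \<Rightarrow> real. continuous_on UNIV u \<and> bounded (range u) \<longrightarrow>
        ((\<lambda>i. \<integral>\<omega>. u (X i \<omega>) \<partial>P i) \<longlongrightarrow> (\<integral>\<omega>. u (Y \<omega>) \<partial>Q)) F)"

end

theory Submission
  imports Defs
begin

text \<open>
  Let \<open>G(x,r)\<close> be a linear combination of ball masses \<open>\<mu>(B(x,r))\<close>, and let \<open>n = n(\<rho>)\<close>.
  Averaging over the independent marks turns the characteristic functional of the shot noise of \<open>G/n\<close>
  into \<open>\<Sum>\<^sub>k 1/k! \<integral> \<Prod>\<^sub>i u(x\<^sub>i) det (K\<^sub>\<rho>(x\<^sub>i - x\<^sub>j))\<close>, where \<open>u(x)\<close> is the mean of \<open>exp(i G(x,r)/n) - 1\<close>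
  over the radius.  In the Leibniz expansion the fixed points of the permutations split off the Poisson
  factor \<open>exp (K\<^sub>\<rho>(0) \<integral> u)\<close>, and there remains a series \<open>D\<close> over derangements.  A cycle of length at least
  two is bounded by a power of the Hilbert--Schmidt quantity \<open>e\<close>, \<open>e\<^sup>2 = \<integral>\<bar>u\<bar>\<^sup>2 \<integral>\<bar>K\<^sub>\<rho>\<bar>\<^sup>2\<close>, and there are
  at most \<open>k!\<close> derangements of \<open>k\<close> points, so \<open>\<bar>D - 1\<bar> \<le> e\<^sup>2/(1 - e)\<close>.  The growth condition on \<open>\<mu>\<close>
  and hypothesis (c) give \<open>e\<^sup>2 = O(\<rho>\<^bsup>q-\<beta>\<^esup>)\<close> for some \<open>q > \<beta>\<close>, so the correlations of the points disappear
  in the limit.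

  After centering, the Poisson factor has exponent
  \<open>K(0) \<lambda>(\<rho>) \<integral> (exp(i G/n) - 1 - i G/n) f(r/\<rho>)/\<rho> dx dr\<close>.  Since \<open>\<lambda>(\<rho>) = n\<^sup>2 \<rho>\<^bsup>-\<beta>\<^esup>\<close> and
  \<open>\<rho>\<^bsup>-\<beta>-1\<^esup> f(r/\<rho>)\<close> tends to \<open>C\<^sub>\<beta> r\<^bsup>-\<beta>-1\<^esup>\<close> while staying below \<open>C\<^sub>0 r\<^bsup>-\<beta>-1\<^esup>\<close>, dominated convergence yields
  the exponent of the Gaussian field.
\<close>

section \<open>Fredholm expansions\<close>

text \<open>The exponent \<open>K\<^sub>\<rho>(0) \<integral> u\<close> of the Poisson factor may
  blow up before centering, so a bound on the whole series would be useless. Two constants are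
  therefore kept apart: \<open>t\<close> for fixed points, which need only be finite, and
  \<open>e\<close> for moved points, which must be small. The exponent q enters twice. With
  \<open>\<integral> |u|^2 \<le> C \<rho>^q / n^2\<close>,
  \<open>\<integral> |K\<^sub>\<rho>|^2 \<le> M \<lambda>(\<rho>)\<close> and
  \<open>n^2 = \<lambda>(\<rho>) \<rho>^\<beta>\<close> the intensity cancels, and q > \<beta> makes
  e small. The first bound uses a moment of the radius of order q/2, which is finite because q \<le>
  2d and d < \<beta>. The other obstacle is that a Dpp is specified through disjoint sets only,
  whereas the product functional runs over tuples of distinct points. The specification is therefore
  raised to an equality of measures on tuples.\<close>

lemma nn_integral_hilbert_schmidt_comp:
  fixes F G :: "'a \<Rightarrow> 'a \<Rightarrow> ennreal"
  assumes "sigma_finite_measure M"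
    and [measurable]: "(\<lambda>(x, y). F x y) \<in> borel_measurable (M \<Otimes>\<^sub>M M)"
      "(\<lambda>(x, y). G x y) \<in> borel_measurable (M \<Otimes>\<^sub>M M)"
  shows "(\<integral>\<^sup>+x. \<integral>\<^sup>+y. (\<integral>\<^sup>+z. F x z * G z y \<partial>M)\<^sup>2 \<partial>M \<partial>M) \<le>
    (\<integral>\<^sup>+x. \<integral>\<^sup>+y. (F x y)\<^sup>2 \<partial>M \<partial>M) * (\<integral>\<^sup>+x. \<integral>\<^sup>+y. (G x y)\<^sup>2 \<partial>M \<partial>M)"
proof -
  interpret sigma_finite_measure M by fact
  interpret pair_sigma_finite M M by standard
  \<comment> \<open>Cauchy-Schwarz in \<open>z\<close> separates a row norm of \<open>F\<close> from
    a column norm of \<open>G\<close>, after which the integrals over \<open>x\<close> and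
    \<open>y\<close> factor.\<close>
  have "(\<integral>\<^sup>+x. \<integral>\<^sup>+y. (\<integral>\<^sup>+z. F x z * G z y \<partial>M)\<^sup>2 \<partial>M \<partial>M) \<le>
      (\<integral>\<^sup>+x. \<integral>\<^sup>+y. (\<integral>\<^sup>+z. (F x z)\<^sup>2 \<partial>M) * (\<integral>\<^sup>+z. (G z y)\<^sup>2 \<partial>M) \<partial>M \<partial>M)"
    by (intro nn_integral_mono Cauchy_Schwarz_nn_integral) measurable
  also have "\<dots> = (\<integral>\<^sup>+x. \<integral>\<^sup>+y. (F x y)\<^sup>2 \<partial>M \<partial>M) * (\<integral>\<^sup>+y. \<integral>\<^sup>+x. (G x y)\<^sup>2 \<partial>M \<partial>M)"
    by (simp add: nn_integral_cmult nn_integral_multc)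
  also have "(\<integral>\<^sup>+y. \<integral>\<^sup>+x. (G x y)\<^sup>2 \<partial>M \<partial>M) = (\<integral>\<^sup>+x. \<integral>\<^sup>+y. (G x y)\<^sup>2 \<partial>M \<partial>M)"
    by (rule Fubini') measurable
  finally show ?thesis .
qed

text \<open>Integrating out one vertex of a cycle composes two Hilbert--Schmidt kernels.\<close>

lemma nn_integral_derangement_le:
  fixes F :: "'i \<Rightarrow> 'a \<Rightarrow> 'a \<Rightarrow> ennreal"
  assumes "sigma_finite_measure M" "finite S" "s permutes S" "\<And>i. i \<in> S \<Longrightarrow> s i \<noteq> i"
    and "\<And>i. i \<in> S \<Longrightarrow> (\<lambda>(x, y). F i x y) \<in> borel_measurable (M \<Otimes>\<^sub>M M)"
  shows "(\<integral>\<^sup>+x. (\<Prod>i\<in>S. F i (x i) (x (s i))) \<partial>PiM S (\<lambda>_. M))\<^sup>2 \<le>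
    (\<Prod>i\<in>S. \<integral>\<^sup>+x. \<integral>\<^sup>+y. (F i x y)\<^sup>2 \<partial>M \<partial>M)"
proof -
  interpret sigma_finite_measure M by fact
  interpret P: product_sigma_finite "\<lambda>_::'i. M" by standard
  \<comment> \<open>Stated for all \<open>S\<close>, \<open>s\<close> and \<open>F\<close>, because
    the induction below replaces all three.\<close>
  have meas: "(\<lambda>x. \<Prod>i\<in>T. F i (x i) (x (s i))) \<in> borel_measurable (PiM S (\<lambda>_. M))"
    if "s permutes S" "T \<subseteq> S" "\<And>i. i \<in> T \<Longrightarrow> (\<lambda>(x, y). F i x y) \<in> borel_measurable (M \<Otimes>\<^sub>M M)"
    for S T s and F :: "'i \<Rightarrow> 'a \<Rightarrow> 'a \<Rightarrow> ennreal"
  proof (intro borel_measurable_prod_ennreal)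
    fix i assume i: "i \<in> T"
    have s: "i \<in> S" "s i \<in> S" using that i permutes_in_image[of s S] by auto
    have "(\<lambda>x. (x i, x (s i))) \<in> PiM S (\<lambda>_. M) \<rightarrow>\<^sub>M M \<Otimes>\<^sub>M M"
      using s by measurable
    from measurable_compose[OF this that(3)[OF i]]
    show "(\<lambda>x. F i (x i) (x (s i))) \<in> borel_measurable (PiM S (\<lambda>_. M))" by simp
  qed
  show ?thesis using assms(2-)
  proof (induction S arbitrary: s F rule: finite_psubset_induct)
    \<comment> \<open>The kernels are indexed by the vertex for the sake of this induction: removing
      a vertex turns one kernel into a composition and leaves the others alone.\<close>
    case (psubset S s F)
    note per = psubset.prems(1) and der = psubset.prems(2) and [measurable] = psubset.prems(3)
    show ?case
    proof (cases "S = {}")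
      case True
      then show ?thesis by (simp add: PiM_empty)
    next
      case False
      then obtain a where a: "a \<in> S" by auto
      define b where "b = s a"
      have b: "b \<in> S" "b \<noteq> a" using a der[OF a] per permutes_in_image[OF per] by (auto simp: b_def)
      have inj: "s i = s j \<longleftrightarrow> i = j" for i j using permutes_inj[OF per] by (auto simp: inj_def)
      have sS: "s i \<in> S \<longleftrightarrow> i \<in> S" for i using permutes_in_image[OF per] by auto
      have out: "s i = i" if "i \<notin> S" for i using per that by (auto simp: permutes_def)
      have Fa[measurable]: "(\<lambda>(x, y). F a x y) \<in> borel_measurable (M \<Otimes>\<^sub>M M)"
        and Fb[measurable]: "(\<lambda>(x, y). F b x y) \<in> borel_measurable (M \<Otimes>\<^sub>M M)"
        using a b by auto
      show ?thesis
      proof (cases "s b = a")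
        \<comment> \<open>\<open>a\<close> and \<open>b\<close> form a 2-cycle. Bypassing
          \<open>b\<close> would leave the fixed point \<open>a\<close>, which no Hilbert-Schmidt
          norm controls, so both vertices are integrated out together by Cauchy-Schwarz on
          \<open>M \<Otimes>\<^sub>M M\<close>.\<close>
        case True
        define S' where "S' = S - {a, b}"
        have S: "S = insert a (insert b S')" "a \<notin> insert b S'" "b \<notin> S'" "finite S'" "S' \<subset> S"
          using a b psubset.hyps by (auto simp: S'_def)
        define s' where "s' = (\<lambda>i. if i \<in> S' then s i else i)"
        have sS': "s i \<in> S'" if "i \<in> S'" for i
          using that inj[of i a] inj[of i b] True b_def sS[of i] by (auto simp: S'_def)
        have s': "s' permutes S'"
        proof (rule bij_imp_permutes)
          have "s ` S' = S'"
            by (rule endo_inj_surj) (use S sS' inj in \<open>auto intro!: inj_onI\<close>)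
          then show "bij_betw s' S' S'" by (auto simp: bij_betw_def s'_def inj_on_def inj)
        qed (auto simp: s'_def)
        have ba: "s a = b" by (simp add: b_def)
        let ?R = "\<lambda>x. \<Prod>i\<in>S'. F i (x i) (x (s' i))"
        have [measurable]: "?R \<in> borel_measurable (PiM S' (\<lambda>_. M))"
          by (rule meas[OF s']) (use S in auto)
        have pr: "(\<Prod>i\<in>S. F i ((x(b := z, a := y)) i) ((x(b := z, a := y)) (s i))) = F a y z * F b z y * ?R x"
          for x y z
        proof -
          have "(\<Prod>i\<in>S'. F i ((x(b := z, a := y)) i) ((x(b := z, a := y)) (s i))) = ?R x"
            by (rule prod.cong) (use S sS' in \<open>auto simp: s'_def\<close>)
          then show ?thesis unfolding S(1) using S(2-4) True ba b
            by (simp add: mult.assoc)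
        qed
        have m1: "(\<lambda>x. \<Prod>i\<in>S. F i (x i) (x (s i))) \<in> borel_measurable (PiM (insert a (insert b S')) (\<lambda>_. M))"
          using meas[OF per order_refl psubset.prems(3)] by (simp add: S(1)[symmetric])
        have "(\<integral>\<^sup>+x. (\<Prod>i\<in>S. F i (x i) (x (s i))) \<partial>PiM S (\<lambda>_. M)) =
          (\<integral>\<^sup>+x. \<integral>\<^sup>+y. (\<Prod>i\<in>S. F i ((x(a := y)) i) ((x(a := y)) (s i))) \<partial>M \<partial>PiM (insert b S') (\<lambda>_. M))"
          by (subst (1) S(1), subst P.product_nn_integral_insert) (use S m1 in auto)
        also have "\<dots> = (\<integral>\<^sup>+x. \<integral>\<^sup>+z. \<integral>\<^sup>+y. (\<Prod>i\<in>S. F i ((x(b := z, a := y)) i) ((x(b := z, a := y)) (s i))) \<partial>M \<partial>M \<partial>PiM S' (\<lambda>_. M))"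
        proof (subst P.product_nn_integral_insert)
          have *: "(\<lambda>(x, y). x(a := y)) \<in> PiM (insert b S') (\<lambda>_. M) \<Otimes>\<^sub>M M \<rightarrow>\<^sub>M PiM (insert a (insert b S')) (\<lambda>_. M)"
            by (rule measurable_add_dim)
          show "(\<lambda>x. \<integral>\<^sup>+ y. (\<Prod>i\<in>S. F i ((x(a := y)) i) ((x(a := y)) (s i))) \<partial>M)
              \<in> borel_measurable (Pi\<^sub>M (insert b S') (\<lambda>_. M))"
            using measurable_compose[OF * m1] by (intro borel_measurable_nn_integral) (simp add: split_beta')
        qed (use S in auto)
        also have "\<dots> = (\<integral>\<^sup>+x. \<integral>\<^sup>+z. \<integral>\<^sup>+y. F a y z * F b z y * ?R x \<partial>M \<partial>M \<partial>PiM S' (\<lambda>_. M))"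
          unfolding pr ..
        also have "\<dots> = (\<integral>\<^sup>+z. \<integral>\<^sup>+y. F a y z * F b z y \<partial>M \<partial>M) * (\<integral>\<^sup>+x. ?R x \<partial>PiM S' (\<lambda>_. M))"
        proof -
          have "(\<integral>\<^sup>+z. \<integral>\<^sup>+y. F a y z * F b z y * ?R x \<partial>M \<partial>M) = (\<integral>\<^sup>+z. \<integral>\<^sup>+y. F a y z * F b z y \<partial>M \<partial>M) * ?R x" for x
          proof -
            have "(\<integral>\<^sup>+z. \<integral>\<^sup>+y. F a y z * F b z y * ?R x \<partial>M \<partial>M) = (\<integral>\<^sup>+z. (\<integral>\<^sup>+y. F a y z * F b z y \<partial>M) * ?R x \<partial>M)"
              by (intro nn_integral_cong nn_integral_multc) measurable
            also have "\<dots> = (\<integral>\<^sup>+z. \<integral>\<^sup>+y. F a y z * F b z y \<partial>M \<partial>M) * ?R x"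
              by (intro nn_integral_multc) measurable
            finally show ?thesis .
          qed
          then show ?thesis by (simp add: nn_integral_cmult)
        qed
        finally have eq: "(\<integral>\<^sup>+x. (\<Prod>i\<in>S. F i (x i) (x (s i))) \<partial>PiM S (\<lambda>_. M)) = \<dots>" .
        have "(\<integral>\<^sup>+z. \<integral>\<^sup>+y. F a y z * F b z y \<partial>M \<partial>M)\<^sup>2 \<le>
            (\<integral>\<^sup>+z. \<integral>\<^sup>+y. (F a y z)\<^sup>2 \<partial>M \<partial>M) * (\<integral>\<^sup>+z. \<integral>\<^sup>+y. (F b z y)\<^sup>2 \<partial>M \<partial>M)"
        proof -
          have "(\<integral>\<^sup>+p. (case p of (z, y) \<Rightarrow> F a y z) * (case p of (z, y) \<Rightarrow> F b z y) \<partial>(M \<Otimes>\<^sub>M M))\<^sup>2 \<le>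
            (\<integral>\<^sup>+p. (case p of (z, y) \<Rightarrow> F a y z)\<^sup>2 \<partial>(M \<Otimes>\<^sub>M M)) * (\<integral>\<^sup>+p. (case p of (z, y) \<Rightarrow> F b z y)\<^sup>2 \<partial>(M \<Otimes>\<^sub>M M))"
            by (rule Cauchy_Schwarz_nn_integral) measurable
          also have "(\<integral>\<^sup>+p. (case p of (z, y) \<Rightarrow> F a y z)\<^sup>2 \<partial>(M \<Otimes>\<^sub>M M)) = (\<integral>\<^sup>+z. \<integral>\<^sup>+y. (F a y z)\<^sup>2 \<partial>M \<partial>M)"
            by (subst nn_integral_fst[symmetric]) simp_all
          also have "(\<integral>\<^sup>+p. (case p of (z, y) \<Rightarrow> F b z y)\<^sup>2 \<partial>(M \<Otimes>\<^sub>M M)) = (\<integral>\<^sup>+z. \<integral>\<^sup>+y. (F b z y)\<^sup>2 \<partial>M \<partial>M)"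
            by (subst nn_integral_fst[symmetric]) simp_all
          also have "(\<integral>\<^sup>+p. (case p of (z, y) \<Rightarrow> F a y z) * (case p of (z, y) \<Rightarrow> F b z y) \<partial>(M \<Otimes>\<^sub>M M)) =
              (\<integral>\<^sup>+z. \<integral>\<^sup>+y. F a y z * F b z y \<partial>M \<partial>M)"
            by (subst nn_integral_fst[symmetric]) simp_all
          finally show ?thesis .
        qed
        also have "(\<integral>\<^sup>+z. \<integral>\<^sup>+y. (F a y z)\<^sup>2 \<partial>M \<partial>M) = (\<integral>\<^sup>+y. \<integral>\<^sup>+z. (F a y z)\<^sup>2 \<partial>M \<partial>M)"
          by (rule pair_sigma_finite.Fubini') (unfold_locales, measurable)
        finally have le1: "(\<integral>\<^sup>+z. \<integral>\<^sup>+y. F a y z * F b z y \<partial>M \<partial>M)\<^sup>2 \<le> \<dots> * (\<integral>\<^sup>+z. \<integral>\<^sup>+y. (F b z y)\<^sup>2 \<partial>M \<partial>M)" .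
        have le2: "(\<integral>\<^sup>+x. ?R x \<partial>PiM S' (\<lambda>_. M))\<^sup>2 \<le> (\<Prod>i\<in>S'. \<integral>\<^sup>+x. \<integral>\<^sup>+y. (F i x y)\<^sup>2 \<partial>M \<partial>M)"
          by (rule psubset.IH[OF S(5) s']) (use S der in \<open>auto simp: s'_def\<close>)
        show ?thesis unfolding eq power_mult_distrib
          by (rule order_trans[OF mult_mono[OF le1 le2]])
             (simp_all add: S(1) S(2-4)[simplified] mult.assoc b(2)[symmetric])
      next
        case False
        define S' where "S' = S - {b}"
        define c where "c = s b"
        have c: "c \<in> S'" "c \<noteq> a" "c \<noteq> b" using False der[OF b(1)] b sS[of b] by (auto simp: c_def S'_def)
        have S: "S = insert b S'" "b \<notin> S'" "finite S'" "S' \<subset> S" "a \<in> S'"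
          using a b psubset.hyps by (auto simp: S'_def)
        \<comment> \<open>The cycle with \<open>b\<close> bypassed, \<open>a \<rightarrow> c\<close>
          instead of \<open>a \<rightarrow> b \<rightarrow> c\<close>. It has no fixed point in
          \<open>S'\<close> because \<open>c \<noteq> a\<close>; the composed kernel
          \<open>G\<close> defined below takes over the factor at \<open>a\<close>.\<close>
        define s' where "s' = (\<lambda>i. if i = b then b else if i = a then c else s i)"
        have s'_eq: "s' = Transposition.transpose b c \<circ> s"
        proof
          fix i show "s' i = (Transposition.transpose b c \<circ> s) i"
            using inj[of i a] inj[of i b] c b by (auto simp: s'_def transpose_def b_def c_def)
        qed
        have "s' permutes S"
          unfolding s'_eq by (rule permutes_compose[OF per]) (use b c S in \<open>auto intro!: permutes_swap_id\<close>)
        then have s': "s' permutes S'"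
          by (rule permutes_superset) (auto simp: S'_def s'_def)
        define G where "G = (\<lambda>x y. \<integral>\<^sup>+z. F a x z * F b z y \<partial>M)"
        have G[measurable]: "(\<lambda>(x, y). G x y) \<in> borel_measurable (M \<Otimes>\<^sub>M M)"
          unfolding G_def by measurable
        define F' where "F' = F(a := G)"
        let ?R = "\<lambda>x. \<Prod>i\<in>S'-{a}. F i (x i) (x (s i))"
        have sb: "s i \<noteq> b" if "i \<in> S' - {a}" for i using inj[of i a] that by (auto simp: b_def)
        have pr: "(\<Prod>i\<in>S. F i ((x(b := z)) i) ((x(b := z)) (s i))) = F a (x a) z * F b z (x c) * ?R x" for x z
        proof -
          have "S = insert a (insert b (S' - {a}))" using S by auto
          moreover have "(\<Prod>i\<in>S'-{a}. F i ((x(b := z)) i) ((x(b := z)) (s i))) = ?R x"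
            by (rule prod.cong) (use S sb in auto)
          moreover have "s a = b" "s b = c" by (auto simp: b_def c_def)
          moreover have "a \<notin> insert b (S' - {a})" "b \<notin> S' - {a}" "finite (S' - {a})" using b S by auto
          ultimately show ?thesis using b c
            by (simp add: mult.assoc del: Diff_iff)
        qed
        have m1: "(\<lambda>x. \<Prod>i\<in>S. F i (x i) (x (s i))) \<in> borel_measurable (PiM (insert b S') (\<lambda>_. M))"
          using meas[OF per order_refl psubset.prems(3)] by (simp add: S(1)[symmetric])
        have "(\<integral>\<^sup>+x. (\<Prod>i\<in>S. F i (x i) (x (s i))) \<partial>PiM S (\<lambda>_. M)) =
          (\<integral>\<^sup>+x. \<integral>\<^sup>+z. (\<Prod>i\<in>S. F i ((x(b := z)) i) ((x(b := z)) (s i))) \<partial>M \<partial>PiM S' (\<lambda>_. M))"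
          by (subst (1) S(1), subst P.product_nn_integral_insert) (use S m1 in auto)
        also have "\<dots> = (\<integral>\<^sup>+x. (\<Prod>i\<in>S'. F' i (x i) (x (s' i))) \<partial>PiM S' (\<lambda>_. M))"
        proof (rule nn_integral_cong)
          fix x assume "x \<in> space (PiM S' (\<lambda>_. M))"
          then have x: "x a \<in> space M" "x c \<in> space M" using S c by (auto simp: space_PiM)
          have "(\<integral>\<^sup>+z. (\<Prod>i\<in>S. F i ((x(b := z)) i) ((x(b := z)) (s i))) \<partial>M) = G (x a) (x c) * ?R x"
            unfolding pr G_def using x by (intro nn_integral_multc) measurable
          also have "\<dots> = (\<Prod>i\<in>S'. F' i (x i) (x (s' i)))"
            by (subst prod.remove[OF S(3,5)], intro arg_cong2[where f="(*)"] prod.cong)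
               (use b S in \<open>auto simp: F'_def s'_def\<close>)
          finally show "(\<integral>\<^sup>+z. (\<Prod>i\<in>S. F i ((x(b := z)) i) ((x(b := z)) (s i))) \<partial>M) = \<dots>" .
        qed
        finally have eq: "(\<integral>\<^sup>+x. (\<Prod>i\<in>S. F i (x i) (x (s i))) \<partial>PiM S (\<lambda>_. M)) = \<dots>" .
        have "(\<integral>\<^sup>+x. (\<Prod>i\<in>S'. F' i (x i) (x (s' i))) \<partial>PiM S' (\<lambda>_. M))\<^sup>2 \<le> (\<Prod>i\<in>S'. \<integral>\<^sup>+x. \<integral>\<^sup>+y. (F' i x y)\<^sup>2 \<partial>M \<partial>M)"
        proof (rule psubset.IH[OF S(4) s'])
          fix i assume "i \<in> S'"
          then show "s' i \<noteq> i" using S der[of i] c by (auto simp: s'_def)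
          show "(\<lambda>(x, y). F' i x y) \<in> borel_measurable (M \<Otimes>\<^sub>M M)"
            using \<open>i \<in> S'\<close> S G psubset.prems(3)[of i] by (auto simp: F'_def)
        qed
        also have "\<dots> = (\<integral>\<^sup>+x. \<integral>\<^sup>+y. (G x y)\<^sup>2 \<partial>M \<partial>M) * (\<Prod>i\<in>S'-{a}. \<integral>\<^sup>+x. \<integral>\<^sup>+y. (F i x y)\<^sup>2 \<partial>M \<partial>M)"
          by (subst prod.remove[OF S(3,5)]) (simp add: F'_def)
        also have "\<dots> \<le> ((\<integral>\<^sup>+x. \<integral>\<^sup>+y. (F a x y)\<^sup>2 \<partial>M \<partial>M) * (\<integral>\<^sup>+x. \<integral>\<^sup>+y. (F b x y)\<^sup>2 \<partial>M \<partial>M)) *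
            (\<Prod>i\<in>S'-{a}. \<integral>\<^sup>+x. \<integral>\<^sup>+y. (F i x y)\<^sup>2 \<partial>M \<partial>M)"
          unfolding G_def by (intro mult_right_mono nn_integral_hilbert_schmidt_comp assms) (auto simp: a b)
        also have "\<dots> = (\<Prod>i\<in>S. \<integral>\<^sup>+x. \<integral>\<^sup>+y. (F i x y)\<^sup>2 \<partial>M \<partial>M)"
        proof -
          have "S = insert a (insert b (S' - {a}))" using S by auto
          moreover have "a \<notin> insert b (S' - {a})" "b \<notin> S' - {a}" "finite (S' - {a})" using b S by auto
          ultimately show ?thesis by (simp add: mult.assoc del: Diff_iff)
        qed
        finally show ?thesis unfolding eq .
      qed
    qed
  qed
qed

lemma ennreal_le_if_power2_le:
  fixes a :: ennreal
  assumes "a\<^sup>2 \<le> ennreal (b\<^sup>2)" "0 \<le> b"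
  shows "a \<le> ennreal b"
proof (cases a)
  case (real r)
  then have "r\<^sup>2 \<le> b\<^sup>2" using assms by (simp add: ennreal_power)
  then show ?thesis using real assms by (auto intro: power2_le_imp_le)
next
  case top
  then show ?thesis using assms by (simp add: power2_eq_square ennreal_mult_top top_unique)
qed

section \<open>Permutations sorted by the points that they move\<close>

lemma sum_Pow_card:
  fixes g :: "nat \<Rightarrow> 'a::semiring_1"
  assumes "finite A"
  shows "(\<Sum>S\<in>Pow A. g (card S)) = (\<Sum>j\<le>card A. of_nat (card A choose j) * g j)"
proof -
  have "(\<Sum>S\<in>Pow A. g (card S)) = (\<Sum>j\<le>card A. \<Sum>S\<in>{S\<in>Pow A. card S = j}. g (card S))"
    by (rule sum.group[symmetric]) (use assms in \<open>auto intro: card_mono\<close>)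
  also have "\<dots> = (\<Sum>j\<le>card A. of_nat (card A choose j) * g j)"
  proof (rule sum.cong[OF refl])
    fix j
    have "(\<Sum>S\<in>{S\<in>Pow A. card S = j}. g (card S)) = (\<Sum>S\<in>{S. S \<subseteq> A \<and> card S = j}. g j)"
      by (rule sum.cong) auto
    then show "(\<Sum>S\<in>{S\<in>Pow A. card S = j}. g (card S)) = of_nat (card A choose j) * g j"
      using n_subsets[OF assms, of j] by simp
  qed
  finally show ?thesis .
qed

text \<open>Since \<open>s permutes S\<close> forces the identity off \<open>S\<close>, membership
  makes \<open>S\<close> exactly the set of points moved by \<open>s\<close>.\<close>

definition derangements_on :: "'i set \<Rightarrow> ('i \<Rightarrow> 'i) set" where
  "derangements_on S = {s. s permutes S \<and> (\<forall>i\<in>S. s i \<noteq> i)}"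

lemma finite_derangements_on: "finite S \<Longrightarrow> finite (derangements_on S)"
  by (rule finite_subset[OF _ finite_permutations[of S]]) (auto simp: derangements_on_def)

lemma card_derangements_on_le: "finite S \<Longrightarrow> card (derangements_on S) \<le> fact (card S)"
  by (subst card_permutations[OF refl, symmetric], assumption, rule card_mono)
     (auto simp: derangements_on_def finite_permutations)

lemma derangements_on_mono_permutes: "s \<in> derangements_on S \<Longrightarrow> S \<subseteq> A \<Longrightarrow> s permutes A"
  by (auto simp: derangements_on_def intro: permutes_subset)

text \<open>The set of moved points can be read off from a permutation, so sorting by it is a
  partition.\<close>

lemma sum_permutations_derangements:
  assumes "finite A"
  shows "(\<Sum>s | s permutes A. g s) = (\<Sum>S\<in>Pow A. \<Sum>s\<in>derangements_on S. g s)"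
proof -
  have "{s. s permutes A} = (\<Union>S\<in>Pow A. derangements_on S)"
  proof (intro equalityI subsetI)
    fix s assume "s \<in> {s. s permutes A}"
    then have s: "s permutes A" by simp
    define S where "S = {i\<in>A. s i \<noteq> i}"
    have "s permutes S" by (rule permutes_superset[OF s]) (auto simp: S_def)
    then show "s \<in> (\<Union>S\<in>Pow A. derangements_on S)"
      by (auto simp: derangements_on_def S_def intro!: bexI[of _ S])
  qed (auto simp: derangements_on_def intro: permutes_subset)
  moreover have "S = T" if "s \<in> derangements_on S" "s \<in> derangements_on T" for s S T
  proof -
    have "U = {i. s i \<noteq> i}" if "s \<in> derangements_on U" for U
      using that permutes_not_in[of s U] by (auto simp: derangements_on_def)
    then show ?thesis using that by metis
  qed
  ultimately show ?thesis
    using assms finite_subset[OF _ assms]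
    by (simp only:, subst sum.UNION_disjoint) (auto intro!: finite_derangements_on)
qed

text \<open>A box over \<open>J\<close> pulls back to the box over \<open>I\<close> whose sides are
  relabelled by the inverse of \<open>b\<close>, and boxes determine the measure. Sigma-finite
  factors are allowed, so this covers Lebesgue measure.\<close>

lemma (in product_sigma_finite) distr_PiM_reindex_finite:
  assumes b: "bij_betw b J I" and fin: "finite I" "finite J" and M: "\<And>i. i \<in> J \<Longrightarrow> M (b i) = M i"
  shows "distr (PiM I M) (PiM J M) (\<lambda>x. \<lambda>j\<in>J. x (b j)) = PiM J M"
proof (rule PiM_eqI)
  interpret I: finite_product_sigma_finite M I by standard fact
  have bI: "b j \<in> I" if "j \<in> J" for j using b that by (auto simp: bij_betw_def)
  have m: "(\<lambda>x. \<lambda>j\<in>J. x (b j)) \<in> PiM I M \<rightarrow>\<^sub>M PiM J M"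
  proof (rule measurable_restrict)
    fix j assume j: "j \<in> J"
    show "(\<lambda>x. x (b j)) \<in> PiM I M \<rightarrow>\<^sub>M M j"
      using measurable_component_singleton[OF bI[OF j], of M] M[OF j] by simp
  qed
  fix A assume A: "\<And>i. i \<in> J \<Longrightarrow> A i \<in> sets (M i)"
  have AM: "A j \<subseteq> space (M j)" if "j \<in> J" for j using A[OF that] by (rule sets.sets_into_space)
  have inv: "inv_into J b i \<in> J" "b (inv_into J b i) = i" if "i \<in> I" for i
    using that b by (auto simp: bij_betw_def inv_into_into f_inv_into_f)
  have inv': "inv_into J b (b j) = j" if "j \<in> J" for j using that b by (auto simp: bij_betw_def)
  have eq: "(\<lambda>x. \<lambda>j\<in>J. x (b j)) -` Pi\<^sub>E J A \<inter> space (PiM I M) = Pi\<^sub>E I (\<lambda>i. A (inv_into J b i))"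
  proof (intro equalityI subsetI)
    fix x assume x: "x \<in> (\<lambda>x. \<lambda>j\<in>J. x (b j)) -` Pi\<^sub>E J A \<inter> space (PiM I M)"
    have "x i \<in> A (inv_into J b i)" if "i \<in> I" for i
    proof -
      have mem: "(\<lambda>j\<in>J. x (b j)) \<in> Pi\<^sub>E J A" by (rule vimageD[OF IntD1[OF x]])
      show ?thesis using PiE_mem[OF mem inv(1)[OF that]] inv[OF that] by simp
    qed
    then show "x \<in> Pi\<^sub>E I (\<lambda>i. A (inv_into J b i))" using x by (auto simp: space_PiM PiE_iff)
  next
    fix x assume x: "x \<in> Pi\<^sub>E I (\<lambda>i. A (inv_into J b i))"
    have "x i \<in> space (M i)" if "i \<in> I" for i
      using PiE_mem[OF x that] AM[OF inv(1)[OF that]] M[OF inv(1)[OF that]] inv(2)[OF that] by auto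
    moreover have "x (b j) \<in> A j" if "j \<in> J" for j using PiE_mem[OF x bI[OF that]] inv'[OF that] by simp
    ultimately show "x \<in> (\<lambda>x. \<lambda>j\<in>J. x (b j)) -` Pi\<^sub>E J A \<inter> space (PiM I M)"
      using x by (auto simp: space_PiM PiE_iff)
  qed
  have "emeasure (distr (PiM I M) (PiM J M) (\<lambda>x. \<lambda>j\<in>J. x (b j))) (Pi\<^sub>E J A) =
      emeasure (PiM I M) (Pi\<^sub>E I (\<lambda>i. A (inv_into J b i)))"
    by (subst emeasure_distr[OF m]) (use A fin eq in \<open>auto intro!: sets_PiM_I_finite\<close>)
  also have "\<dots> = (\<Prod>i\<in>I. emeasure (M i) (A (inv_into J b i)))"
  proof (rule I.measure_times)
    fix i assume i: "i \<in> I"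
    show "A (inv_into J b i) \<in> sets (M i)"
      using A[OF inv(1)[OF i]] M[OF inv(1)[OF i]] inv(2)[OF i] by simp
  qed
  also have "\<dots> = (\<Prod>j\<in>J. emeasure (M j) (A j))"
    unfolding prod.reindex_bij_betw[OF b, symmetric] by (intro prod.cong refl) (simp add: inv' M)
  finally show "emeasure (distr (PiM I M) (PiM J M) (\<lambda>x. \<lambda>j\<in>J. x (b j))) (Pi\<^sub>E J A) = (\<Prod>j\<in>J. emeasure (M j) (A j))" .
qed (use fin in auto)

text \<open>\<open>w\<close> dominates the modulus of the functions \<open>u\<close> to be
  integrated, so one set of bounds covers the absolute and the signed series. Fixed points of a
  permutation are paid for by \<open>t\<close>, moved points by \<open>e\<close>, a bound for the
  Hilbert-Schmidt norm of \<open>sqrt (w x) * \<kappa> x y * sqrt (w y)\<close>. The diagonal may be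
  a null set, hence the separate constant \<open>t\<close>.\<close>

locale weighted_kernel = sigma_finite_measure M for M :: "'a measure" +
  fixes \<kappa> :: "'a \<Rightarrow> 'a \<Rightarrow> complex" and w :: "'a \<Rightarrow> real" and t e :: real
  assumes kernel_measurable[measurable]: "(\<lambda>(x, y). \<kappa> x y) \<in> borel_measurable (M \<Otimes>\<^sub>M M)"
    and diag_measurable[measurable]: "(\<lambda>x. \<kappa> x x) \<in> borel_measurable M"
    and weight_measurable[measurable]: "w \<in> borel_measurable M"
    and weight_nonneg: "\<And>x. 0 \<le> w x"
    and te_nonneg: "0 \<le> t" "0 \<le> e"
    and trace_le: "(\<integral>\<^sup>+x. ennreal (w x * norm (\<kappa> x x)) \<partial>M) \<le> ennreal t"
    and hs_le: "(\<integral>\<^sup>+x. \<integral>\<^sup>+y. ennreal (w x * (norm (\<kappa> x y))\<^sup>2 * w y) \<partial>M \<partial>M) \<le> ennreal (e\<^sup>2)"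
begin

sublocale P: product_sigma_finite "\<lambda>_::nat. M" by standard

lemma perm_component_measurable:
  assumes "s permutes S" "i \<in> S"
  shows "(\<lambda>x. \<kappa> (x i) (x (s i))) \<in> borel_measurable (PiM S (\<lambda>_::nat. M))"
proof -
  have s: "i \<in> S" "s i \<in> S" using assms permutes_in_image[of s S] by auto
  have "(\<lambda>x. (x i, x (s i))) \<in> PiM S (\<lambda>_. M) \<rightarrow>\<^sub>M M \<Otimes>\<^sub>M M"
    using s by measurable
  from measurable_compose[OF this kernel_measurable] show ?thesis by simp
qed

text \<open>Because \<open>s\<close> permutes \<open>S\<close>, the weight can be shared evenly
  between the two ends of every edge: the product of \<open>w (x i)\<close> is the product of
  \<open>sqrt (w (x i)) * sqrt (w (x (s i)))\<close>. Each edge then carries a kernel of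
  Hilbert-Schmidt norm at most \<open>e\<close>.\<close>

lemma nn_integral_derangement_weighted_le:
  assumes "finite S" "s \<in> derangements_on S"
  shows "(\<integral>\<^sup>+x. ennreal (\<Prod>i\<in>S. w (x i) * norm (\<kappa> (x i) (x (s i)))) \<partial>PiM S (\<lambda>_::nat. M)) \<le> ennreal (e ^ card S)"
proof -
  have s: "s permutes S" "\<And>i. i \<in> S \<Longrightarrow> s i \<noteq> i" using assms by (auto simp: derangements_on_def)
  define F where "F = (\<lambda>(i::nat) x y. ennreal (sqrt (w x) * norm (\<kappa> x y) * sqrt (w y)))"
  have F2: "(F i x y)\<^sup>2 = ennreal (w x * (norm (\<kappa> x y))\<^sup>2 * w y)" for i x y
    by (simp add: F_def ennreal_power power_mult_distrib weight_nonneg)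
  have "(\<Prod>i\<in>S. w (x i) * norm (\<kappa> (x i) (x (s i)))) =
      (\<Prod>i\<in>S. sqrt (w (x i)) * norm (\<kappa> (x i) (x (s i))) * sqrt (w (x (s i))))" for x
  proof -
    have "(\<Prod>i\<in>S. w (x i)) = (\<Prod>i\<in>S. sqrt (w (x i))) * (\<Prod>i\<in>S. sqrt (w (x i)))"
      by (simp add: prod.distrib[symmetric] weight_nonneg)
    also have "(\<Prod>i\<in>S. sqrt (w (x i))) = (\<Prod>i\<in>S. sqrt (w (x (s i))))" (is "?a = _")
      using prod.permute[OF s(1), of "\<lambda>i. sqrt (w (x i))"] by (simp add: o_def)
    finally have "(\<Prod>i\<in>S. w (x i)) = (\<Prod>i\<in>S. sqrt (w (x i))) * (\<Prod>i\<in>S. sqrt (w (x (s i))))"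
      using prod.permute[OF s(1), of "\<lambda>i. sqrt (w (x i))"] by (simp add: o_def)
    then show ?thesis by (simp add: prod.distrib)
  qed
  then have "(\<integral>\<^sup>+x. ennreal (\<Prod>i\<in>S. w (x i) * norm (\<kappa> (x i) (x (s i)))) \<partial>PiM S (\<lambda>_::nat. M)) =
     (\<integral>\<^sup>+x. (\<Prod>i\<in>S. F i (x i) (x (s i))) \<partial>PiM S (\<lambda>_. M))"
    by (simp add: F_def prod_ennreal weight_nonneg)
  also have "\<dots> \<le> ennreal (e ^ card S)"
  proof (rule ennreal_le_if_power2_le)
    have "(\<integral>\<^sup>+x. (\<Prod>i\<in>S. F i (x i) (x (s i))) \<partial>PiM S (\<lambda>_. M))\<^sup>2 \<le> (\<Prod>i\<in>S. \<integral>\<^sup>+x. \<integral>\<^sup>+y. (F i x y)\<^sup>2 \<partial>M \<partial>M)"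
    proof (rule nn_integral_derangement_le[OF sigma_finite_measure_axioms assms(1) s])
      show "(\<lambda>(x, y). F i x y) \<in> borel_measurable (M \<Otimes>\<^sub>M M)" for i
        unfolding F_def by measurable
    qed
    also have "\<dots> \<le> (\<Prod>i\<in>S. ennreal (e\<^sup>2))"
      unfolding F2 prod_constant by (intro power_mono hs_le) simp
    also have "\<dots> = ennreal ((e ^ card S)\<^sup>2)"
      by (simp add: ennreal_power power_mult[symmetric] mult.commute)
    finally show "(\<integral>\<^sup>+x. (\<Prod>i\<in>S. F i (x i) (x (s i))) \<partial>PiM S (\<lambda>_. M))\<^sup>2 \<le> ennreal ((e ^ card S)\<^sup>2)" .
  qed (use te_nonneg in simp)
  finally show ?thesis .
qed

lemma merge_prod_split:
  assumes s: "s \<in> derangements_on S" and S: "S \<subseteq> A" "finite A"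
  shows "(\<Prod>i\<in>A. h (merge S (A - S) (x, y) i) (merge S (A - S) (x, y) (s i))) =
    (\<Prod>i\<in>S. h (x i) (x (s i))) * (\<Prod>i\<in>A-S. h (y i) (y i))"
proof -
  have sS: "s permutes S" using s by (auto simp: derangements_on_def)
  have "(\<Prod>i\<in>A. h (merge S (A - S) (x, y) i) (merge S (A - S) (x, y) (s i))) =
      (\<Prod>i\<in>S. h (merge S (A - S) (x, y) i) (merge S (A - S) (x, y) (s i))) *
      (\<Prod>i\<in>A-S. h (merge S (A - S) (x, y) i) (merge S (A - S) (x, y) (s i)))"
    using S by (metis (no_types, lifting) mult.commute prod.subset_diff)
  also have "\<dots> = (\<Prod>i\<in>S. h (x i) (x (s i))) * (\<Prod>i\<in>A-S. h (y i) (y i))"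
    using sS permutes_in_image[OF sS] permutes_not_in[OF sS]
    by (intro arg_cong2[where f="(*)"] prod.cong) (auto simp: merge_def)
  finally show ?thesis .
qed

text \<open>The permutation acts on \<open>S\<close> and is the identity on \<open>A - S\<close>, so
  Tonelli splits the integral into a derangement part, worth \<open>e ^ card S\<close>, and one
  diagonal factor of at most \<open>t\<close> for each fixed point.\<close>

lemma nn_integral_permutation_le:
  assumes s: "s \<in> derangements_on S" and S: "S \<subseteq> A" "finite A"
  shows "(\<integral>\<^sup>+x. ennreal (\<Prod>i\<in>A. w (x i) * norm (\<kappa> (x i) (x (s i)))) \<partial>PiM A (\<lambda>_::nat. M)) \<le>
    ennreal (t ^ card (A - S) * e ^ card S)"
proof -
  have fin: "finite S" "finite (A - S)" using S finite_subset by auto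
  have sA: "s permutes A" by (rule derangements_on_mono_permutes[OF s S(1)])
  have sS: "s permutes S" using s by (auto simp: derangements_on_def)
  have A: "S \<union> (A - S) = A" using S by auto
  note [measurable] = perm_component_measurable[OF sA] perm_component_measurable[OF sS]
  let ?h = "\<lambda>x y. w x * norm (\<kappa> x y)"
  have nn: "0 \<le> ?h x y" for x y by (simp add: weight_nonneg)
  have m: "(\<lambda>x. ennreal (\<Prod>i\<in>A. ?h (x i) (x (s i)))) \<in> borel_measurable (PiM (S \<union> (A - S)) (\<lambda>_::nat. M))"
    unfolding A by measurable
  have "(\<integral>\<^sup>+x. ennreal (\<Prod>i\<in>A. ?h (x i) (x (s i))) \<partial>PiM A (\<lambda>_::nat. M)) =
     (\<integral>\<^sup>+x. \<integral>\<^sup>+y. ennreal (\<Prod>i\<in>A. ?h (merge S (A-S) (x, y) i) (merge S (A-S) (x, y) (s i))) \<partial>PiM (A-S) (\<lambda>_. M) \<partial>PiM S (\<lambda>_. M))"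
    by (rule P.product_nn_integral_fold[OF Diff_disjoint fin m, unfolded A])
  also have "\<dots> = (\<integral>\<^sup>+x. \<integral>\<^sup>+y. ennreal (\<Prod>i\<in>S. ?h (x i) (x (s i))) * (\<Prod>i\<in>A-S. ennreal (?h (y i) (y i))) \<partial>PiM (A-S) (\<lambda>_. M) \<partial>PiM S (\<lambda>_. M))"
    by (subst merge_prod_split[OF s S, where h="?h"]) (simp add: ennreal_mult' prod_ennreal prod_nonneg nn)
  also have "\<dots> = (\<integral>\<^sup>+x. ennreal (\<Prod>i\<in>S. ?h (x i) (x (s i))) \<partial>PiM S (\<lambda>_. M)) * (\<integral>\<^sup>+y. (\<Prod>i\<in>A-S. ennreal (?h (y i) (y i))) \<partial>PiM (A-S) (\<lambda>_. M))"
    by (subst nn_integral_cmult) (auto intro!: nn_integral_multc)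
  also have "(\<integral>\<^sup>+y. (\<Prod>i\<in>A-S. ennreal (?h (y i) (y i))) \<partial>PiM (A-S) (\<lambda>_. M)) = (\<Prod>i\<in>A-S. \<integral>\<^sup>+x. ennreal (?h x x) \<partial>M)"
    by (subst P.product_nn_integral_prod[OF fin(2), of "\<lambda>_ x. ennreal (?h x x)"]) auto
  also have "(\<integral>\<^sup>+x. ennreal (\<Prod>i\<in>S. ?h (x i) (x (s i))) \<partial>PiM S (\<lambda>_. M)) * \<dots> \<le> ennreal (e ^ card S) * (\<Prod>i\<in>A-S. ennreal t)"
    by (intro mult_mono nn_integral_derangement_weighted_le fin s) (auto intro!: prod_mono power_mono trace_le)
  also have "\<dots> = ennreal (t ^ card (A - S) * e ^ card S)"
    using te_nonneg by (simp add: ennreal_power ennreal_mult' mult.commute)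
  finally show ?thesis .
qed

text \<open>The same splitting as an exact identity. Integrability comes from the absolute bound,
  and all fixed points contribute the same diagonal integral.\<close>

lemma merge_permutation_integral:
  fixes u :: "'a \<Rightarrow> complex"
  assumes s: "s \<in> derangements_on S" and S: "S \<subseteq> A" "finite A"
    and [measurable]: "u \<in> borel_measurable M" and u: "\<And>x. norm (u x) \<le> w x"
  shows "integrable (PiM A (\<lambda>_::nat. M)) (\<lambda>x. \<Prod>i\<in>A. u (x i) * \<kappa> (x i) (x (s i)))"
    and "(\<integral>x. (\<Prod>i\<in>A. u (x i) * \<kappa> (x i) (x (s i))) \<partial>PiM A (\<lambda>_::nat. M)) =
      (\<integral>x. (\<Prod>i\<in>S. u (x i) * \<kappa> (x i) (x (s i))) \<partial>PiM S (\<lambda>_::nat. M)) * (\<integral>x. u x * \<kappa> x x \<partial>M) ^ card (A - S)"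
proof -
  have fin: "finite S" "finite (A - S)" using S finite_subset by auto
  have sA: "s permutes A" by (rule derangements_on_mono_permutes[OF s S(1)])
  have A: "S \<union> (A - S) = A" using S by auto
  note [measurable] = perm_component_measurable[OF sA]
  have "(\<integral>\<^sup>+x. ennreal (norm (\<Prod>i\<in>A. u (x i) * \<kappa> (x i) (x (s i)))) \<partial>PiM A (\<lambda>_::nat. M)) \<le>
      (\<integral>\<^sup>+x. ennreal (\<Prod>i\<in>A. w (x i) * norm (\<kappa> (x i) (x (s i)))) \<partial>PiM A (\<lambda>_::nat. M))"
    unfolding prod_norm[symmetric] norm_mult
    by (intro nn_integral_mono ennreal_leI prod_mono conjI mult_right_mono u) auto
  also have "\<dots> \<le> ennreal (t ^ card (A - S) * e ^ card S)"
    by (rule nn_integral_permutation_le[OF s S])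
  finally have "(\<integral>\<^sup>+x. ennreal (norm (\<Prod>i\<in>A. u (x i) * \<kappa> (x i) (x (s i)))) \<partial>PiM A (\<lambda>_::nat. M)) < \<infinity>"
    by (simp add: le_less_trans)
  then show int: "integrable (PiM A (\<lambda>_::nat. M)) (\<lambda>x. \<Prod>i\<in>A. u (x i) * \<kappa> (x i) (x (s i)))"
    by (intro integrableI_bounded) measurable
  have ui: "integrable M (\<lambda>x. u x * \<kappa> x x)"
  proof (rule integrableI_bounded)
    have "(\<integral>\<^sup>+x. ennreal (norm (u x * \<kappa> x x)) \<partial>M) \<le> (\<integral>\<^sup>+x. ennreal (w x * norm (\<kappa> x x)) \<partial>M)"
      unfolding norm_mult by (intro nn_integral_mono ennreal_leI mult_right_mono u) auto
    from order_trans[OF this trace_le] show "(\<integral>\<^sup>+x. ennreal (norm (u x * \<kappa> x x)) \<partial>M) < \<infinity>"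
      by (simp add: le_less_trans)
  qed measurable
  have "(\<integral>x. (\<Prod>i\<in>A. u (x i) * \<kappa> (x i) (x (s i))) \<partial>PiM A (\<lambda>_::nat. M)) =
     (\<integral>x. \<integral>y. (\<Prod>i\<in>A. u (merge S (A-S) (x, y) i) * \<kappa> (merge S (A-S) (x, y) i) (merge S (A-S) (x, y) (s i))) \<partial>PiM (A-S) (\<lambda>_. M) \<partial>PiM S (\<lambda>_. M))"
    by (rule P.product_integral_fold[OF Diff_disjoint fin, unfolded A, OF int])
  also have "\<dots> = (\<integral>x. \<integral>y. (\<Prod>i\<in>S. u (x i) * \<kappa> (x i) (x (s i))) * (\<Prod>i\<in>A-S. u (y i) * \<kappa> (y i) (y i)) \<partial>PiM (A-S) (\<lambda>_. M) \<partial>PiM S (\<lambda>_. M))"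
    by (subst merge_prod_split[OF s S, where h="\<lambda>x y. u x * \<kappa> x y"]) simp
  also have "\<dots> = (\<integral>x. (\<Prod>i\<in>S. u (x i) * \<kappa> (x i) (x (s i))) \<partial>PiM S (\<lambda>_. M)) * (\<integral>y. (\<Prod>i\<in>A-S. u (y i) * \<kappa> (y i) (y i)) \<partial>PiM (A-S) (\<lambda>_. M))"
    by simp
  also have "(\<integral>y. (\<Prod>i\<in>A-S. u (y i) * \<kappa> (y i) (y i)) \<partial>PiM (A-S) (\<lambda>_. M)) = (\<Prod>i\<in>A-S. \<integral>x. u x * \<kappa> x x \<partial>M)"
    by (subst P.product_integral_prod[OF fin(2), of "\<lambda>_ x. u x * \<kappa> x x"]) (auto intro: ui)
  finally show "(\<integral>x. (\<Prod>i\<in>A. u (x i) * \<kappa> (x i) (x (s i))) \<partial>PiM A (\<lambda>_::nat. M)) =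
      (\<integral>x. (\<Prod>i\<in>S. u (x i) * \<kappa> (x i) (x (s i))) \<partial>PiM S (\<lambda>_::nat. M)) * (\<integral>x. u x * \<kappa> x x \<partial>M) ^ card (A - S)"
    by simp
qed

text \<open>
  The sum over derangements is the Leibniz expansion of the determinant of the kernel with its diagonal
  replaced by zero.
\<close>

definition zero_diag_integral :: "('a \<Rightarrow> complex) \<Rightarrow> nat set \<Rightarrow> complex" where
  "zero_diag_integral u S =
     (\<Sum>s\<in>derangements_on S. of_int (sign s) * (\<integral>x. (\<Prod>i\<in>S. u (x i) * \<kappa> (x i) (x (s i))) \<partial>PiM S (\<lambda>_::nat. M)))"

text \<open>Relabelling by \<open>b\<close> conjugates derangements of \<open>S\<close> into
  derangements of \<open>T\<close> with the same sign, and the product measure is invariant under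
  it. So only the size of the set matters, and every set of \<open>j\<close> labels may be replaced
  by \<open>{..<j}\<close>.\<close>

lemma zero_diag_integral_reindex:
  fixes u :: "'a \<Rightarrow> complex"
  assumes fin: "finite S" and b: "bij_betw b S T" and [measurable]: "u \<in> borel_measurable M"
  shows "zero_diag_integral u T = zero_diag_integral u S"
proof -
  have finT: "finite T" using bij_betw_finite[OF b] fin by simp
  have inj: "inj_on b S" and im: "b ` S = T" using b by (auto simp: bij_betw_def)
  have inj': "inj_on (inv_into S b) T" using b bij_betw_inv_into bij_betw_imp_inj_on by blast
  have bT: "b j \<in> T" if "j \<in> S" for j using im that by auto
  have der1: "map_permutation S b s \<in> derangements_on T" if "s \<in> derangements_on S" for s
  proof -
    have s: "s permutes S" "\<And>i. i \<in> S \<Longrightarrow> s i \<noteq> i" using that by (auto simp: derangements_on_def)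
    have "map_permutation S b s (b i) \<noteq> b i" if "i \<in> S" for i
      using map_permutation_apply[OF inj, of i s] s(2)[OF that] that inj permutes_in_image[OF s(1), of i]
      by (auto simp: inj_on_def)
    then show ?thesis using map_permutation_permutes[OF b s(1)] im by (auto simp: derangements_on_def)
  qed
  have der2: "map_permutation T (inv_into S b) s \<in> derangements_on S" if "s \<in> derangements_on T" for s
  proof -
    have s: "s permutes T" "\<And>i. i \<in> T \<Longrightarrow> s i \<noteq> i" using that by (auto simp: derangements_on_def)
    have b': "bij_betw (inv_into S b) T S" by (rule bij_betw_inv_into[OF b])
    have "map_permutation T (inv_into S b) s (inv_into S b i) \<noteq> inv_into S b i" if "i \<in> T" for i
      using map_permutation_apply[OF inj', of i s] s(2)[OF that] that inj' permutes_in_image[OF s(1), of i]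
      by (auto simp: inj_on_def)
    moreover have "\<exists>j\<in>T. i = inv_into S b j" if "i \<in> S" for i
      using b' that by (auto simp: bij_betw_def)
    ultimately show ?thesis using map_permutation_permutes[OF b' s(1)]
      unfolding derangements_on_def by blast
  qed
  show ?thesis unfolding zero_diag_integral_def
  proof (rule sum.reindex_bij_witness[where i="map_permutation S b" and j="map_permutation T (inv_into S b)"])
    fix s assume s: "s \<in> derangements_on T"
    then have sT: "s permutes T" by (auto simp: derangements_on_def)
    show "map_permutation T (inv_into S b) s \<in> derangements_on S" by (rule der2[OF s])
    show backm: "map_permutation S b (map_permutation T (inv_into S b) s) = s"
      by (rule map_permutation_compose_inv[OF bij_betw_inv_into[OF b] sT])
         (use b im in \<open>auto simp: f_inv_into_f\<close>)
    let ?s = "map_permutation T (inv_into S b) s"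
    have ss: "?s permutes S" using der2[OF s] by (auto simp: derangements_on_def)
    have sg: "sign ?s = sign s" by (rule sign_map_permutation[OF inj' sT finT])
    have sb: "s (b i) = b (?s i)" if "i \<in> S" for i
      using map_permutation_apply[OF inj that, of ?s] backm by simp
    have si: "?s i \<in> S" if "i \<in> S" for i using permutes_in_image[OF ss] that by simp
    note [measurable] = perm_component_measurable[OF sT] perm_component_measurable[OF ss]
    have "(\<integral>x. (\<Prod>i\<in>S. u (x i) * \<kappa> (x i) (x (?s i))) \<partial>PiM S (\<lambda>_::nat. M)) =
       (\<integral>x. (\<Prod>i\<in>S. u (x i) * \<kappa> (x i) (x (?s i))) \<partial>distr (PiM T (\<lambda>_::nat. M)) (PiM S (\<lambda>_::nat. M)) (\<lambda>x. \<lambda>j\<in>S. x (b j)))"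
      by (subst P.distr_PiM_reindex_finite[OF b finT fin refl]) simp
    also have "\<dots> = (\<integral>x. (\<Prod>i\<in>S. u (x (b i)) * \<kappa> (x (b i)) (x (s (b i)))) \<partial>PiM T (\<lambda>_::nat. M))"
    proof (subst integral_distr)
      show "(\<lambda>x. \<lambda>j\<in>S. x (b j)) \<in> PiM T (\<lambda>_. M) \<rightarrow>\<^sub>M PiM S (\<lambda>_. M)"
        by (intro measurable_restrict measurable_component_singleton bT)
      show "(\<integral>x. (\<Prod>i\<in>S. u ((\<lambda>j\<in>S. x (b j)) i) * \<kappa> ((\<lambda>j\<in>S. x (b j)) i) ((\<lambda>j\<in>S. x (b j)) (?s i))) \<partial>PiM T (\<lambda>_. M)) =
         (\<integral>x. (\<Prod>i\<in>S. u (x (b i)) * \<kappa> (x (b i)) (x (s (b i)))) \<partial>PiM T (\<lambda>_::nat. M))"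
        by (intro Bochner_Integration.integral_cong refl prod.cong) (simp add: si sb)
    qed measurable
    also have "\<dots> = (\<integral>x. (\<Prod>i\<in>T. u (x i) * \<kappa> (x i) (x (s i))) \<partial>PiM T (\<lambda>_::nat. M))"
      by (subst prod.reindex_bij_betw[OF b, symmetric]) simp
    finally show "of_int (sign ?s) * (\<integral>x. (\<Prod>i\<in>S. u (x i) * \<kappa> (x i) (x (?s i))) \<partial>PiM S (\<lambda>_::nat. M)) =
       of_int (sign s) * (\<integral>x. (\<Prod>i\<in>T. u (x i) * \<kappa> (x i) (x (s i))) \<partial>PiM T (\<lambda>_::nat. M))"
      by (simp add: sg)
  next
    fix s assume s: "s \<in> derangements_on S"
    then have sS: "s permutes S" by (auto simp: derangements_on_def)
    show "map_permutation S b s \<in> derangements_on T" by (rule der1[OF s])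
    show "map_permutation T (inv_into S b) (map_permutation S b s) = s"
      by (rule map_permutation_compose_inv[OF b sS]) (use b in \<open>auto simp: bij_betw_def\<close>)
  qed
qed

lemma norm_zero_diag_integral_le:
  fixes u :: "'a \<Rightarrow> complex"
  assumes fin: "finite S" and u[measurable]: "u \<in> borel_measurable M" and ule: "\<And>x. norm (u x) \<le> w x"
  shows "norm (zero_diag_integral u S) \<le> fact (card S) * e ^ card S"
proof -
  have "norm (zero_diag_integral u S) \<le> (\<Sum>s\<in>derangements_on S. e ^ card S)"
    unfolding zero_diag_integral_def
  proof (rule sum_norm_le)
    fix s assume s: "s \<in> derangements_on S"
    let ?I = "\<lambda>x. \<Prod>i\<in>S. u (x i) * \<kappa> (x i) (x (s i))"
    have "ennreal (norm (\<integral>x. ?I x \<partial>PiM S (\<lambda>_::nat. M))) \<le> (\<integral>\<^sup>+x. ennreal (norm (?I x)) \<partial>PiM S (\<lambda>_::nat. M))"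
      by (rule integral_norm_bound_ennreal[OF merge_permutation_integral(1)[OF s order_refl fin u ule]])
    also have "\<dots> \<le> (\<integral>\<^sup>+x. ennreal (\<Prod>i\<in>S. w (x i) * norm (\<kappa> (x i) (x (s i)))) \<partial>PiM S (\<lambda>_::nat. M))"
      unfolding prod_norm[symmetric] norm_mult
      by (intro nn_integral_mono ennreal_leI prod_mono conjI mult_right_mono ule) auto
    also have "\<dots> \<le> ennreal (e ^ card S)" by (rule nn_integral_derangement_weighted_le[OF fin s])
    finally have "norm (\<integral>x. ?I x \<partial>PiM S (\<lambda>_::nat. M)) \<le> e ^ card S" using te_nonneg by simp
    then show "norm (of_int (sign s) * (\<integral>x. ?I x \<partial>PiM S (\<lambda>_::nat. M))) \<le> e ^ card S"
      by (cases s rule: sign_cases) (auto simp: norm_mult)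
  qed
  also have "\<dots> \<le> fact (card S) * e ^ card S"
  proof -
    have "real (card (derangements_on S)) \<le> real (fact (card S))"
      using card_derangements_on_le[OF fin] of_nat_le_iff by blast
    then show ?thesis using te_nonneg by (simp add: mult_right_mono)
  qed
  finally show ?thesis .
qed

section \<open>Determinants and their generating series\<close>

lemma correlation_det_eq:
  "correlation_det \<kappa> k x = (\<Sum>s | s permutes {..<k}. of_int (sign s) * (\<Prod>i<k. \<kappa> (x i) (x (s i))))"
proof -
  have "correlation_det \<kappa> k x = (\<Sum>s | s permutes {..<k}. of_int (sign s) *
      (\<Prod>i<k. Matrix.mat k k (\<lambda>(i, j). \<kappa> (x i) (x j)) $$ (i, s i)))"
    unfolding correlation_det_def by (subst det_def'[where n=k]) (auto simp: lessThan_atLeast0)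
  also have "\<dots> = (\<Sum>s | s permutes {..<k}. of_int (sign s) * (\<Prod>i<k. \<kappa> (x i) (x (s i))))"
  proof (intro sum.cong refl arg_cong2[where f="(*)"] prod.cong)
    fix s i assume "s \<in> {s. s permutes {..<k}}" "i \<in> {..<k}"
    then have "s i < k" "i < k" using permutes_in_image[of s "{..<k}" i] by auto
    then show "Matrix.mat k k (\<lambda>(i, j). \<kappa> (x i) (x j)) $$ (i, s i) = \<kappa> (x i) (x (s i))" by simp
  qed
  finally show ?thesis .
qed

lemma correlation_det_measurable[measurable]:
  "correlation_det \<kappa> k \<in> borel_measurable (PiM {..<k} (\<lambda>_::nat. M))"
  unfolding correlation_det_eq[abs_def]
  by (intro borel_measurable_sum borel_measurable_times borel_measurable_prod borel_measurable_const)
     (auto intro: perm_component_measurable)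

text \<open>A binomial convolution: \<open>j\<close> moved points are chosen out of
  \<open>k\<close>, and each of the \<open>k - j\<close> fixed points contributes the diagonal
  integral. Divided by \<open>fact k\<close> it is the coefficient of a Cauchy product.\<close>

lemma correlation_det_integral:
  fixes u :: "'a \<Rightarrow> complex"
  assumes u[measurable]: "u \<in> borel_measurable M" and ule: "\<And>x. norm (u x) \<le> w x"
  shows "(\<integral>x. (\<Prod>i<k. u (x i)) * correlation_det \<kappa> k x \<partial>PiM {..<k} (\<lambda>_::nat. M)) =
    (\<Sum>j\<le>k. of_nat (k choose j) * (zero_diag_integral u {..<j} * (\<integral>x. u x * \<kappa> x x \<partial>M) ^ (k - j)))"
proof -
  let ?A = "{..<k}" and ?T = "\<integral>x. u x * \<kappa> x x \<partial>M"
  let ?I = "\<lambda>S s x. \<Prod>i\<in>S. u (x i) * \<kappa> (x i) (x (s i))"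
  have "(\<integral>x. (\<Prod>i<k. u (x i)) * correlation_det \<kappa> k x \<partial>PiM ?A (\<lambda>_::nat. M)) =
     (\<integral>x. (\<Sum>S\<in>Pow ?A. \<Sum>s\<in>derangements_on S. of_int (sign s) * ?I ?A s x) \<partial>PiM ?A (\<lambda>_::nat. M))"
    unfolding correlation_det_eq sum_permutations_derangements[OF finite_lessThan] sum_distrib_left prod.distrib
    by (intro Bochner_Integration.integral_cong sum.cong refl mult.left_commute)
  also have "\<dots> = (\<Sum>S\<in>Pow ?A. \<Sum>s\<in>derangements_on S. of_int (sign s) * (\<integral>x. ?I ?A s x \<partial>PiM ?A (\<lambda>_::nat. M)))"
  proof -
    have i: "integrable (PiM ?A (\<lambda>_::nat. M)) (\<lambda>x. of_int (sign s) * ?I ?A s x)"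
      if "S \<in> Pow ?A" "s \<in> derangements_on S" for S s
      using that by (intro integrable_mult_right merge_permutation_integral(1)[OF that(2)] u ule) auto
    have "(\<integral>x. (\<Sum>S\<in>Pow ?A. \<Sum>s\<in>derangements_on S. of_int (sign s) * ?I ?A s x) \<partial>PiM ?A (\<lambda>_::nat. M)) =
       (\<Sum>S\<in>Pow ?A. \<integral>x. (\<Sum>s\<in>derangements_on S. of_int (sign s) * ?I ?A s x) \<partial>PiM ?A (\<lambda>_::nat. M))"
      by (intro Bochner_Integration.integral_sum Bochner_Integration.integrable_sum i)
    also have "\<dots> = (\<Sum>S\<in>Pow ?A. \<Sum>s\<in>derangements_on S. \<integral>x. of_int (sign s) * ?I ?A s x \<partial>PiM ?A (\<lambda>_::nat. M))"
      by (intro sum.cong refl Bochner_Integration.integral_sum i)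
    finally show ?thesis by simp
  qed
  also have "\<dots> = (\<Sum>S\<in>Pow ?A. zero_diag_integral u S * ?T ^ card (?A - S))"
    unfolding zero_diag_integral_def sum_distrib_right
    by (intro sum.cong refl) (use merge_permutation_integral(2)[OF _ _ _ u ule, of _ _ ?A] in auto)
  also have "\<dots> = (\<Sum>S\<in>Pow ?A. zero_diag_integral u {..<card S} * ?T ^ (k - card S))"
  proof (intro sum.cong refl)
    fix S assume S: "S \<in> Pow ?A"
    then have fS: "finite S" using finite_subset by auto
    obtain b where "bij_betw b {..<card S} S"
      using ex_bij_betw_nat_finite[OF fS] by (auto simp: lessThan_atLeast0)
    then have "zero_diag_integral u S = zero_diag_integral u {..<card S}"
      by (intro zero_diag_integral_reindex u) auto
    moreover have "card (?A - S) = k - card S" using S fS by (subst card_Diff_subset) auto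
    ultimately show "zero_diag_integral u S * ?T ^ card (?A - S) = zero_diag_integral u {..<card S} * ?T ^ (k - card S)"
      by simp
  qed
  also have "\<dots> = (\<Sum>j\<le>k. of_nat (k choose j) * (zero_diag_integral u {..<j} * ?T ^ (k - j)))"
    by (subst sum_Pow_card[of ?A "\<lambda>j. zero_diag_integral u {..<j} * ?T ^ (k - j)"]) simp_all
  finally show ?thesis .
qed

text \<open>The coefficients of \<open>exp (t z) / (1 - e z)\<close>.\<close>

definition majorant :: "nat \<Rightarrow> real" where
  "majorant k = (\<Sum>j\<le>k. e ^ j * (t ^ (k - j) / fact (k - j)))"

lemma summable_majorant:
  assumes "e < 1" shows "summable majorant"
proof -
  have "summable (\<lambda>k. norm (e ^ k))"
    using te_nonneg assms by (auto simp: summable_geometric)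
  moreover have "summable (\<lambda>k. norm (t ^ k / fact k))"
  proof -
    have "t ^ k /\<^sub>R fact k = t ^ k / fact k" for k by (simp add: divide_inverse mult.commute)
    then show ?thesis using summable_norm_exp[of t] by simp
  qed
  ultimately have "(\<lambda>k. \<Sum>j\<le>k. e ^ j * (t ^ (k - j) / fact (k - j))) sums ((\<Sum>k. e ^ k) * (\<Sum>k. t ^ k / fact k))"
    by (rule Cauchy_product_sums)
  then show ?thesis unfolding majorant_def[abs_def] by (rule sums_summable)
qed

text \<open>Signs are discarded. Choosing \<open>j\<close> moved points and one of at most
  \<open>j!\<close> derangements of them costs \<open>(k choose j) * j! = k! / (k - j)!\<close>,
  which leaves the coefficients of \<open>majorant\<close>. For a single \<open>k\<close> the size
  of \<open>e\<close> does not matter.\<close>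

lemma nn_integral_correlation_det_le:
  "(\<integral>\<^sup>+x. ennreal ((\<Prod>i<k. w (x i)) * norm (correlation_det \<kappa> k x)) \<partial>PiM {..<k} (\<lambda>_::nat. M)) \<le>
    ennreal (fact k * majorant k)"
proof -
  let ?A = "{..<k}"
  let ?I = "\<lambda>s x. \<Prod>i<k. w (x i) * norm (\<kappa> (x i) (x (s i)))"
  have "(\<integral>\<^sup>+x. ennreal ((\<Prod>i<k. w (x i)) * norm (correlation_det \<kappa> k x)) \<partial>PiM ?A (\<lambda>_::nat. M)) \<le>
     (\<integral>\<^sup>+x. (\<Sum>S\<in>Pow ?A. \<Sum>s\<in>derangements_on S. ennreal (?I s x)) \<partial>PiM ?A (\<lambda>_::nat. M))"
  proof (rule nn_integral_mono)
    fix x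
    have "norm (correlation_det \<kappa> k x) \<le> (\<Sum>s | s permutes ?A. \<Prod>i<k. norm (\<kappa> (x i) (x (s i))))"
      unfolding correlation_det_eq
    proof (rule sum_norm_le)
      fix s show "norm (of_int (sign s) * (\<Prod>i<k. \<kappa> (x i) (x (s i)))) \<le> (\<Prod>i<k. norm (\<kappa> (x i) (x (s i))))"
      proof -
        have "norm (of_int (sign s) :: complex) = 1" by (cases s rule: sign_cases) auto
        then have "norm (of_int (sign s) * (\<Prod>i<k. \<kappa> (x i) (x (s i)))) = norm (\<Prod>i<k. \<kappa> (x i) (x (s i)))"
          by (simp only: norm_mult mult_1)
        then show ?thesis by (simp only: prod_norm)
      qed
    qed
    then have "(\<Prod>i<k. w (x i)) * norm (correlation_det \<kappa> k x) \<le> (\<Prod>i<k. w (x i)) * (\<Sum>s | s permutes ?A. \<Prod>i<k. norm (\<kappa> (x i) (x (s i))))"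
      by (intro mult_left_mono prod_nonneg) (auto simp: weight_nonneg)
    also have "\<dots> = (\<Sum>S\<in>Pow ?A. \<Sum>s\<in>derangements_on S. ?I s x)"
      unfolding sum_distrib_left sum_permutations_derangements[OF finite_lessThan] prod.distrib ..
    finally have le: "(\<Prod>i<k. w (x i)) * norm (correlation_det \<kappa> k x) \<le> (\<Sum>S\<in>Pow ?A. \<Sum>s\<in>derangements_on S. ?I s x)" .
    show "ennreal ((\<Prod>i<k. w (x i)) * norm (correlation_det \<kappa> k x)) \<le> (\<Sum>S\<in>Pow ?A. \<Sum>s\<in>derangements_on S. ennreal (?I s x))"
    proof -
      have nn: "0 \<le> ?I s x" for s by (intro prod_nonneg) (auto simp: weight_nonneg)
      have "(\<Sum>S\<in>Pow ?A. \<Sum>s\<in>derangements_on S. ennreal (?I s x)) = ennreal (\<Sum>S\<in>Pow ?A. \<Sum>s\<in>derangements_on S. ?I s x)"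
        by (simp only: sum_ennreal nn sum_nonneg)
      then show ?thesis using le by (simp only: ennreal_leI)
    qed
  qed
  also have "\<dots> = (\<Sum>S\<in>Pow ?A. \<Sum>s\<in>derangements_on S. \<integral>\<^sup>+x. ennreal (?I s x) \<partial>PiM ?A (\<lambda>_::nat. M))"
  proof -
    have m: "(\<lambda>x. ennreal (?I s x)) \<in> borel_measurable (PiM ?A (\<lambda>_::nat. M))"
      if "s \<in> derangements_on S" "S \<subseteq> ?A" for s S
    proof -
      note [measurable] = perm_component_measurable[OF derangements_on_mono_permutes[OF that]]
      show ?thesis by measurable
    qed
    have "(\<integral>\<^sup>+x. (\<Sum>S\<in>Pow ?A. \<Sum>s\<in>derangements_on S. ennreal (?I s x)) \<partial>PiM ?A (\<lambda>_::nat. M)) =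
       (\<Sum>S\<in>Pow ?A. \<integral>\<^sup>+x. (\<Sum>s\<in>derangements_on S. ennreal (?I s x)) \<partial>PiM ?A (\<lambda>_::nat. M))"
      by (rule nn_integral_sum) (intro borel_measurable_sum m, auto)
    also have "\<dots> = (\<Sum>S\<in>Pow ?A. \<Sum>s\<in>derangements_on S. \<integral>\<^sup>+x. ennreal (?I s x) \<partial>PiM ?A (\<lambda>_::nat. M))"
      by (intro sum.cong refl nn_integral_sum m) auto
    finally show ?thesis .
  qed
  also have "\<dots> \<le> (\<Sum>S\<in>Pow ?A. \<Sum>s\<in>derangements_on S. ennreal (t ^ card (?A - S) * e ^ card S))"
    by (intro sum_mono nn_integral_permutation_le) auto
  also have "\<dots> = ennreal (\<Sum>S\<in>Pow ?A. \<Sum>s\<in>derangements_on S. t ^ card (?A - S) * e ^ card S)"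
  proof -
    have "0 \<le> t ^ card (?A - S) * e ^ card S" for S using te_nonneg by simp
    then show ?thesis by (simp only: sum_ennreal sum_nonneg)
  qed
  also have "\<dots> \<le> ennreal (\<Sum>S\<in>Pow ?A. fact (card S) * (t ^ (k - card S) * e ^ card S))"
  proof (intro ennreal_leI sum_mono)
    fix S assume S: "S \<in> Pow ?A"
    then have fS: "finite S" using finite_subset by auto
    have "card (?A - S) = k - card S" using S fS by (subst card_Diff_subset) auto
    moreover have "real (card (derangements_on S)) \<le> fact (card S)"
      using card_derangements_on_le[OF fS] by (metis of_nat_fact of_nat_le_iff)
    ultimately show "(\<Sum>s\<in>derangements_on S. t ^ card (?A - S) * e ^ card S) \<le> fact (card S) * (t ^ (k - card S) * e ^ card S)"
      using te_nonneg by (simp add: mult_right_mono)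
  qed
  also have "(\<Sum>S\<in>Pow ?A. fact (card S) * (t ^ (k - card S) * e ^ card S)) = fact k * majorant k"
    unfolding majorant_def sum_distrib_left
    by (subst sum_Pow_card[of ?A "\<lambda>j. fact j * (t ^ (k - j) * e ^ j)"])
       (simp_all, intro sum.cong refl, simp add: binomial_fact)
  finally show ?thesis .
qed

text \<open>The terms form the Cauchy product of the series of \<open>d j\<close>, the derangements
  of \<open>j\<close> points divided by \<open>j!\<close>, with the exponential series of the
  diagonal integral. Thus \<open>D\<close> is the sum of the \<open>d j\<close>, and
  \<open>t\<close> does not enter its distance to 1.\<close>

proposition fredholm_series:
  fixes u :: "'a \<Rightarrow> complex"
  assumes u[measurable]: "u \<in> borel_measurable M" and ule: "\<And>x. norm (u x) \<le> w x" and e: "e < 1"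
  obtains D where "norm (D - 1) \<le> e\<^sup>2 / (1 - e)"
    and "(\<lambda>k. (\<integral>x. (\<Prod>i<k. u (x i)) * correlation_det \<kappa> k x \<partial>PiM {..<k} (\<lambda>_::nat. M)) / fact k)
      sums (D * exp (\<integral>x. u x * \<kappa> x x \<partial>M))"
proof -
  let ?T = "\<integral>x. u x * \<kappa> x x \<partial>M"
  define d where "d = (\<lambda>j. zero_diag_integral u {..<j} / fact j)"
  have dle: "norm (d j) \<le> e ^ j" for j
  proof -
    have "norm (zero_diag_integral u {..<j}) \<le> fact j * e ^ j"
      using norm_zero_diag_integral_le[OF _ u ule, of "{..<j}"] by simp
    then have "norm (zero_diag_integral u {..<j}) / fact j \<le> e ^ j"
      by (simp add: divide_le_eq mult.commute)
    then show ?thesis by (simp add: d_def norm_divide)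
  qed
  have geo: "summable (\<lambda>j. e ^ j)" using te_nonneg e by (intro summable_geometric) simp
  have sd: "summable (\<lambda>j. norm (d j))"
    by (rule summable_comparison_test[OF _ geo]) (use dle in auto)
  have conv: "z /\<^sub>R fact k = z / fact k" for z :: complex and k
    by (simp add: scaleR_conv_of_real field_simps)
  have st: "summable (\<lambda>k. norm (?T ^ k / fact k))"
    using summable_norm_exp[of ?T] by (simp only: conv)
  have ex: "(\<Sum>k. ?T ^ k / fact k) = exp ?T"
    unfolding exp_def conv ..
  have "(\<lambda>k. \<Sum>j\<le>k. d j * (?T ^ (k - j) / fact (k - j))) sums ((\<Sum>j. d j) * exp ?T)"
    using Cauchy_product_sums[OF sd st] by (simp add: ex)
  moreover have "(\<Sum>j\<le>k. d j * (?T ^ (k - j) / fact (k - j))) =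
     (\<integral>x. (\<Prod>i<k. u (x i)) * correlation_det \<kappa> k x \<partial>PiM {..<k} (\<lambda>_::nat. M)) / fact k" for k
    unfolding correlation_det_integral[OF u ule] sum_divide_distrib
    by (intro sum.cong refl) (simp add: d_def binomial_fact)
  ultimately have "(\<lambda>k. (\<integral>x. (\<Prod>i<k. u (x i)) * correlation_det \<kappa> k x \<partial>PiM {..<k} (\<lambda>_::nat. M)) / fact k)
      sums ((\<Sum>j. d j) * exp ?T)" by simp
  moreover have "norm ((\<Sum>j. d j) - 1) \<le> e\<^sup>2 / (1 - e)"
  proof -
    \<comment> \<open>The empty permutation gives \<open>d 0 = 1\<close> and a single point has no
      derangement, so \<open>D - 1\<close> starts at \<open>j = 2\<close>; the geometric tail from
      there is \<open>e\<^sup>2 / (1 - e)\<close>.\<close>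
    have "derangements_on {} = {id::nat \<Rightarrow> nat}" by (auto simp: derangements_on_def)
    then have d0: "d 0 = 1" by (simp add: d_def zero_diag_integral_def PiM_empty lebesgue_integral_count_space_finite)
    have "derangements_on {..<1::nat} = {}"
    proof (rule equals0I)
      fix s assume "s \<in> derangements_on {..<1::nat}"
      then have "s permutes {..<1}" "s 0 \<noteq> 0" by (auto simp: derangements_on_def)
      then show False using permutes_in_image[of s "{..<1}" 0] by auto
    qed
    then have d1: "d 1 = 0" by (simp add: d_def zero_diag_integral_def)
    have sums: "summable d" by (rule summable_norm_cancel[OF sd])
    have "(\<Sum>j. d j) - 1 = (\<Sum>j. d (j + 2))"
      using suminf_split_initial_segment[OF sums, of 2] d0 d1 by (simp add: numeral_2_eq_2)
    also have "norm \<dots> \<le> (\<Sum>j. e ^ (j + 2))"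
      by (rule norm_suminf_le[OF dle summable_ignore_initial_segment[OF geo]])
    also have "\<dots> = (\<Sum>j. e\<^sup>2 * e ^ j)" by (simp only: power_add mult.commute)
    also have "\<dots> = e\<^sup>2 * (\<Sum>j. e ^ j)" by (rule suminf_mult[OF geo])
    also have "\<dots> = e\<^sup>2 / (1 - e)"
      using te_nonneg e by (simp add: suminf_geometric)
    finally show ?thesis .
  qed
  ultimately show thesis by (rule that[rotated])
qed

end

section \<open>Factorial moments\<close>

text \<open>Tuples are extensional, so that each ordered choice of \<open>k\<close> distinct labels
  is counted once.\<close>

definition inj_tuples :: "nat \<Rightarrow> 'i set \<Rightarrow> (nat \<Rightarrow> 'i) set" where
  "inj_tuples k A = {s \<in> {..<k} \<rightarrow>\<^sub>E A. inj_on s {..<k}}"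

lemma finite_inj_tuples: "finite A \<Longrightarrow> finite (inj_tuples k A)"
  unfolding inj_tuples_def by (simp add: finite_PiE)

lemma countable_inj_tuples: "countable (inj_tuples k (A :: 'i::countable set))"
  unfolding inj_tuples_def
  by (rule countable_subset[of _ "{..<k} \<rightarrow>\<^sub>E A"]) (auto intro!: countable_PiE)

lemma inj_tuples_mono: "A \<subseteq> B \<Longrightarrow> inj_tuples k A \<subseteq> inj_tuples k B"
  unfolding inj_tuples_def by (auto simp: PiE_iff)

text \<open>An injective tuple with image \<open>J\<close> is the fixed enumeration \<open>b\<close>
  composed with a permutation of the positions.\<close>

lemma card_bijective_tuples:
  assumes b: "bij_betw b {..<k} J"
  shows "card {s \<in> inj_tuples k A. s ` {..<k} = J} = (if J \<subseteq> A then fact k else 0)"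
proof (cases "J \<subseteq> A")
  case True
  have bij: "bij_betw (\<lambda>p. \<lambda>i\<in>{..<k}. b (p i)) {p. p permutes {..<k}} {s \<in> inj_tuples k A. s ` {..<k} = J}"
  proof (rule bij_betw_byWitness[where f'="\<lambda>s i. if i < k then inv_into {..<k} b (s i) else i"])
    show "\<forall>p\<in>{p. p permutes {..<k}}. (\<lambda>i. if i < k then inv_into {..<k} b ((\<lambda>i\<in>{..<k}. b (p i)) i) else i) = p"
    proof (intro ballI ext)
      fix p i assume "p \<in> {p. p permutes {..<k}}"
      then have p: "p permutes {..<k}" by simp
      show "(if i < k then inv_into {..<k} b ((\<lambda>i\<in>{..<k}. b (p i)) i) else i) = p i"
        using permutes_in_image[OF p, of i] permutes_not_in[OF p, of i] b by (auto simp: bij_betw_def)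
    qed
    show "\<forall>s\<in>{s \<in> inj_tuples k A. s ` {..<k} = J}. (\<lambda>i\<in>{..<k}. b ((\<lambda>i. if i < k then inv_into {..<k} b (s i) else i) i)) = s"
    proof
      fix s assume s: "s \<in> {s \<in> inj_tuples k A. s ` {..<k} = J}"
      show "(\<lambda>i\<in>{..<k}. b ((\<lambda>i. if i < k then inv_into {..<k} b (s i) else i) i)) = s"
      proof
        fix i
        have "s i \<in> J" if "i < k" using s that by auto
        then have "b (inv_into {..<k} b (s i)) = s i" if "i < k" using that b by (simp add: bij_betw_def f_inv_into_f)
        then show "(\<lambda>i\<in>{..<k}. b ((\<lambda>i. if i < k then inv_into {..<k} b (s i) else i) i)) i = s i"
          using s by (auto simp: inj_tuples_def PiE_def extensional_def)
      qed
    qed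
    show "(\<lambda>p. \<lambda>i\<in>{..<k}. b (p i)) ` {p. p permutes {..<k}} \<subseteq> {s \<in> inj_tuples k A. s ` {..<k} = J}"
    proof clarify
      fix p assume p: "p permutes {..<k}"
      have bp: "bij_betw (\<lambda>i. b (p i)) {..<k} J"
        using bij_betw_trans[OF permutes_imp_bij[OF p] b] by (simp add: o_def)
      then have im: "(\<lambda>i\<in>{..<k}. b (p i)) ` {..<k} = J" by (auto simp: bij_betw_def)
      then show "(\<lambda>i\<in>{..<k}. b (p i)) \<in> inj_tuples k A \<and> (\<lambda>i\<in>{..<k}. b (p i)) ` {..<k} = J"
        using bp True by (auto simp: inj_tuples_def bij_betw_def inj_on_def)
    qed
    show "(\<lambda>s i. if i < k then inv_into {..<k} b (s i) else i) ` {s \<in> inj_tuples k A. s ` {..<k} = J} \<subseteq> {p. p permutes {..<k}}"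
    proof (clarsimp)
      fix s assume s: "s \<in> inj_tuples k A" and J: "J = s ` {..<k}"
      have "bij_betw s {..<k} J" using s J by (auto simp: inj_tuples_def bij_betw_def)
      from bij_betw_trans[OF this bij_betw_inv_into[OF b]]
      have "bij_betw (\<lambda>i. if i < k then inv_into {..<k} b (s i) else i) {..<k} {..<k}"
        by (subst bij_betw_cong[of _ _ "inv_into {..<k} b \<circ> s"]) auto
      then show "(\<lambda>i. if i < k then inv_into {..<k} b (s i) else i) permutes {..<k}"
        by (rule bij_imp_permutes) simp
    qed
  qed
  show ?thesis using bij_betw_same_card[OF bij] card_permutations[OF card_lessThan finite_lessThan, of k] True by simp
next
  case False
  then have "{s \<in> inj_tuples k A. s ` {..<k} = J} = {}" by (auto simp: inj_tuples_def)
  then show ?thesis using False by (simp only: card.empty if_False)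
qed

lemma sum_inj_tuples:
  fixes a :: "'i \<Rightarrow> 'c::comm_semiring_1"
  assumes A: "finite A"
  shows "(\<Sum>s\<in>inj_tuples k A. \<Prod>i<k. a (s i)) = of_nat (fact k) * (\<Sum>J | J \<subseteq> A \<and> card J = k. prod a J)"
proof -
  have "(\<Sum>s\<in>inj_tuples k A. \<Prod>i<k. a (s i)) =
      (\<Sum>J | J \<subseteq> A \<and> card J = k. \<Sum>s\<in>{s \<in> inj_tuples k A. s ` {..<k} = J}. \<Prod>i<k. a (s i))"
  proof (rule sum.group[symmetric])
    show "finite (inj_tuples k A)" by (rule finite_inj_tuples[OF A])
    show "finite {J. J \<subseteq> A \<and> card J = k}" using A by (rule finite_subset[rotated, OF finite_Pow_iff[THEN iffD2]]) auto
    show "(\<lambda>s. s ` {..<k}) ` inj_tuples k A \<subseteq> {J. J \<subseteq> A \<and> card J = k}"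
    proof clarify
      fix s assume "s \<in> inj_tuples k A"
      then have "s ` {..<k} \<subseteq> A" "inj_on s {..<k}" by (auto simp: inj_tuples_def)
      then show "s ` {..<k} \<subseteq> A \<and> card (s ` {..<k}) = k" by (simp add: card_image)
    qed
  qed
  also have "\<dots> = (\<Sum>J | J \<subseteq> A \<and> card J = k. of_nat (fact k) * prod a J)"
  proof (rule sum.cong[OF refl])
    fix J assume J: "J \<in> {J. J \<subseteq> A \<and> card J = k}"
    then have "finite J" using A finite_subset by auto
    then obtain b where b: "bij_betw b {..<k} J"
      using ex_bij_betw_nat_finite[of J] J by (auto simp: lessThan_atLeast0)
    have "(\<Sum>s\<in>{s \<in> inj_tuples k A. s ` {..<k} = J}. \<Prod>i<k. a (s i)) = (\<Sum>s\<in>{s \<in> inj_tuples k A. s ` {..<k} = J}. prod a J)"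
    proof (rule sum.cong[OF refl])
      fix s assume "s \<in> {s \<in> inj_tuples k A. s ` {..<k} = J}"
      then have "inj_on s {..<k}" "s ` {..<k} = J" by (simp_all add: inj_tuples_def)
      then show "(\<Prod>i<k. a (s i)) = prod a J" using prod.reindex[of s "{..<k}" a] by (simp add: o_def)
    qed
    then show "(\<Sum>s\<in>{s \<in> inj_tuples k A. s ` {..<k} = J}. \<Prod>i<k. a (s i)) = of_nat (fact k) * prod a J"
      using card_bijective_tuples[OF b, of A] J by simp
  qed
  finally show ?thesis by (simp add: sum_distrib_left)
qed

text \<open>Links a product over points to factorial moments: each \<open>k\<close>-element set of
  labels in the expanded product is the image of \<open>k!\<close> injective tuples. The finite
  range keeps the expansion exact; the limit in \<open>m\<close> is taken later.\<close>

lemma prod_one_plus_inj_tuples: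
  fixes a :: "nat \<Rightarrow> complex"
  shows "(\<Prod>n<m. 1 + a n) = (\<Sum>k\<le>m. (\<Sum>s\<in>inj_tuples k {..<m}. \<Prod>i<k. a (s i)) / fact k)"
proof -
  have "(\<Prod>n<m. 1 + a n) = (\<Prod>n<m. a n + 1)" by (simp add: add.commute)
  also have "\<dots> = (\<Sum>J\<in>Pow {..<m}. prod a J)"
    by (subst prod_add) auto
  also have "\<dots> = (\<Sum>k\<le>m. \<Sum>J\<in>{J \<in> Pow {..<m}. card J = k}. prod a J)"
    by (rule sum.group[symmetric]) (use card_mono[OF finite_lessThan, of _ m] in auto)
  also have "\<dots> = (\<Sum>k\<le>m. (\<Sum>s\<in>inj_tuples k {..<m}. \<Prod>i<k. a (s i)) / fact k)"
  proof (rule sum.cong[OF refl])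
    fix k
    have "{J \<in> Pow {..<m}. card J = k} = {J. J \<subseteq> {..<m} \<and> card J = k}" by auto
    then show "(\<Sum>J\<in>{J \<in> Pow {..<m}. card J = k}. prod a J) = (\<Sum>s\<in>inj_tuples k {..<m}. \<Prod>i<k. a (s i)) / fact k"
      by (subst sum_inj_tuples) (auto simp: fact_nonzero)
  qed
  finally show ?thesis .
qed

text \<open>
  Measures on \<open>k\<close>-tuples that do not charge the diagonals are determined by the rectangles with
  disjoint sides: a rectangle is cut along the finite partitions generated by the first \<open>m\<close> sets of
  a countable basis, and the cells with distinct indices exhaust the complement of the diagonals.
\<close>

lemma measure_eqI_disjoint_rectangles:
  fixes \<nu>1 \<nu>2 :: "(nat \<Rightarrow> 'a::euclidean_space) measure"
  assumes sets: "sets \<nu>1 = sets (PiM {..<k} (\<lambda>_. borel))" "sets \<nu>2 = sets (PiM {..<k} (\<lambda>_. borel))"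
    and diag: "AE x in \<nu>1. inj_on x {..<k}" "AE x in \<nu>2. inj_on x {..<k}"
    and eq: "\<And>D. (\<And>i. i < k \<Longrightarrow> D i \<in> sets borel) \<Longrightarrow> disjoint_family_on D {..<k} \<Longrightarrow>
       emeasure \<nu>1 (PiE {..<k} D) = emeasure \<nu>2 (PiE {..<k} D)"
    and fin: "\<And>n::nat. emeasure \<nu>1 (PiE {..<k} (\<lambda>_. cball 0 (real n))) \<noteq> \<infinity>"
  shows "\<nu>1 = \<nu>2"
proof -
  obtain B :: "'a set set" where B: "countable B" "topological_basis B"
    using ex_countable_basis by auto
  have Bne: "B \<noteq> {}" using topological_basisE[OF B(2) open_UNIV UNIV_I] by blast
  define U where "U = from_nat_into B"
  have Ub: "U l \<in> sets borel" for l
    using topological_basis_open[OF B(2)] from_nat_into[OF Bne, of l] by (auto simp: U_def)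
  \<comment> \<open>The code of \<open>x\<close> at level \<open>m\<close> records which of the
    first \<open>m\<close> basic sets contain it; its fibres are the cells of the partition.\<close>
  define c where "c = (\<lambda>m (x::'a). {l. l < m \<and> x \<in> U l})"
  have sep: "\<exists>l. (x \<in> U l) \<noteq> (y \<in> U l)" if "x \<noteq> y" for x y
  proof -
    obtain V where V: "open V" "x \<in> V" "y \<notin> V" using t1_space_class.t1_space[OF \<open>x \<noteq> y\<close>] by blast
    then obtain b where "b \<in> B" "x \<in> b" "b \<subseteq> V" by (meson topological_basisE[OF B(2)])
    moreover then obtain l where "U l = b" using from_nat_into_surj[OF B(1)] by (auto simp: U_def)
    ultimately show ?thesis using V by blast
  qed
  \<comment> \<open>Tuples whose points are told apart at level \<open>m\<close>. These sets
    increase with \<open>m\<close>, since a finer code never merges two points, and every injective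
    tuple lies in one of them.\<close>
  define E where "E = (\<lambda>m. {x :: nat \<Rightarrow> 'a. inj_on (\<lambda>i. c m (x i)) {..<k}})"
  have cmono: "c m x \<noteq> c m y" if "c n x \<noteq> c n y" "n \<le> m" for n m x y
  proof
    assume eq: "c m x = c m y"
    have "(x \<in> U l) = (y \<in> U l)" if "l < n" for l
    proof -
      have "l \<in> c m x \<longleftrightarrow> l \<in> c m y" by (simp only: eq)
      then show ?thesis using \<open>l < n\<close> \<open>n \<le> m\<close> by (simp add: c_def)
    qed
    then have "c n x = c n y" unfolding c_def by blast
    then show False using that(1) by contradiction
  qed
  have Eincr: "incseq E"
    unfolding E_def incseq_def inj_on_def using cmono by blast
  have Eall: "x \<in> (\<Union>m. E m)" if "inj_on x {..<k}" for x
  proof -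
    have "\<exists>m. c m (x i) \<noteq> c m (x j)" if ij: "i < k" "j < k" "i \<noteq> j" for i j
    proof -
      have "x i \<noteq> x j" using \<open>inj_on x {..<k}\<close> ij by (auto simp: inj_on_def)
      then obtain l where "(x i \<in> U l) \<noteq> (x j \<in> U l)" using sep by blast
      then have "c (Suc l) (x i) \<noteq> c (Suc l) (x j)" by (auto simp: c_def)
      then show ?thesis by blast
    qed
    then obtain m where m: "\<And>i j. i < k \<Longrightarrow> j < k \<Longrightarrow> i \<noteq> j \<Longrightarrow> c (m i j) (x i) \<noteq> c (m i j) (x j)" by metis
    \<comment> \<open>Only an upper bound for all the \<open>m i j\<close> is wanted, and their sum
      is one.\<close>
    define M where "M = (\<Sum>i<k. \<Sum>j<k. m i j)"
    have "m i j \<le> M" if "i < k" "j < k" for i j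
    proof -
      have "m i j \<le> (\<Sum>j<k. m i j)" by (rule member_le_sum) (use that in auto)
      also have "\<dots> \<le> M" unfolding M_def by (rule member_le_sum) (use that in auto)
      finally show ?thesis .
    qed
    then have "x \<in> E M" using m cmono unfolding E_def inj_on_def by blast
    then show ?thesis by blast
  qed
  have cell: "c m -` {q} \<in> sets borel" for m q
  proof (cases "q \<subseteq> {..<m}")
    case True
    have "c m x = q \<longleftrightarrow> (\<forall>l\<in>{..<m}. (x \<in> U l) = (l \<in> q))" for x
      using True unfolding c_def by blast
    then have "c m -` {q} = {x\<in>space borel. \<forall>l\<in>{..<m}. (x \<in> U l) = (l \<in> q)}"
      by (simp add: vimage_def)
    also have "\<dots> \<in> sets borel"
      using Ub[measurable] by measurable
    finally show ?thesis .
  next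
    case False
    then have "c m -` {q} = {}" by (auto simp: c_def)
    then show ?thesis by simp
  qed
  have part: "emeasure \<nu> (PiE {..<k} A \<inter> E m) = (\<Sum>q\<in>inj_tuples k (Pow {..<m}). emeasure \<nu> (PiE {..<k} (\<lambda>i. A i \<inter> c m -` {q i})))"
    and Emeas: "PiE {..<k} A \<inter> E m \<in> sets \<nu>"
    if s: "sets \<nu> = sets (PiM {..<k} (\<lambda>_. borel))" and A: "\<And>i. i < k \<Longrightarrow> A i \<in> sets borel" for \<nu> A m
  proof -
    have eqs: "PiE {..<k} A \<inter> E m = (\<Union>q\<in>inj_tuples k (Pow {..<m}). PiE {..<k} (\<lambda>i. A i \<inter> c m -` {q i}))"
    proof (intro equalityI subsetI)
      fix x assume x: "x \<in> PiE {..<k} A \<inter> E m"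
      define q where "q = (\<lambda>i\<in>{..<k}. c m (x i))"
      have "q \<in> inj_tuples k (Pow {..<m})" using x by (auto simp: inj_tuples_def q_def E_def inj_on_def c_def)
      moreover have "x \<in> PiE {..<k} (\<lambda>i. A i \<inter> c m -` {q i})" using x by (auto simp: q_def PiE_iff)
      ultimately show "x \<in> (\<Union>q\<in>inj_tuples k (Pow {..<m}). PiE {..<k} (\<lambda>i. A i \<inter> c m -` {q i}))" by blast
    next
      fix x assume "x \<in> (\<Union>q\<in>inj_tuples k (Pow {..<m}). PiE {..<k} (\<lambda>i. A i \<inter> c m -` {q i}))"
      then show "x \<in> PiE {..<k} A \<inter> E m" by (auto simp: inj_tuples_def E_def inj_on_def PiE_iff)
    qed
    have ms: "PiE {..<k} (\<lambda>i. A i \<inter> c m -` {q i}) \<in> sets \<nu>" for q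
      unfolding s by (intro sets_PiM_I_finite) (auto intro!: sets.Int A cell)
    show "PiE {..<k} A \<inter> E m \<in> sets \<nu>"
      unfolding eqs by (intro sets.finite_UN finite_inj_tuples ms) simp
    show "emeasure \<nu> (PiE {..<k} A \<inter> E m) = (\<Sum>q\<in>inj_tuples k (Pow {..<m}). emeasure \<nu> (PiE {..<k} (\<lambda>i. A i \<inter> c m -` {q i})))"
      unfolding eqs
    proof (rule sum_emeasure[symmetric])
      show "disjoint_family_on (\<lambda>q. PiE {..<k} (\<lambda>i. A i \<inter> c m -` {q i})) (inj_tuples k (Pow {..<m}))"
        unfolding disjoint_family_on_def
      proof (intro ballI impI)
        fix q q' assume q: "q \<in> inj_tuples k (Pow {..<m})" "q' \<in> inj_tuples k (Pow {..<m})" "q \<noteq> q'"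
        have "\<exists>i\<in>{..<k}. q i \<noteq> q' i"
        proof (rule ccontr)
          assume "\<not> (\<exists>i\<in>{..<k}. q i \<noteq> q' i)"
          then have "q = q'" using q(1,2) by (intro PiE_ext[of q "{..<k}" "\<lambda>_. Pow {..<m}"]) (auto simp: inj_tuples_def)
          then show False using q(3) by contradiction
        qed
        then obtain i where "i < k" "q i \<noteq> q' i" by auto
        then show "PiE {..<k} (\<lambda>i. A i \<inter> c m -` {q i}) \<inter> PiE {..<k} (\<lambda>i. A i \<inter> c m -` {q' i}) = {}"
          by (auto simp: PiE_iff)
      qed
    qed (auto intro: finite_inj_tuples ms)
  qed
  have sup: "emeasure \<nu> (PiE {..<k} A) = (SUP m. emeasure \<nu> (PiE {..<k} A \<inter> E m))"
    if s: "sets \<nu> = sets (PiM {..<k} (\<lambda>_. borel))" and ae: "AE x in \<nu>. inj_on x {..<k}"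
      and A: "\<And>i. i < k \<Longrightarrow> A i \<in> sets borel" for \<nu> A
  proof -
    have "(SUP m. emeasure \<nu> (PiE {..<k} A \<inter> E m)) = emeasure \<nu> (\<Union>m. PiE {..<k} A \<inter> E m)"
      using Eincr by (intro SUP_emeasure_incseq) (auto intro!: Emeas s A simp: incseq_def)
    also have "\<dots> = emeasure \<nu> (PiE {..<k} A)"
    proof (rule emeasure_eq_AE)
      show "AE x in \<nu>. x \<in> (\<Union>m. PiE {..<k} A \<inter> E m) \<longleftrightarrow> x \<in> PiE {..<k} A"
        using ae by eventually_elim (use Eall in blast)
      show "(\<Union>m. PiE {..<k} A \<inter> E m) \<in> sets \<nu>" by (intro sets.countable_UN) (auto intro!: Emeas s A)
      show "PiE {..<k} A \<in> sets \<nu>" unfolding s by (intro sets_PiM_I_finite) (auto intro: A)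
    qed
    finally show ?thesis ..
  qed
  show ?thesis
  proof (rule measure_eqI_PiM_finite[OF finite_lessThan sets])
    fix A :: "nat \<Rightarrow> 'a set" assume "\<And>i. i \<in> {..<k} \<Longrightarrow> A i \<in> sets borel"
    then have A: "\<And>i. i < k \<Longrightarrow> A i \<in> sets borel" by simp
    have "emeasure \<nu>1 (PiE {..<k} A \<inter> E m) = emeasure \<nu>2 (PiE {..<k} A \<inter> E m)" for m
    proof -
      have "emeasure \<nu>1 (PiE {..<k} (\<lambda>i. A i \<inter> c m -` {q i})) = emeasure \<nu>2 (PiE {..<k} (\<lambda>i. A i \<inter> c m -` {q i}))"
        if q: "q \<in> inj_tuples k (Pow {..<m})" for q
      proof (rule eq)
        show "disjoint_family_on (\<lambda>i. A i \<inter> c m -` {q i}) {..<k}"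
          using q by (auto simp: disjoint_family_on_def inj_tuples_def inj_on_def)
        show "A i \<inter> c m -` {q i} \<in> sets borel" if "i < k" for i
          using A[OF that] cell by (intro sets.Int)
      qed
      then have "(\<Sum>q\<in>inj_tuples k (Pow {..<m}). emeasure \<nu>1 (PiE {..<k} (\<lambda>i. A i \<inter> c m -` {q i}))) =
          (\<Sum>q\<in>inj_tuples k (Pow {..<m}). emeasure \<nu>2 (PiE {..<k} (\<lambda>i. A i \<inter> c m -` {q i})))"
        by (rule sum.cong[OF refl])
      then show ?thesis
        using part[of \<nu>1 A m, OF sets(1) A] part[of \<nu>2 A m, OF sets(2) A] by simp
    qed
    then show "emeasure \<nu>1 (PiE {..<k} A) = emeasure \<nu>2 (PiE {..<k} A)"
      using sup[of \<nu>1 A, OF sets(1) diag(1) A] sup[of \<nu>2 A, OF sets(2) diag(2) A] by simp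
  next
    \<comment> \<open>Products of balls cover the space and have finite mass by \<open>fin\<close>,
      as uniqueness of a measure given on boxes requires.\<close>
    define C where "C = (\<lambda>n::nat. PiE {..<k} (\<lambda>_. cball (0::'a) (real n)))"
    show "range C \<subseteq> prod_algebra {..<k} (\<lambda>_. borel)"
      unfolding C_def by (auto intro!: prod_algebraI_finite)
    show "emeasure \<nu>1 (C n) \<noteq> \<infinity>" for n unfolding C_def by (rule fin)
    show "(\<Union>n. C n) = space (PiM {..<k} (\<lambda>_. borel))"
    proof (intro equalityI subsetI)
      fix x :: "nat \<Rightarrow> 'a" assume x: "x \<in> space (PiM {..<k} (\<lambda>_. borel))"
      obtain n :: nat where n: "(\<Sum>i<k. norm (x i)) \<le> real n" using real_arch_simple by blast
      have "norm (x i) \<le> real n" if "i < k" for i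
      proof -
        have "norm (x i) \<le> (\<Sum>i<k. norm (x i))" by (rule member_le_sum) (use that in auto)
        then show ?thesis using n by simp
      qed
      then show "x \<in> (\<Union>n. C n)" using x by (auto simp: C_def space_PiM PiE_iff)
    qed (auto simp: C_def space_PiM)
  qed
qed

text \<open>The enumeration comes with the marking. Labels from \<open>N\<close> on carry arbitrary
  values of \<open>X\<close>, so every sum over labels has to be cut off by
  \<open>enat n < N \<omega>\<close>.\<close>

locale enumerated_points = prob_space P for P :: "'w measure" +
  fixes N :: "'w \<Rightarrow> enat" and X :: "nat \<Rightarrow> 'w \<Rightarrow> 'a::euclidean_space" and \<phi> :: "'w \<Rightarrow> 'a set"
  assumes N_measurable[measurable]: "N \<in> P \<rightarrow>\<^sub>M count_space UNIV"
    and X_measurable[measurable]: "\<And>n. X n \<in> borel_measurable P"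
    and X_inj: "\<And>\<omega>. \<omega> \<in> space P \<Longrightarrow> inj_on (\<lambda>n. X n \<omega>) {n. enat n < N \<omega>}"
    and points_eq: "\<And>\<omega>. \<omega> \<in> space P \<Longrightarrow> \<phi> \<omega> = (\<lambda>n. X n \<omega>) ` {n. enat n < N \<omega>}"
begin

definition active :: "nat \<Rightarrow> (nat \<Rightarrow> nat) \<Rightarrow> 'w \<Rightarrow> bool" where
  "active k s \<omega> \<longleftrightarrow> (\<forall>i<k. enat (s i) < N \<omega>)"

lemma active_measurable[measurable]: "Measurable.pred P (active k s)"
  unfolding active_def by measurable

definition tuple :: "nat \<Rightarrow> (nat \<Rightarrow> nat) \<Rightarrow> 'w \<Rightarrow> nat \<Rightarrow> 'a" where
  "tuple k s \<omega> = (\<lambda>i\<in>{..<k}. X (s i) \<omega>)"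

lemma tuple_measurable[measurable]: "tuple k s \<in> P \<rightarrow>\<^sub>M PiM {..<k} (\<lambda>_. borel)"
  unfolding tuple_def by measurable

text \<open>The intensity measure of the ordered \<open>k\<close>-tuples of distinct points:
  \<open>count_space\<close> sums over tuples of labels, and the density removes the labels that are
  not in use.\<close>

definition factorial_moment :: "nat \<Rightarrow> (nat \<Rightarrow> 'a) measure" where
  "factorial_moment k = distr
     (density (count_space (inj_tuples k UNIV) \<Otimes>\<^sub>M P) (\<lambda>p. ennreal (of_bool (active k (fst p) (snd p)))))
     (PiM {..<k} (\<lambda>_. borel)) (\<lambda>p. tuple k (fst p) (snd p))"

lemma sets_factorial_moment[measurable_cong]: "sets (factorial_moment k) = sets (PiM {..<k} (\<lambda>_. borel))"
  by (simp add: factorial_moment_def)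

lemma active_pair_measurable[measurable]:
  "(\<lambda>p. active k (fst p) (snd p)) \<in> count_space (inj_tuples k UNIV) \<Otimes>\<^sub>M P \<rightarrow>\<^sub>M count_space UNIV"
  by (rule measurable_pair_measure_countable1[OF countable_inj_tuples]) simp

lemma tuple_pair_measurable[measurable]:
  "(\<lambda>p. tuple k (fst p) (snd p)) \<in> count_space (inj_tuples k UNIV) \<Otimes>\<^sub>M P \<rightarrow>\<^sub>M PiM {..<k} (\<lambda>_. borel)"
  by (rule measurable_pair_measure_countable1[OF countable_inj_tuples]) simp

lemma nn_integral_factorial_moment:
  assumes [measurable]: "u \<in> borel_measurable (PiM {..<k} (\<lambda>_. borel))"
  shows "(\<integral>\<^sup>+x. u x \<partial>factorial_moment k) =
    (\<integral>\<^sup>+s. \<integral>\<^sup>+\<omega>. of_bool (active k s \<omega>) * u (tuple k s \<omega>) \<partial>P \<partial>count_space (inj_tuples k UNIV))"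
proof -
  have ob: "ennreal (of_bool b) = of_bool b" for b by (cases b) simp_all
  have "(\<integral>\<^sup>+x. u x \<partial>factorial_moment k) =
     (\<integral>\<^sup>+p. ennreal (of_bool (active k (fst p) (snd p))) * u (tuple k (fst p) (snd p)) \<partial>(count_space (inj_tuples k UNIV) \<Otimes>\<^sub>M P))"
    unfolding factorial_moment_def
    by (subst nn_integral_distr, simp, simp, subst nn_integral_density) simp_all
  also have "\<dots> = (\<integral>\<^sup>+s. \<integral>\<^sup>+\<omega>. ennreal (of_bool (active k s \<omega>)) * u (tuple k s \<omega>) \<partial>P \<partial>count_space (inj_tuples k UNIV))"
    by (subst nn_integral_fst[symmetric]) simp_all
  finally show ?thesis by (simp only: ob)
qed

lemma integral_factorial_moment:
  fixes u :: "(nat \<Rightarrow> 'a) \<Rightarrow> complex"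
  assumes int: "integrable (factorial_moment k) u"
  shows "(\<integral>x. u x \<partial>factorial_moment k) =
    (\<integral>s. \<integral>\<omega>. of_bool (active k s \<omega>) * u (tuple k s \<omega>) \<partial>P \<partial>count_space (inj_tuples k UNIV))"
    and "integrable (count_space (inj_tuples k UNIV)) (\<lambda>s. \<integral>\<omega>. of_bool (active k s \<omega>) * u (tuple k s \<omega>) \<partial>P)"
proof -
  let ?C = "count_space (inj_tuples k (UNIV :: nat set))"
  interpret C: sigma_finite_measure ?C by (rule sigma_finite_measure_count_space_countable[OF countable_inj_tuples])
  interpret pair_sigma_finite ?C P by standard
  have [measurable]: "u \<in> borel_measurable (PiM {..<k} (\<lambda>_. borel))"
    using borel_measurable_integrable[OF int] by simp
  have ob: "of_bool b *\<^sub>R z = of_bool b * z" for b and z :: complex by (cases b) simp_all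
  have i: "integrable (?C \<Otimes>\<^sub>M P) (\<lambda>p. of_bool (active k (fst p) (snd p)) *\<^sub>R u (tuple k (fst p) (snd p)))"
    using int unfolding factorial_moment_def
    by (subst (asm) integrable_distr_eq, simp, simp, subst (asm) integrable_density) simp_all
  then have i': "integrable (?C \<Otimes>\<^sub>M P) (\<lambda>(s, \<omega>). of_bool (active k s \<omega>) * u (tuple k s \<omega>))"
    by (simp only: ob split_beta')
  have "(\<integral>x. u x \<partial>factorial_moment k) =
     (\<integral>p. of_bool (active k (fst p) (snd p)) *\<^sub>R u (tuple k (fst p) (snd p)) \<partial>(?C \<Otimes>\<^sub>M P))"
    unfolding factorial_moment_def
    by (subst integral_distr, simp, simp, subst integral_density) simp_all
  also have "\<dots> = (\<integral>(s, \<omega>). of_bool (active k s \<omega>) * u (tuple k s \<omega>) \<partial>(?C \<Otimes>\<^sub>M P))"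
    by (simp only: ob split_beta')
  also have "\<dots> = (\<integral>s. \<integral>\<omega>. of_bool (active k s \<omega>) * u (tuple k s \<omega>) \<partial>P \<partial>?C)"
    using integral_fst'[OF i'] by simp
  finally show "(\<integral>x. u x \<partial>factorial_moment k) = (\<integral>s. \<integral>\<omega>. of_bool (active k s \<omega>) * u (tuple k s \<omega>) \<partial>P \<partial>?C)" .
  show "integrable ?C (\<lambda>s. \<integral>\<omega>. of_bool (active k s \<omega>) * u (tuple k s \<omega>) \<partial>P)"
    using integrable_fst'[OF i'] by simp
qed

lemma number_of_points_eq:
  assumes \<omega>: "\<omega> \<in> space P"
  shows "number_of_points (\<phi> \<omega>) D = (\<integral>\<^sup>+n. of_bool (enat n < N \<omega> \<and> X n \<omega> \<in> D) \<partial>count_space UNIV)"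
proof -
  define A where "A = {n. enat n < N \<omega> \<and> X n \<omega> \<in> D}"
  have eq: "\<phi> \<omega> \<inter> D = (\<lambda>n. X n \<omega>) ` A" unfolding points_eq[OF \<omega>] A_def by auto
  have inj: "inj_on (\<lambda>n. X n \<omega>) A" using X_inj[OF \<omega>] by (rule inj_on_subset) (auto simp: A_def)
  have "emeasure (count_space UNIV) (\<phi> \<omega> \<inter> D) = emeasure (count_space UNIV) A"
  proof (cases "finite A")
    case True
    then show ?thesis unfolding eq by (simp add: card_image[OF inj])
  next
    case False
    then have "infinite ((\<lambda>n. X n \<omega>) ` A)" using finite_image_iff[OF inj] by simp
    then show ?thesis unfolding eq using False by simp
  qed
  also have "\<dots> = (\<integral>\<^sup>+n. indicator A n \<partial>count_space UNIV)" by simp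
  also have "\<dots> = (\<integral>\<^sup>+n. of_bool (enat n < N \<omega> \<and> X n \<omega> \<in> D) \<partial>count_space UNIV)"
    by (intro nn_integral_cong) (simp add: A_def indicator_def)
  finally show ?thesis by (simp add: number_of_points_def)
qed

text \<open>Disjointness of the sides makes injectivity automatic, since no point lies in two sides.
  So the sum over injective tuples of labels equals the sum over all tuples, which factors into the
  counts of the single sides.\<close>

lemma emeasure_factorial_moment_rectangle:
  assumes D: "\<And>i. i < k \<Longrightarrow> D i \<in> sets borel" and disj: "disjoint_family_on D {..<k}"
  shows "emeasure (factorial_moment k) (PiE {..<k} D) = (\<integral>\<^sup>+\<omega>. (\<Prod>i<k. number_of_points (\<phi> \<omega>) (D i)) \<partial>P)"
proof -
  let ?C = "count_space (inj_tuples k (UNIV :: nat set))"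
  interpret C: sigma_finite_measure ?C by (rule sigma_finite_measure_count_space_countable[OF countable_inj_tuples])
  interpret CP: pair_sigma_finite ?C P by standard
  interpret nat: sigma_finite_measure "count_space (UNIV :: nat set)" by (rule sigma_finite_measure_count_space_countable) simp
  interpret PC: product_sigma_finite "\<lambda>_::nat. count_space (UNIV :: nat set)" by standard
  have R[measurable]: "PiE {..<k} D \<in> sets (PiM {..<k} (\<lambda>_. borel))"
    by (intro sets_PiM_I_finite) (auto intro: D)
  have "emeasure (factorial_moment k) (PiE {..<k} D) = (\<integral>\<^sup>+x. indicator (PiE {..<k} D) x \<partial>factorial_moment k)"
    by (subst nn_integral_indicator) (simp_all add: sets_factorial_moment)
  also have "\<dots> = (\<integral>\<^sup>+s. \<integral>\<^sup>+\<omega>. of_bool (active k s \<omega>) * indicator (PiE {..<k} D) (tuple k s \<omega>) \<partial>P \<partial>?C)"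
    by (rule nn_integral_factorial_moment) simp
  also have "\<dots> = (\<integral>\<^sup>+\<omega>. \<integral>\<^sup>+s. of_bool (active k s \<omega>) * indicator (PiE {..<k} D) (tuple k s \<omega>) \<partial>?C \<partial>P)"
  proof (rule CP.Fubini'[symmetric])
    show "(\<lambda>(s, \<omega>). of_bool (active k s \<omega>) * indicator (PiE {..<k} D) (tuple k s \<omega>) :: ennreal) \<in> borel_measurable (?C \<Otimes>\<^sub>M P)"
      by (rule measurable_pair_measure_countable1[OF countable_inj_tuples]) simp
  qed
  also have "\<dots> = (\<integral>\<^sup>+\<omega>. (\<Prod>i<k. number_of_points (\<phi> \<omega>) (D i)) \<partial>P)"
  proof (rule nn_integral_cong)
    fix \<omega> assume \<omega>: "\<omega> \<in> space P"
    let ?f = "\<lambda>i n. of_bool (enat n < N \<omega> \<and> X n \<omega> \<in> D i) :: ennreal"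
    have "(\<integral>\<^sup>+s. of_bool (active k s \<omega>) * indicator (PiE {..<k} D) (tuple k s \<omega>) \<partial>?C) = (\<integral>\<^sup>+s. (\<Prod>i<k. ?f i (s i)) \<partial>?C)"
    proof (rule nn_integral_cong)
      fix s
      have "tuple k s \<omega> \<in> PiE {..<k} D \<longleftrightarrow> (\<forall>i<k. X (s i) \<omega> \<in> D i)" by (auto simp: tuple_def PiE_iff)
      then show "of_bool (active k s \<omega>) * indicator (PiE {..<k} D) (tuple k s \<omega>) = (\<Prod>i<k. ?f i (s i))"
        by (auto simp: active_def indicator_def)
    qed
    also have "\<dots> = (\<integral>\<^sup>+s. (\<Prod>i<k. ?f i (s i)) \<partial>count_space ({..<k} \<rightarrow>\<^sub>E UNIV))"
    proof (rule nn_integral_count_space_eq)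
      fix s :: "nat \<Rightarrow> nat" assume "s \<in> ({..<k} \<rightarrow>\<^sub>E UNIV) - inj_tuples k UNIV"
      then have "\<not> inj_on s {..<k}" by (simp add: inj_tuples_def)
      then obtain i j where ij: "i < k" "j < k" "i \<noteq> j" "s i = s j" by (auto simp: inj_on_def)
      then have "D i \<inter> D j = {}" using disj by (auto simp: disjoint_family_on_def)
      then have "?f i (s i) = 0 \<or> ?f j (s j) = 0" using ij by auto
      then show "(\<Prod>i<k. ?f i (s i)) = 0" using ij(1,2) by (intro prod_zero) auto
    qed (auto simp: inj_tuples_def)
    also have "\<dots> = (\<integral>\<^sup>+s. (\<Prod>i<k. ?f i (s i)) \<partial>PiM {..<k} (\<lambda>_. count_space UNIV))"
      by (subst count_space_PiM_finite) auto
    also have "\<dots> = (\<Prod>i<k. \<integral>\<^sup>+n. ?f i n \<partial>count_space UNIV)"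
      by (rule PC.product_nn_integral_prod) auto
    finally show "(\<integral>\<^sup>+s. of_bool (active k s \<omega>) * indicator (PiE {..<k} D) (tuple k s \<omega>) \<partial>?C) =
        (\<Prod>i<k. number_of_points (\<phi> \<omega>) (D i))"
      by (simp add: number_of_points_eq[OF \<omega>])
  qed
  finally show ?thesis .
qed

lemma inj_on_pred_measurable[measurable]:
  "Measurable.pred (PiM {..<k::nat} (\<lambda>_. borel :: 'a measure)) (\<lambda>x. inj_on x {..<k})"
proof -
  have eq: "(\<lambda>x :: nat \<Rightarrow> 'a. inj_on x {..<k}) = (\<lambda>x. \<forall>i\<in>{..<k}. \<forall>j\<in>{..<k}. i = j \<or> x i \<noteq> x j)"
    unfolding inj_on_def by blast
  have "Measurable.pred (PiM {..<k} (\<lambda>_. borel :: 'a measure)) (\<lambda>x. i = j \<or> x i \<noteq> x j)"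
    if "i \<in> {..<k}" "j \<in> {..<k}" for i j
  proof -
    have "Measurable.pred (PiM {..<k} (\<lambda>_. borel :: 'a measure)) (\<lambda>x. x i = x j)"
      unfolding pred_def
      by (rule measurable_equality_set[OF measurable_component_singleton[OF that(1)] measurable_component_singleton[OF that(2)]])
    then show ?thesis by (intro pred_intros_logic) simp_all
  qed
  then show ?thesis unfolding eq by (intro pred_intros_finite finite_lessThan)
qed

lemma AE_factorial_moment_inj: "AE x in factorial_moment k. inj_on x {..<k}"
proof -
  have "inj_on (tuple k s \<omega>) {..<k}"
    if s: "s \<in> inj_tuples k UNIV" and \<omega>: "\<omega> \<in> space P" and act: "active k s \<omega>" for s \<omega>
  proof (rule inj_onI)
    fix i j assume ij: "i \<in> {..<k}" "j \<in> {..<k}" and eq: "tuple k s \<omega> i = tuple k s \<omega> j"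
    then have "X (s i) \<omega> = X (s j) \<omega>" by (simp add: tuple_def)
    then have "s i = s j" using inj_onD[OF X_inj[OF \<omega>]] act ij by (simp add: active_def)
    then show "i = j" using s ij by (auto simp: inj_tuples_def inj_on_def)
  qed
  then show ?thesis unfolding factorial_moment_def
    by (subst AE_distr_iff, simp, simp add: space_PiM[symmetric], subst AE_density)
       (auto intro!: AE_I2 simp: space_pair_measure)
qed

end

text \<open>With all other coordinates fixed, a coincidence \<open>x i = x j\<close> confines
  \<open>x i\<close> to one point, a Lebesgue null set.\<close>

lemma AE_PiM_lborel_inj:
  "AE x in PiM {..<k::nat} (\<lambda>_. lborel :: 'a::euclidean_space measure). inj_on x {..<k}"
proof -
  interpret product_sigma_finite "\<lambda>_::nat. lborel :: 'a measure" by standard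
  have "AE x in PiM {..<k} (\<lambda>_. lborel :: 'a measure). x i \<noteq> x j" if ij: "i < k" "j < k" "i \<noteq> j" for i j
  proof -
    let ?I = "{..<k} - {i}"
    have I: "{..<k} = insert i ?I" using ij by auto
    let ?f = "\<lambda>x::nat \<Rightarrow> 'a. indicator {x. x i = x j} x :: ennreal"
    have m: "?f \<in> borel_measurable (PiM (insert i ?I) (\<lambda>_. lborel))"
    proof -
      have i: "i \<in> {..<k}" "j \<in> {..<k}" using ij by auto
      have "(\<lambda>x. x l) \<in> borel_measurable (PiM {..<k} (\<lambda>_. lborel :: 'a measure))" if "l \<in> {..<k}" for l
        using measurable_component_singleton[OF that, of "\<lambda>_. lborel :: 'a measure"] by simp
      from measurable_equality_set[OF this[OF i(1)] this[OF i(2)]]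
      have "Measurable.pred (PiM {..<k} (\<lambda>_. lborel :: 'a measure)) (\<lambda>x. x i = x j)"
        unfolding pred_def .
      then show ?thesis unfolding I[symmetric] by simp
    qed
    have "(\<integral>\<^sup>+x. ?f x \<partial>PiM (insert i ?I) (\<lambda>_. lborel)) = (\<integral>\<^sup>+x. \<integral>\<^sup>+y. ?f (x(i := y)) \<partial>lborel \<partial>PiM ?I (\<lambda>_. lborel))"
      by (rule product_nn_integral_insert) (use m in auto)
    also have "\<dots> = (\<integral>\<^sup>+x. \<integral>\<^sup>+y. indicator {x j} y \<partial>lborel \<partial>PiM ?I (\<lambda>_. lborel :: 'a measure))"
      using ij by (intro nn_integral_cong) (simp add: indicator_def)
    also have "(\<integral>\<^sup>+x. \<integral>\<^sup>+y. indicator {x j} y \<partial>lborel \<partial>PiM ?I (\<lambda>_. lborel :: 'a measure)) = 0"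
      by simp
    finally have "(\<integral>\<^sup>+x. ?f x \<partial>PiM {..<k} (\<lambda>_. lborel)) = 0" unfolding I[symmetric] .
    then have "AE x in PiM {..<k} (\<lambda>_. lborel :: 'a measure). ?f x = 0"
      using m unfolding I[symmetric] by (simp add: nn_integral_0_iff_AE)
    then show ?thesis by eventually_elim (simp add: indicator_def split: if_splits)
  qed
  then have "AE x in PiM {..<k} (\<lambda>_. lborel :: 'a measure). \<forall>i\<in>{..<k}. \<forall>j\<in>{..<k}. i \<noteq> j \<longrightarrow> x i \<noteq> x j"
    by (intro AE_finite_allI) auto
  then show ?thesis by eventually_elim (auto simp: inj_on_def)
qed

text \<open>\<open>w x * w y\<close> is at most the mean of the two squares, and each half is
  integrated by translation and reflection invariance of Lebesgue measure. With \<open>g\<close> the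
  squared modulus of the kernel this is the Hilbert-Schmidt bound behind \<open>e\<close>; here
  stationarity enters.\<close>

lemma nn_integral_convolution_le:
  fixes w :: "'a::euclidean_space \<Rightarrow> real" and g :: "'a \<Rightarrow> ennreal"
  assumes [measurable]: "w \<in> borel_measurable borel" "g \<in> borel_measurable borel" and w: "\<And>x. 0 \<le> w x"
  shows "(\<integral>\<^sup>+x. \<integral>\<^sup>+y. ennreal (w x) * g (x - y) * ennreal (w y) \<partial>lborel \<partial>lborel) \<le>
    (\<integral>\<^sup>+x. ennreal ((w x)\<^sup>2) \<partial>lborel) * (\<integral>\<^sup>+x. g x \<partial>lborel)"
proof -
  let ?A = "\<integral>\<^sup>+x. ennreal ((w x)\<^sup>2) \<partial>lborel" and ?B = "\<integral>\<^sup>+x. g x \<partial>lborel"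
  have t1: "(\<integral>\<^sup>+y. g (x - y) \<partial>lborel) = ?B" for x
  proof -
    have "?B = (\<integral>\<^sup>+y. g (x + (-1) *\<^sub>R y) \<partial>lborel)"
      by (subst lborel_affine[of "-1" x]) (simp_all add: nn_integral_density nn_integral_distr)
    then show ?thesis by simp
  qed
  have t2: "(\<integral>\<^sup>+x. g (x - y) \<partial>lborel) = ?B" for y
    by (subst (2) lborel_affine[of "1" "- y"]) (simp_all add: nn_integral_density nn_integral_distr)
  have "(\<integral>\<^sup>+x. \<integral>\<^sup>+y. ennreal (w x) * g (x - y) * ennreal (w y) \<partial>lborel \<partial>lborel) \<le>
     (\<integral>\<^sup>+x. \<integral>\<^sup>+y. ennreal ((w x)\<^sup>2 / 2) * g (x - y) + ennreal ((w y)\<^sup>2 / 2) * g (x - y) \<partial>lborel \<partial>lborel)"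
  proof (intro nn_integral_mono)
    fix x y
    have "w x * w y \<le> (w x)\<^sup>2 / 2 + (w y)\<^sup>2 / 2"
      using sum_squares_bound[of "w x" "w y"] by simp
    then have "ennreal (w x) * ennreal (w y) \<le> ennreal ((w x)\<^sup>2 / 2) + ennreal ((w y)\<^sup>2 / 2)"
      using w by (simp add: ennreal_mult'[symmetric] ennreal_plus[symmetric] del: ennreal_plus)
    then show "ennreal (w x) * g (x - y) * ennreal (w y) \<le> ennreal ((w x)\<^sup>2 / 2) * g (x - y) + ennreal ((w y)\<^sup>2 / 2) * g (x - y)"
      by (metis (no_types) distrib_right mult.assoc mult.commute mult_left_mono zero_le)
  qed
  also have "\<dots> = (\<integral>\<^sup>+x. \<integral>\<^sup>+y. ennreal ((w x)\<^sup>2 / 2) * g (x - y) \<partial>lborel \<partial>lborel) +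
     (\<integral>\<^sup>+x. \<integral>\<^sup>+y. ennreal ((w y)\<^sup>2 / 2) * g (x - y) \<partial>lborel \<partial>lborel)"
    by (simp add: nn_integral_add)
  also have "(\<integral>\<^sup>+x. \<integral>\<^sup>+y. ennreal ((w x)\<^sup>2 / 2) * g (x - y) \<partial>lborel \<partial>lborel) = (\<integral>\<^sup>+x. ennreal ((w x)\<^sup>2 / 2) \<partial>lborel) * ?B"
    by (simp add: nn_integral_cmult nn_integral_multc t1)
  also have "(\<integral>\<^sup>+x. \<integral>\<^sup>+y. ennreal ((w y)\<^sup>2 / 2) * g (x - y) \<partial>lborel \<partial>lborel) =
     (\<integral>\<^sup>+y. \<integral>\<^sup>+x. ennreal ((w y)\<^sup>2 / 2) * g (x - y) \<partial>lborel \<partial>lborel)"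
    by (rule lborel_pair.Fubini') measurable
  also have "\<dots> = (\<integral>\<^sup>+x. ennreal ((w x)\<^sup>2 / 2) \<partial>lborel) * ?B"
    by (simp add: nn_integral_cmult nn_integral_multc t2)
  also have "(\<integral>\<^sup>+x. ennreal ((w x)\<^sup>2 / 2) \<partial>lborel) * ?B + (\<integral>\<^sup>+x. ennreal ((w x)\<^sup>2 / 2) \<partial>lborel) * ?B = ?A * ?B"
  proof -
    have "?A = (\<integral>\<^sup>+x. ennreal ((w x)\<^sup>2 / 2) + ennreal ((w x)\<^sup>2 / 2) \<partial>lborel)"
      by (intro nn_integral_cong) (simp add: ennreal_plus[symmetric] del: ennreal_plus)
    also have "\<dots> = (\<integral>\<^sup>+x. ennreal ((w x)\<^sup>2 / 2) \<partial>lborel) + (\<integral>\<^sup>+x. ennreal ((w x)\<^sup>2 / 2) \<partial>lborel)"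
      by (rule nn_integral_add) measurable
    finally show ?thesis by (simp add: distrib_right)
  qed
  finally show ?thesis .
qed

locale stationary_kernel_points = enumerated_points P N X \<phi>
  for P :: "'w measure" and N and X :: "nat \<Rightarrow> 'w \<Rightarrow> 'a::euclidean_space" and \<phi> +
  fixes K :: "'a \<Rightarrow> complex"
  assumes dpp: "dpp P \<phi> (\<lambda>x y. K (x - y)) lborel"
    and K_square: "(\<integral>\<^sup>+x. ennreal ((norm (K x))\<^sup>2) \<partial>lborel) < \<infinity>"
begin

abbreviation "\<kappa> \<equiv> \<lambda>x y. K (x - y)"

lemma kernel_pair_measurable[measurable]: "(\<lambda>(x, y). K (x - y)) \<in> borel_measurable (lborel \<Otimes>\<^sub>M lborel)"
  using dpp by (simp add: dpp_def)

lemma K_measurable[measurable]: "K \<in> borel_measurable borel"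
proof -
  have "(\<lambda>x. (x, 0)) \<in> lborel \<rightarrow>\<^sub>M lborel \<Otimes>\<^sub>M lborel" by measurable
  from measurable_compose[OF this kernel_pair_measurable] show ?thesis by simp
qed

lemma weighted_kernelI:
  assumes [measurable]: "w \<in> borel_measurable borel" and w: "\<And>x. 0 \<le> w x" and te: "0 \<le> t" "0 \<le> e"
    and t: "(\<integral>\<^sup>+x. ennreal (w x * norm (K 0)) \<partial>lborel) \<le> ennreal t"
    and e: "(\<integral>\<^sup>+x. ennreal ((w x)\<^sup>2) \<partial>lborel) * (\<integral>\<^sup>+x. ennreal ((norm (K x))\<^sup>2) \<partial>lborel) \<le> ennreal (e\<^sup>2)"
  shows "weighted_kernel lborel \<kappa> w t e"
proof
  show "(\<integral>\<^sup>+x. \<integral>\<^sup>+y. ennreal (w x * (norm (K (x - y)))\<^sup>2 * w y) \<partial>lborel \<partial>lborel) \<le> ennreal (e\<^sup>2)"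
    using order_trans[OF nn_integral_convolution_le[of w "\<lambda>x. ennreal ((norm (K x))\<^sup>2)", OF _ _ w] e]
    by (simp add: ennreal_mult' ennreal_mult w)
qed (use w te t in auto)

text \<open>The defining identity of a Dpp speaks about disjoint sides only. It determines the whole
  measure because neither side charges the diagonals: enumerated points are distinct, and
  coincidences are Lebesgue null.\<close>

theorem factorial_moment_eq:
  "factorial_moment k = density (PiM {..<k} (\<lambda>_. lborel)) (\<lambda>x. ennreal (Re (correlation_det \<kappa> k x)))"
proof (rule measure_eqI_disjoint_rectangles[symmetric])
  \<comment> \<open>With weight zero all bounds are trivial; this gives access to the Leibniz
    formula and the measurability of the determinants.\<close>
  interpret w0: weighted_kernel lborel \<kappa> "\<lambda>_. 0" 0 0
    by (rule weighted_kernelI) auto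
  note [measurable] = w0.correlation_det_measurable
  let ?d = "density (PiM {..<k} (\<lambda>_. lborel)) (\<lambda>x. ennreal (Re (correlation_det \<kappa> k x)))"
  show sets_d: "sets ?d = sets (PiM {..<k} (\<lambda>_. borel))"
    by (simp, rule sets_PiM_cong) auto
  show "sets (factorial_moment k) = sets (PiM {..<k} (\<lambda>_. borel))" by (rule sets_factorial_moment)
  show "AE x in factorial_moment k. inj_on x {..<k}" by (rule AE_factorial_moment_inj)
  show "AE x in ?d. inj_on x {..<k}"
    using AE_PiM_lborel_inj[of k] by (subst AE_density) (measurable, auto elim: eventually_mono)
  show "emeasure ?d (PiE {..<k} D) = emeasure (factorial_moment k) (PiE {..<k} D)"
    if D: "\<And>i. i < k \<Longrightarrow> D i \<in> sets borel" and disj: "disjoint_family_on D {..<k}" for D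
  proof (cases "k = 0")
    \<comment> \<open>The Dpp identity starts at \<open>k = 1\<close>; for \<open>k = 0\<close> both
      measures have mass one on the empty tuple.\<close>
    case True
    have "correlation_det \<kappa> 0 x = 1" for x by (simp add: w0.correlation_det_eq)
    then have "emeasure ?d (PiE {..<k} D) = 1"
      using True by (simp add: PiM_empty emeasure_density nn_integral_count_space_finite)
    then show ?thesis using True emeasure_factorial_moment_rectangle[OF D disj] emeasure_space_1 by simp
  next
    case False
    have Dm: "PiE {..<k} D \<in> sets (PiM {..<k} (\<lambda>_. lborel))"
      by (intro sets_PiM_I_finite) (auto intro: D)
    have "emeasure ?d (PiE {..<k} D) = (\<integral>\<^sup>+x\<in>PiE {..<k} D. ennreal (Re (correlation_det \<kappa> k x)) \<partial>PiM {..<k} (\<lambda>_. lborel))"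
      by (rule emeasure_density) (use Dm in measurable)
    also have "\<dots> = (\<integral>\<^sup>+\<omega>. (\<Prod>i<k. number_of_points (\<phi> \<omega>) (D i)) \<partial>P)"
    proof -
      have k: "1 \<le> k" and D': "\<forall>i<k. D i \<in> sets borel" using False D by auto
      show ?thesis
        by (rule dpp[unfolded dpp_def, THEN conjunct2, THEN conjunct2, THEN conjunct2, THEN conjunct2, THEN spec[of _ k],
            THEN mp, OF k, THEN conjunct2, THEN spec[of _ D], THEN mp, OF conjI[OF D' disj], symmetric])
    qed
    finally show ?thesis using emeasure_factorial_moment_rectangle[OF D disj] by simp
  qed
  fix n :: nat
  let ?w = "indicator (cball (0::'a) (real n)) :: 'a \<Rightarrow> real"
  have vol: "emeasure lborel (cball (0::'a) (real n)) < \<infinity>" by (rule emeasure_bounded_finite[OF bounded_cball])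
  define V where "V = measure lborel (cball (0::'a) (real n))"
  have V: "emeasure lborel (cball (0::'a) (real n)) = ennreal V" "0 \<le> V"
    using vol by (simp_all add: V_def emeasure_eq_ennreal_measure)
  obtain B where B: "(\<integral>\<^sup>+x. ennreal ((norm (K x))\<^sup>2) \<partial>lborel) = ennreal B" "0 \<le> B"
    using K_square by (cases "\<integral>\<^sup>+x. ennreal ((norm (K x))\<^sup>2) \<partial>lborel") auto
  \<comment> \<open>Finiteness on products of balls: the weight is the indicator of the ball, and
    \<open>majorant k\<close> is finite whatever the size of its parameter \<open>e\<close>, here
    \<open>sqrt (V * B)\<close>.\<close>
  interpret w: weighted_kernel lborel \<kappa> ?w "V * norm (K 0)" "sqrt (V * B)"
  proof (rule weighted_kernelI)
    show "?w \<in> borel_measurable borel" by (intro borel_measurable_indicator borel_closed closed_cball)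
    show "0 \<le> V * norm (K 0)" "0 \<le> sqrt (V * B)" using V B by auto
    have "(\<integral>\<^sup>+x. ennreal (?w x * norm (K 0)) \<partial>lborel) = (\<integral>\<^sup>+x. indicator (cball (0::'a) (real n)) x * ennreal (norm (K 0)) \<partial>lborel)"
      by (intro nn_integral_cong) (simp add: indicator_def)
    also have "\<dots> = (\<integral>\<^sup>+x. indicator (cball (0::'a) (real n)) x \<partial>lborel) * ennreal (norm (K 0))"
      by (rule nn_integral_multc) (simp add: borel_measurable_indicator borel_closed)
    also have "\<dots> = ennreal V * ennreal (norm (K 0))" using V(1) by simp
    finally show "(\<integral>\<^sup>+x. ennreal (?w x * norm (K 0)) \<partial>lborel) \<le> ennreal (V * norm (K 0))"
      using V by (simp add: ennreal_mult)
    have "(\<integral>\<^sup>+x. ennreal ((?w x)\<^sup>2) \<partial>lborel) = (\<integral>\<^sup>+x. indicator (cball (0::'a) (real n)) x \<partial>lborel)"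
      by (intro nn_integral_cong) (simp add: indicator_def)
    then show "(\<integral>\<^sup>+x. ennreal ((?w x)\<^sup>2) \<partial>lborel) * (\<integral>\<^sup>+x. ennreal ((norm (K x))\<^sup>2) \<partial>lborel) \<le> ennreal ((sqrt (V * B))\<^sup>2)"
      using V B by (simp add: ennreal_mult)
  qed simp
  have Cm: "PiE {..<k} (\<lambda>_. cball (0::'a) (real n)) \<in> sets (PiM {..<k} (\<lambda>_. lborel))"
    by (intro sets_PiM_I_finite) auto
  have "emeasure ?d (PiE {..<k} (\<lambda>_. cball (0::'a) (real n))) =
      (\<integral>\<^sup>+x\<in>PiE {..<k} (\<lambda>_. cball (0::'a) (real n)). ennreal (Re (correlation_det \<kappa> k x)) \<partial>PiM {..<k} (\<lambda>_. lborel))"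
    by (rule emeasure_density) (use Cm in measurable)
  also have "\<dots> \<le> (\<integral>\<^sup>+x. ennreal ((\<Prod>i<k. ?w (x i)) * norm (correlation_det \<kappa> k x)) \<partial>PiM {..<k} (\<lambda>_. lborel))"
  proof (rule nn_integral_mono)
    fix x :: "nat \<Rightarrow> 'a"
    have "Re (correlation_det \<kappa> k x) \<le> norm (correlation_det \<kappa> k x)" by (rule complex_Re_le_cmod)
    then show "ennreal (Re (correlation_det \<kappa> k x)) * indicator (PiE {..<k} (\<lambda>_. cball (0::'a) (real n))) x \<le>
        ennreal ((\<Prod>i<k. ?w (x i)) * norm (correlation_det \<kappa> k x))"
      by (cases "x \<in> PiE {..<k} (\<lambda>_. cball (0::'a) (real n))") (auto simp: PiE_iff ennreal_leI)
  qed
  also have "\<dots> \<le> ennreal (fact k * w.majorant k)" by (rule w.nn_integral_correlation_det_le)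
  finally show "emeasure ?d (PiE {..<k} (\<lambda>_. cball (0::'a) (real n))) \<noteq> \<infinity>"
    by (metis ennreal_neq_top infinity_ennreal_def top_unique)
qed

end

section \<open>Independent marks\<close>

lemma (in prob_space) distr_pair_indep_set:
  assumes [measurable]: "random_variable S X" "random_variable T Y"
    and indep: "indep_set (sets (vimage_algebra (space M) X S)) (sets (vimage_algebra (space M) Y T))"
  shows "distr M (S \<Otimes>\<^sub>M T) (\<lambda>\<omega>. (X \<omega>, Y \<omega>)) = distr M S X \<Otimes>\<^sub>M distr M T Y"
proof -
  interpret S: prob_space "distr M S X" by (rule prob_space_distr) simp
  interpret T: prob_space "distr M T Y" by (rule prob_space_distr) simp
  show ?thesis
  proof (rule pair_measure_eqI[symmetric])
    show "sets (distr M S X \<Otimes>\<^sub>M distr M T Y) = sets (distr M (S \<Otimes>\<^sub>M T) (\<lambda>\<omega>. (X \<omega>, Y \<omega>)))"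
      by (simp cong: sets_pair_measure_cong)
    fix A B assume "A \<in> sets (distr M S X)" "B \<in> sets (distr M T Y)"
    then have [measurable]: "A \<in> sets S" "B \<in> sets T" by simp_all
    let ?a = "X -` A \<inter> space M" and ?b = "Y -` B \<inter> space M"
    have "prob (?a \<inter> ?b) = prob ?a * prob ?b"
      by (rule indep[unfolded indep_sets2_eq, THEN conjunct2, THEN conjunct2, rule_format]; rule in_vimage_algebra; simp)
    then have "emeasure M (?a \<inter> ?b) = emeasure M ?a * emeasure M ?b"
      by (simp add: emeasure_eq_measure ennreal_mult)
    moreover have "(\<lambda>\<omega>. (X \<omega>, Y \<omega>)) -` (A \<times> B) \<inter> space M = ?a \<inter> ?b" by auto
    ultimately show "emeasure (distr M S X) A * emeasure (distr M T Y) B =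
        emeasure (distr M (S \<Otimes>\<^sub>M T) (\<lambda>\<omega>. (X \<omega>, Y \<omega>))) (A \<times> B)"
      by (simp add: emeasure_distr)
  qed (unfold_locales)
qed

locale marked_points = enumerated_points P N X \<phi>
  for P :: "'w measure" and N and X :: "nat \<Rightarrow> 'w \<Rightarrow> 'a::euclidean_space" and \<phi> +
  fixes R :: "nat \<Rightarrow> 'w \<Rightarrow> real" and h :: "real \<Rightarrow> ennreal"
  assumes R_indep: "indep_vars (\<lambda>_. borel) R UNIV"
    and R_distributed: "\<And>n. distributed P lborel (R n) h"
    and NX_R_indep: "indep_set
      (sets (vimage_algebra (space P) (\<lambda>\<omega>. (N \<omega>, \<lambda>n. X n \<omega>)) (count_space UNIV \<Otimes>\<^sub>M (\<Pi>\<^sub>M n\<in>UNIV. borel))))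
      (sets (vimage_algebra (space P) (\<lambda>\<omega> n. R n \<omega>) (\<Pi>\<^sub>M n\<in>UNIV. borel)))"
begin

definition mark_law :: "real measure" where "mark_law = density lborel h"

lemma R_measurable[measurable]: "R n \<in> borel_measurable P"
  using R_distributed[of n] by (simp add: distributed_def)

lemma distr_R: "distr P borel (R n) = mark_law"
proof -
  have "distr P borel (R n) = distr P lborel (R n)" by (rule distr_cong) auto
  also have "\<dots> = mark_law" using R_distributed[of n] by (simp add: distributed_def mark_law_def)
  finally show ?thesis .
qed

lemma sets_mark_law[measurable_cong, simp]: "sets mark_law = sets borel" by (simp add: mark_law_def)

lemma prob_space_mark_law: "prob_space mark_law"
  using prob_space_distr[OF R_measurable[of 0]] by (simp add: distr_R)

sublocale mark: prob_space mark_law by (rule prob_space_mark_law)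

abbreviation "NX \<equiv> \<lambda>\<omega>. (N \<omega>, \<lambda>n. X n \<omega>)"
abbreviation "RR \<equiv> \<lambda>\<omega> n. R n \<omega>"
abbreviation "NX_space \<equiv> count_space (UNIV :: enat set) \<Otimes>\<^sub>M (\<Pi>\<^sub>M n\<in>(UNIV::nat set). (borel :: 'a measure))"
abbreviation "R_space \<equiv> \<Pi>\<^sub>M n\<in>(UNIV::nat set). (borel :: real measure)"

lemma NX_measurable[measurable]: "NX \<in> P \<rightarrow>\<^sub>M NX_space"
proof (rule measurable_Pair)
  show "(\<lambda>\<omega> n. X n \<omega>) \<in> P \<rightarrow>\<^sub>M (\<Pi>\<^sub>M n\<in>UNIV. borel)"
    by (rule measurable_PiM_single') (auto simp: space_PiM)
qed simp

lemma RR_measurable[measurable]: "RR \<in> P \<rightarrow>\<^sub>M R_space"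
  by (rule measurable_PiM_single') (auto simp: space_PiM)

lemma distr_RR: "distr P R_space RR = PiM UNIV (\<lambda>_. mark_law)"
proof -
  have "distr P R_space (\<lambda>\<omega>. \<lambda>n\<in>UNIV. R n \<omega>) = (\<Pi>\<^sub>M n\<in>UNIV. distr P borel (R n))"
    using R_indep by (subst (asm) indep_vars_iff_distr_eq_PiM) auto
  then show ?thesis by (simp add: distr_R restrict_UNIV)
qed

lemma distr_NX_RR: "distr P (NX_space \<Otimes>\<^sub>M R_space) (\<lambda>\<omega>. (NX \<omega>, RR \<omega>)) = distr P NX_space NX \<Otimes>\<^sub>M PiM UNIV (\<lambda>_. mark_law)"
  unfolding distr_RR[symmetric]
  by (rule distr_pair_indep_set[OF NX_measurable RR_measurable NX_R_indep])

lemma NX_RR_measurable: "(\<lambda>\<omega>. (NX \<omega>, RR \<omega>)) \<in> P \<rightarrow>\<^sub>M NX_space \<Otimes>\<^sub>M R_space"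
  by (rule measurable_Pair[OF NX_measurable RR_measurable])

text \<open>The marks are independent of the enumeration, so they may be integrated with the points
  held fixed; boundedness of \<open>F\<close> permits Fubini.\<close>

lemma integral_marks:
  fixes F :: "enat \<times> (nat \<Rightarrow> 'a) \<Rightarrow> (nat \<Rightarrow> real) \<Rightarrow> complex"
  assumes [measurable]: "(\<lambda>(y, z). F y z) \<in> borel_measurable (NX_space \<Otimes>\<^sub>M R_space)"
    and B: "\<And>y z. norm (F y z) \<le> B"
  shows "(\<integral>\<omega>. F (NX \<omega>) (RR \<omega>) \<partial>P) = (\<integral>\<omega>. \<integral>z. F (NX \<omega>) z \<partial>PiM UNIV (\<lambda>_. mark_law) \<partial>P)"
proof -
  let ?L = "distr P NX_space NX" and ?Z = "PiM UNIV (\<lambda>_::nat. mark_law)"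
  interpret L: prob_space ?L by (rule prob_space_distr) measurable
  interpret Z: prob_space ?Z by (rule prob_space_PiM) (rule prob_space_mark_law)
  interpret LZ: pair_prob_space ?L ?Z by standard
  have sZ: "sets ?Z = sets R_space" by (rule sets_PiM_cong) auto
  have m: "(\<lambda>(y, z). F y z) \<in> borel_measurable (?L \<Otimes>\<^sub>M ?Z)"
    using assms(1) by (subst measurable_cong_sets[OF sets_pair_measure_cong[OF _ sZ] refl]) auto
  have "(\<integral>\<omega>. F (NX \<omega>) (RR \<omega>) \<partial>P) = (\<integral>p. (\<lambda>(y, z). F y z) p \<partial>distr P (NX_space \<Otimes>\<^sub>M R_space) (\<lambda>\<omega>. (NX \<omega>, RR \<omega>)))"
    by (subst integral_distr[OF NX_RR_measurable assms(1)]) simp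
  also have "\<dots> = (\<integral>p. (\<lambda>(y, z). F y z) p \<partial>(?L \<Otimes>\<^sub>M ?Z))" by (simp only: distr_NX_RR)
  also have "\<dots> = (\<integral>y. \<integral>z. F y z \<partial>?Z \<partial>?L)"
  proof -
    have "integrable (?L \<Otimes>\<^sub>M ?Z) (\<lambda>(y, z). F y z)"
      by (rule LZ.P.integrable_const_bound[where B=B]) (use B m in auto)
    from LZ.integral_fst'[OF this] show ?thesis by simp
  qed
  also have "\<dots> = (\<integral>\<omega>. \<integral>z. F (NX \<omega>) z \<partial>?Z \<partial>P)"
  proof (rule integral_distr)
    have "(\<lambda>y. \<integral>z. (\<lambda>(y, z). F y z) (y, z) \<partial>?Z) \<in> borel_measurable ?L"
      using m by (intro Z.borel_measurable_lebesgue_integral) simp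
    then show "(\<lambda>y. \<integral>z. F y z \<partial>?Z) \<in> borel_measurable NX_space" by simp
  qed measurable
  finally show ?thesis .
qed

text \<open>Given the enumeration, marks at distinct labels are independent with a common law, so
  the mean of the product is the product of the means. Injectivity of \<open>s\<close> makes the
  \<open>k\<close> marks distinct coordinates.\<close>

lemma integral_active_marks:
  fixes v :: "'a \<times> real \<Rightarrow> complex"
  assumes [measurable]: "v \<in> borel_measurable (borel \<Otimes>\<^sub>M borel)" and B: "\<And>z. norm (v z) \<le> B"
    and s: "s \<in> inj_tuples k UNIV"
  shows "(\<integral>\<omega>. of_bool (active k s \<omega>) * (\<Prod>i<k. v (X (s i) \<omega>, R (s i) \<omega>)) \<partial>P) =
    (\<integral>\<omega>. of_bool (active k s \<omega>) * (\<Prod>i<k. \<integral>r. v (X (s i) \<omega>, r) \<partial>mark_law) \<partial>P)"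
proof -
  let ?Z = "PiM UNIV (\<lambda>_::nat. mark_law)"
  interpret PZ: product_prob_space "\<lambda>_::nat. mark_law" UNIV by standard
  define F where "F = (\<lambda>(y :: enat \<times> (nat \<Rightarrow> 'a)) (z :: nat \<Rightarrow> real).
    (of_bool (\<forall>i\<in>{..<k}. enat (s i) < fst y) :: complex) * (\<Prod>i<k. v (snd y (s i), z (s i))))"
  have B0: "0 \<le> B" using norm_ge_zero B[of undefined] by (rule order_trans)
  have act: "active k s \<omega> = (\<forall>i\<in>{..<k}. enat (s i) < N \<omega>)" for \<omega> by (auto simp: active_def)
  have "(\<integral>\<omega>. of_bool (active k s \<omega>) * (\<Prod>i<k. v (X (s i) \<omega>, R (s i) \<omega>)) \<partial>P) = (\<integral>\<omega>. F (NX \<omega>) (RR \<omega>) \<partial>P)"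
    by (simp only: F_def act fst_conv snd_conv)
  also have "\<dots> = (\<integral>\<omega>. \<integral>z. F (NX \<omega>) z \<partial>?Z \<partial>P)"
  proof (rule integral_marks)
    have [measurable]: "(\<lambda>p. \<forall>i\<in>{..<k}. enat (s i) < fst (fst p)) \<in> NX_space \<Otimes>\<^sub>M R_space \<rightarrow>\<^sub>M count_space UNIV"
      by (intro pred_intros_finite finite_lessThan) measurable
    have [measurable]: "(\<lambda>p. v (snd (fst p) (s i), snd p (s i))) \<in> borel_measurable (NX_space \<Otimes>\<^sub>M R_space)" for i
      by measurable
    show "(\<lambda>(y, z). F y z) \<in> borel_measurable (NX_space \<Otimes>\<^sub>M R_space)"
      unfolding F_def split_beta' by measurable
    show "norm (F y z) \<le> B ^ k" for y z
    proof -
      have "norm (\<Prod>i<k. v (snd y (s i), z (s i))) \<le> (\<Prod>i<k. B)"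
        unfolding prod_norm[symmetric] by (intro prod_mono) (simp add: B)
      then show ?thesis using B0 by (simp add: F_def norm_mult)
    qed
  qed
  also have "\<dots> = (\<integral>\<omega>. of_bool (active k s \<omega>) * (\<Prod>i<k. \<integral>r. v (X (s i) \<omega>, r) \<partial>mark_law) \<partial>P)"
  proof (rule Bochner_Integration.integral_cong[OF refl])
    fix \<omega>
    have sec[measurable]: "(\<lambda>r. v (x, r)) \<in> borel_measurable mark_law" for x by simp
    have "(\<integral>z. (\<Prod>i<k. v (X (s i) \<omega>, z (s i))) \<partial>?Z) = (\<integral>z. (\<Prod>i<k. v (X (s i) \<omega>, z i)) \<partial>PiM {..<k} (\<lambda>_. mark_law))"
    proof -
      have inj: "inj_on s {..<k}" using s by (simp add: inj_tuples_def)
      have "PiM {..<k} (\<lambda>_. mark_law) = distr ?Z (PiM {..<k} (\<lambda>_. mark_law)) (\<lambda>z. \<lambda>n\<in>{..<k}. z (s n))"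
        by (rule distr_PiM_reindex[symmetric, OF _ inj]) (auto intro: prob_space_mark_law)
      then have "(\<integral>z. (\<Prod>i<k. v (X (s i) \<omega>, z i)) \<partial>PiM {..<k} (\<lambda>_. mark_law)) =
          (\<integral>z. (\<Prod>i<k. v (X (s i) \<omega>, z i)) \<partial>distr ?Z (PiM {..<k} (\<lambda>_. mark_law)) (\<lambda>z. \<lambda>n\<in>{..<k}. z (s n)))"
        by simp
      also have "\<dots> = (\<integral>z. (\<Prod>i<k. v (X (s i) \<omega>, (\<lambda>n\<in>{..<k}. z (s n)) i)) \<partial>?Z)"
      proof (rule integral_distr)
        show "(\<lambda>z. \<lambda>n\<in>{..<k}. z (s n)) \<in> ?Z \<rightarrow>\<^sub>M PiM {..<k} (\<lambda>_. mark_law)"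
          by (intro measurable_restrict measurable_component_singleton) simp
        show "(\<lambda>z. \<Prod>i<k. v (X (s i) \<omega>, z i)) \<in> borel_measurable (PiM {..<k} (\<lambda>_. mark_law))"
        proof (rule borel_measurable_prod)
          fix i assume "i \<in> {..<k}"
          then have "(\<lambda>z. z i) \<in> PiM {..<k} (\<lambda>_. mark_law) \<rightarrow>\<^sub>M mark_law" by (rule measurable_component_singleton)
          from measurable_compose[OF this sec]
          show "(\<lambda>z. v (X (s i) \<omega>, z i)) \<in> borel_measurable (PiM {..<k} (\<lambda>_. mark_law))" .
        qed
      qed
      finally show ?thesis by simp
    qed
    also have "\<dots> = (\<Prod>i<k. \<integral>r. v (X (s i) \<omega>, r) \<partial>mark_law)"
      by (rule PZ.product_integral_prod[OF finite_lessThan])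
         (rule mark.integrable_const_bound[where B=B], use B in auto)
    finally show "(\<integral>z. F (NX \<omega>) z \<partial>?Z) = of_bool (active k s \<omega>) * (\<Prod>i<k. \<integral>r. v (X (s i) \<omega>, r) \<partial>mark_law)"
      by (simp only: F_def act fst_conv snd_conv integral_mult_right_zero)
  qed
  finally show ?thesis .
qed

text \<open>The nonnegative version for one label, free of any bound on \<open>v\<close>, for use in
  Campbell's formula.\<close>

lemma nn_integral_mark:
  fixes v :: "'a \<times> real \<Rightarrow> ennreal"
  assumes [measurable]: "v \<in> borel_measurable (borel \<Otimes>\<^sub>M borel)"
  shows "(\<integral>\<^sup>+\<omega>. of_bool (enat n < N \<omega>) * v (X n \<omega>, R n \<omega>) \<partial>P) =
    (\<integral>\<^sup>+\<omega>. of_bool (enat n < N \<omega>) * (\<integral>\<^sup>+r. v (X n \<omega>, r) \<partial>mark_law) \<partial>P)"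
proof -
  let ?L = "distr P NX_space NX" and ?Z = "PiM UNIV (\<lambda>_::nat. mark_law)"
  interpret L: prob_space ?L by (rule prob_space_distr) measurable
  interpret PZ: product_prob_space "\<lambda>_::nat. mark_law" UNIV by standard
  interpret LZ: pair_prob_space ?L ?Z by standard
  have sZ: "sets ?Z = sets R_space" by (rule sets_PiM_cong) auto
  let ?F = "\<lambda>p. (of_bool (enat n < fst (fst p)) :: ennreal) * v (snd (fst p) n, snd p n)"
  have m0: "?F \<in> borel_measurable (NX_space \<Otimes>\<^sub>M R_space)" by measurable
  have m: "?F \<in> borel_measurable (?L \<Otimes>\<^sub>M ?Z)"
    using m0 by (subst measurable_cong_sets[OF sets_pair_measure_cong[OF _ sZ] refl]) auto
  have "(\<integral>\<^sup>+\<omega>. of_bool (enat n < N \<omega>) * v (X n \<omega>, R n \<omega>) \<partial>P) =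
     (\<integral>\<^sup>+p. ?F p \<partial>distr P (NX_space \<Otimes>\<^sub>M R_space) (\<lambda>\<omega>. (NX \<omega>, RR \<omega>)))"
    using m0 by (subst nn_integral_distr[OF NX_RR_measurable]) simp_all
  also have "\<dots> = (\<integral>\<^sup>+y. \<integral>\<^sup>+z. ?F (y, z) \<partial>?Z \<partial>?L)"
    unfolding distr_NX_RR by (rule PZ.P.nn_integral_fst[symmetric, OF m])
  also have "\<dots> = (\<integral>\<^sup>+y. of_bool (enat n < fst y) * (\<integral>\<^sup>+r. v (snd y n, r) \<partial>mark_law) \<partial>?L)"
  proof (rule nn_integral_cong)
    fix y :: "enat \<times> (nat \<Rightarrow> 'a)"
    have "(\<integral>\<^sup>+z. v (snd y n, z n) \<partial>?Z) = (\<integral>\<^sup>+r. v (snd y n, r) \<partial>distr ?Z mark_law (\<lambda>z. z n))"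
      by (subst nn_integral_distr) auto
    also have "distr ?Z mark_law (\<lambda>z. z n) = mark_law" by (rule PZ.PiM_component) simp
    finally show "(\<integral>\<^sup>+z. ?F (y, z) \<partial>?Z) = of_bool (enat n < fst y) * (\<integral>\<^sup>+r. v (snd y n, r) \<partial>mark_law)"
      by (subst nn_integral_cmult[symmetric]) auto
  qed
  also have "\<dots> = (\<integral>\<^sup>+\<omega>. of_bool (enat n < N \<omega>) * (\<integral>\<^sup>+r. v (X n \<omega>, r) \<partial>mark_law) \<partial>P)"
    by (subst nn_integral_distr) auto
  finally show ?thesis .
qed

end

section \<open>First moments and the characteristic functional of the marked points\<close>

lemma correlation_det_1: "correlation_det \<kappa> 1 x = \<kappa> (x 0) (x 0)"
  unfolding correlation_det_def by (subst det_single) auto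

text \<open>For \<open>k = 1\<close> the determinant is the constant \<open>K 0\<close>, and a
  constant statement that holds almost everywhere for a nonzero measure holds outright.\<close>

lemma dpp_kernel_diagonal:
  fixes K :: "'a::euclidean_space \<Rightarrow> complex"
  assumes "dpp P \<phi> (\<lambda>x y. K (x - y)) lborel"
  shows "Im (K 0) = 0" "0 \<le> Re (K 0)"
proof -
  let ?M = "PiM {..<1::nat} (\<lambda>_. lborel :: 'a measure)"
  interpret product_sigma_finite "\<lambda>_::nat. lborel :: 'a measure" by standard
  have "AE x in ?M. Im (correlation_det (\<lambda>x y. K (x - y)) 1 x) = 0 \<and> 0 \<le> Re (correlation_det (\<lambda>x y. K (x - y)) 1 x)"
    by (rule assms[unfolded dpp_def, THEN conjunct2, THEN conjunct2, THEN conjunct2, THEN conjunct2, THEN spec[of _ 1],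
            THEN mp, OF order_refl, THEN conjunct1])
  then have ae: "AE x in ?M. Im (K 0) = 0 \<and> 0 \<le> Re (K 0)" unfolding correlation_det_1 by simp
  have "emeasure ?M (PiE {..<1} (\<lambda>_. UNIV)) = (\<Prod>i<1::nat. emeasure lborel (UNIV :: 'a set))"
    by (rule emeasure_PiM) auto
  then have ne: "emeasure ?M (space ?M) \<noteq> 0" by (simp add: space_PiM)
  have "Im (K 0) = 0 \<and> 0 \<le> Re (K 0)"
  proof (rule ccontr)
    assume "\<not> (Im (K 0) = 0 \<and> 0 \<le> Re (K 0))"
    with ae have "AE x in ?M. False" by (auto elim: eventually_mono)
    then show False using ne by (simp only: eventually_False ae_filter_eq_bot_iff)
  qed
  then show "Im (K 0) = 0" "0 \<le> Re (K 0)" by auto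
qed

locale marked_dpp = stationary_kernel_points P N X \<phi> K + marked_points P N X \<phi> R h
  for P :: "'w measure" and N and X :: "nat \<Rightarrow> 'w \<Rightarrow> 'a::euclidean_space" and \<phi> K R h
begin

lemma nn_integral_first_moment:
  assumes [measurable]: "v \<in> borel_measurable borel"
  shows "(\<integral>\<^sup>+n. \<integral>\<^sup>+\<omega>. of_bool (enat n < N \<omega>) * v (X n \<omega>) \<partial>P \<partial>count_space UNIV) = ennreal (Re (K 0)) * (\<integral>\<^sup>+x. v x \<partial>lborel)"
proof -
  interpret PL: product_sigma_finite "\<lambda>_::nat. lborel :: 'a measure" by standard
  have bij: "bij_betw (\<lambda>n. \<lambda>i\<in>{..<1::nat}. n) (UNIV :: nat set) (inj_tuples 1 UNIV)"
    by (rule bij_betw_byWitness[where f'="\<lambda>s. s 0"])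
       (auto simp: inj_tuples_def fun_eq_iff PiE_iff extensional_def restrict_def inj_on_def)
  have "(\<integral>\<^sup>+x. v (x 0) \<partial>factorial_moment 1) =
      (\<integral>\<^sup>+s. \<integral>\<^sup>+\<omega>. of_bool (active 1 s \<omega>) * v (tuple 1 s \<omega> 0) \<partial>P \<partial>count_space (inj_tuples 1 UNIV))"
    by (rule nn_integral_factorial_moment) simp
  also have "\<dots> = (\<integral>\<^sup>+n. \<integral>\<^sup>+\<omega>. of_bool (active 1 (\<lambda>i\<in>{..<1::nat}. n) \<omega>) * v (tuple 1 (\<lambda>i\<in>{..<1::nat}. n) \<omega> 0) \<partial>P \<partial>count_space UNIV)"
    by (rule nn_integral_bij_count_space[OF bij, symmetric])
  also have "\<dots> = (\<integral>\<^sup>+n. \<integral>\<^sup>+\<omega>. of_bool (enat n < N \<omega>) * v (X n \<omega>) \<partial>P \<partial>count_space UNIV)"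
    by (simp add: active_def tuple_def)
  finally have eq: "\<dots> = (\<integral>\<^sup>+x. v (x 0) \<partial>factorial_moment 1)" ..
  have m: "(\<lambda>x. v (x 0)) \<in> borel_measurable (PiM {..<1::nat} (\<lambda>_. lborel))"
    by (rule measurable_compose[OF measurable_component_singleton]) auto
  have "(\<integral>\<^sup>+x. v (x 0) \<partial>factorial_moment 1) = (\<integral>\<^sup>+x. ennreal (Re (K 0)) * v (x 0) \<partial>PiM {..<1::nat} (\<lambda>_. lborel))"
    unfolding factorial_moment_eq correlation_det_1 using m by (subst nn_integral_density) auto
  also have "\<dots> = ennreal (Re (K 0)) * (\<integral>\<^sup>+x. v (x 0) \<partial>PiM {0::nat} (\<lambda>_. lborel))"
    using m by (subst nn_integral_cmult) (simp_all add: lessThan_Suc)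
  also have "(\<integral>\<^sup>+x. v (x 0) \<partial>PiM {0::nat} (\<lambda>_. lborel)) = (\<integral>\<^sup>+x. v x \<partial>lborel)"
    by (rule PL.product_nn_integral_singleton) simp
  finally show ?thesis unfolding eq .
qed

lemma campbell:
  assumes [measurable]: "v \<in> borel_measurable (borel \<Otimes>\<^sub>M borel)"
  shows "(\<integral>\<^sup>+\<omega>. (\<Sum>n. of_bool (enat n < N \<omega>) * v (X n \<omega>, R n \<omega>)) \<partial>P) =
    ennreal (Re (K 0)) * (\<integral>\<^sup>+x. \<integral>\<^sup>+r. v (x, r) \<partial>mark_law \<partial>lborel)"
proof -
  have "(\<integral>\<^sup>+\<omega>. (\<Sum>n. of_bool (enat n < N \<omega>) * v (X n \<omega>, R n \<omega>)) \<partial>P) =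
     (\<Sum>n. \<integral>\<^sup>+\<omega>. of_bool (enat n < N \<omega>) * v (X n \<omega>, R n \<omega>) \<partial>P)"
    by (rule nn_integral_suminf) measurable
  also have "\<dots> = (\<Sum>n. \<integral>\<^sup>+\<omega>. of_bool (enat n < N \<omega>) * (\<integral>\<^sup>+r. v (X n \<omega>, r) \<partial>mark_law) \<partial>P)"
    by (intro suminf_cong nn_integral_mark) simp
  also have "\<dots> = (\<integral>\<^sup>+n. \<integral>\<^sup>+\<omega>. of_bool (enat n < N \<omega>) * (\<integral>\<^sup>+r. v (X n \<omega>, r) \<partial>mark_law) \<partial>P \<partial>count_space UNIV)"
    by (rule nn_integral_count_space_nat[symmetric])
  also have "\<dots> = ennreal (Re (K 0)) * (\<integral>\<^sup>+x. \<integral>\<^sup>+r. v (x, r) \<partial>mark_law \<partial>lborel)"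
    by (rule nn_integral_first_moment) measurable
  finally show ?thesis .
qed

text \<open>The value of a divergent series is arbitrary; what counts is that the series converges
  absolutely almost everywhere once \<open>g\<close> has a finite first moment, see
  \<open>AE_marked_summable\<close>.\<close>

definition marked_sum :: "('a \<times> real \<Rightarrow> real) \<Rightarrow> 'w \<Rightarrow> real" where
  "marked_sum g \<omega> = (\<Sum>n. of_bool (enat n < N \<omega>) * g (X n \<omega>, R n \<omega>))"

lemma marked_sum_measurable[measurable]:
  assumes [measurable]: "g \<in> borel_measurable (borel \<Otimes>\<^sub>M borel)"
  shows "marked_sum g \<in> borel_measurable P"
  unfolding marked_sum_def by measurable

text \<open>By Campbell's formula the sum of the moduli has finite mean, hence is almost surely
  finite.\<close>

lemma AE_marked_summable:
  assumes [measurable]: "g \<in> borel_measurable (borel \<Otimes>\<^sub>M borel)"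
    and g: "(\<integral>\<^sup>+x. \<integral>\<^sup>+r. ennreal (norm (g (x, r) :: real)) \<partial>mark_law \<partial>lborel) < \<infinity>"
  shows "AE \<omega> in P. summable (\<lambda>n. norm (of_bool (enat n < N \<omega>) * g (X n \<omega>, R n \<omega>)))"
proof -
  let ?S = "\<lambda>\<omega>. \<Sum>n. of_bool (enat n < N \<omega>) * ennreal (norm (g (X n \<omega>, R n \<omega>)))"
  have "(\<integral>\<^sup>+\<omega>. ?S \<omega> \<partial>P) < \<infinity>"
    using campbell[of "\<lambda>z. ennreal (norm (g z))"] g by (simp add: ennreal_mult_eq_top_iff less_top[symmetric])
  then have "AE \<omega> in P. ?S \<omega> \<noteq> \<infinity>" by (intro nn_integral_noteq_infinite) auto
  then show ?thesis
  proof eventually_elim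
    case (elim \<omega>)
    have "of_bool b * ennreal x = ennreal (of_bool b * x)" for b x by (cases b) auto
    then have "?S \<omega> = (\<Sum>n. ennreal (norm (of_bool (enat n < N \<omega>) * g (X n \<omega>, R n \<omega>))))"
      by (simp add: abs_mult)
    with elim have ne: "(\<Sum>n. ennreal (norm (of_bool (enat n < N \<omega>) * g (X n \<omega>, R n \<omega>)))) \<noteq> \<top>"
      by (simp only: infinity_ennreal_def not_False_eq_True)
    show ?case by (rule summable_suminf_not_top[OF norm_ge_zero ne])
  qed
qed

text \<open>Only the first \<open>m\<close> labels are used at first. The product of the
  \<open>1 + a n\<close> is expanded over tuples of labels, the marks are averaged inside each term,
  and then \<open>m\<close> tends to infinity on both sides: on the left by dominated convergence,
  the products having modulus one, on the right by Tannery's theorem with \<open>majorant\<close>,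
  summable because \<open>e < 1\<close>.\<close>

proposition characteristic_functional:
  fixes g :: "'a \<times> real \<Rightarrow> real"
  defines "V \<equiv> \<lambda>x. \<integral>r. (iexp (g (x, r)) - 1) \<partial>mark_law"
  assumes g_meas[measurable]: "g \<in> borel_measurable (borel \<Otimes>\<^sub>M borel)"
    and g: "(\<integral>\<^sup>+x. \<integral>\<^sup>+r. ennreal (norm (g (x, r))) \<partial>mark_law \<partial>lborel) < \<infinity>"
    and wk: "weighted_kernel lborel \<kappa> (\<lambda>x. norm (V x)) t e" and e: "e < 1"
  obtains D where "norm (D - 1) \<le> e\<^sup>2 / (1 - e)"
    and "(\<integral>\<omega>. iexp (marked_sum g \<omega>) \<partial>P) = D * exp (\<integral>x. V x * K 0 \<partial>lborel)"
proof -
  interpret w: weighted_kernel lborel \<kappa> "\<lambda>x. norm (V x)" t e by fact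
  have V_meas[measurable]: "V \<in> borel_measurable borel"
    unfolding V_def by measurable
  have iexp_meas[measurable]: "(\<lambda>z. iexp (g z)) \<in> borel_measurable (borel \<Otimes>\<^sub>M borel)" by measurable
  define v where "v = (\<lambda>z. iexp (g z) - 1)"
  have v_meas[measurable]: "v \<in> borel_measurable (borel \<Otimes>\<^sub>M borel)" unfolding v_def by measurable
  have v2: "norm (v z) \<le> 2" for z
    unfolding v_def using norm_triangle_ineq4[of "iexp (g z)" 1] by simp
  \<comment> \<open>The share of the label tuple \<open>s\<close> after averaging over the
    marks.\<close>
  define c where "c = (\<lambda>k s. \<integral>\<omega>. of_bool (active k s \<omega>) * (\<Prod>i<k. V (X (s i) \<omega>)) \<partial>P)"
  \<comment> \<open>\<open>1 + a n\<close> is the factor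
    \<open>iexp (g (X n \<omega>, R n \<omega>))\<close> for a label in use and 1 for any
    other.\<close>
  define a where "a = (\<lambda>n \<omega>. of_bool (enat n < N \<omega>) * v (X n \<omega>, R n \<omega>))"
  have a_meas[measurable]: "a n \<in> borel_measurable P" for n unfolding a_def by measurable
  have a2: "norm (a n \<omega>) \<le> 2" for n \<omega> using v2 by (simp add: a_def norm_mult)

  have step1: "(\<integral>\<omega>. (\<Prod>n<m. 1 + a n \<omega>) \<partial>P) = (\<Sum>k\<le>m. (\<Sum>s\<in>inj_tuples k {..<m}. c k s) / fact k)" for m
  proof -
    have int: "integrable P (\<lambda>\<omega>. \<Prod>i<k. a (s i) \<omega>)" for k :: nat and s
    proof (rule integrable_const_bound[where B="2 ^ k"])
      have "norm (\<Prod>i<k. a (s i) \<omega>) \<le> (\<Prod>i<k. 2)" for \<omega>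
        unfolding prod_norm[symmetric] by (intro prod_mono) (simp add: a2)
      then show "AE \<omega> in P. norm (\<Prod>i<k. a (s i) \<omega>) \<le> 2 ^ k" by simp
    qed measurable
    have ci: "(\<integral>\<omega>. (\<Prod>i<k. a (s i) \<omega>) \<partial>P) = c k s" if s: "s \<in> inj_tuples k {..<m}" for k s
    proof -
      have "of_bool (active k s \<omega>) = (\<Prod>i<k. of_bool (enat (s i) < N \<omega>) :: complex)" for \<omega>
        by (auto simp: active_def)
      then have "(\<Prod>i<k. a (s i) \<omega>) = of_bool (active k s \<omega>) * (\<Prod>i<k. v (X (s i) \<omega>, R (s i) \<omega>))" for \<omega>
        by (simp add: a_def prod.distrib)
      moreover have "s \<in> inj_tuples k UNIV" using s inj_tuples_mono[of "{..<m}" UNIV k] by auto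
      ultimately show ?thesis
        using integral_active_marks[OF v_meas v2, of s k] by (simp add: c_def V_def v_def)
    qed
    have "(\<integral>\<omega>. (\<Prod>n<m. 1 + a n \<omega>) \<partial>P) = (\<integral>\<omega>. (\<Sum>k\<le>m. (\<Sum>s\<in>inj_tuples k {..<m}. \<Prod>i<k. a (s i) \<omega>) / fact k) \<partial>P)"
      by (simp only: prod_one_plus_inj_tuples)
    also have "\<dots> = (\<Sum>k\<le>m. (\<Sum>s\<in>inj_tuples k {..<m}. \<integral>\<omega>. (\<Prod>i<k. a (s i) \<omega>) \<partial>P) / fact k)"
      by (simp add: Bochner_Integration.integral_sum int)
    also have "\<dots> = (\<Sum>k\<le>m. (\<Sum>s\<in>inj_tuples k {..<m}. c k s) / fact k)"
      by (simp add: ci)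
    finally show ?thesis .
  qed

  define U where "U = (\<lambda>k (x :: nat \<Rightarrow> 'a). \<Prod>i<k. V (x i))"
  have U_meas[measurable]: "U k \<in> borel_measurable (PiM {..<k} (\<lambda>_. borel))" for k
    unfolding U_def by measurable
  have U_meas'[measurable]: "U k \<in> borel_measurable (PiM {..<k} (\<lambda>_. lborel))" for k
    unfolding U_def by measurable
  have wU: "norm (U k x) = (\<Prod>i<k. norm (V (x i)))" for k x by (simp add: U_def prod_norm)
  have nnU: "(\<integral>\<^sup>+x. ennreal (norm (U k x)) \<partial>factorial_moment k) \<le> ennreal (fact k * w.majorant k)" for k
  proof -
    have "(\<integral>\<^sup>+x. ennreal (norm (U k x)) \<partial>factorial_moment k) =
       (\<integral>\<^sup>+x. ennreal (Re (correlation_det \<kappa> k x)) * ennreal (norm (U k x)) \<partial>PiM {..<k} (\<lambda>_. lborel))"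
      unfolding factorial_moment_eq by (subst nn_integral_density) (auto intro!: w.correlation_det_measurable measurable_compose[OF _ measurable_ennreal] borel_measurable_Re)
    also have "\<dots> \<le> (\<integral>\<^sup>+x. ennreal ((\<Prod>i<k. norm (V (x i))) * norm (correlation_det \<kappa> k x)) \<partial>PiM {..<k} (\<lambda>_. lborel))"
    proof (rule nn_integral_mono)
      fix x :: "nat \<Rightarrow> 'a"
      have "ennreal (Re (correlation_det \<kappa> k x)) \<le> ennreal (norm (correlation_det \<kappa> k x))"
        by (intro ennreal_leI complex_Re_le_cmod)
      then have "ennreal (Re (correlation_det \<kappa> k x)) * ennreal (norm (U k x)) \<le> ennreal (norm (correlation_det \<kappa> k x)) * ennreal (norm (U k x))"
        by (rule mult_right_mono) simp
      also have "\<dots> = ennreal ((\<Prod>i<k. norm (V (x i))) * norm (correlation_det \<kappa> k x))"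
        unfolding wU[symmetric] by (simp add: ennreal_mult mult.commute)
      finally show "ennreal (Re (correlation_det \<kappa> k x)) * ennreal (norm (U k x)) \<le> ennreal ((\<Prod>i<k. norm (V (x i))) * norm (correlation_det \<kappa> k x))" .
    qed
    also have "\<dots> \<le> ennreal (fact k * w.majorant k)" by (rule w.nn_integral_correlation_det_le)
    finally show ?thesis .
  qed
  have majorant_nonneg: "0 \<le> w.majorant k" for k
    unfolding w.majorant_def using w.te_nonneg by (intro sum_nonneg) auto
  have U_int: "integrable (factorial_moment k) (U k)" for k
  proof (rule integrableI_bounded)
    show "(\<integral>\<^sup>+x. ennreal (norm (U k x)) \<partial>factorial_moment k) < \<infinity>"
      using le_less_trans[OF nnU] by simp
    show "U k \<in> borel_measurable (factorial_moment k)"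
      using U_meas by (simp add: measurable_cong_sets[OF sets_factorial_moment refl])
  qed
  have Ut: "U k (tuple k s \<omega>) = (\<Prod>i<k. V (X (s i) \<omega>))" for k s \<omega>
    by (simp add: U_def tuple_def)
  let ?C = "\<lambda>k. count_space (inj_tuples k (UNIV :: nat set))"
  have c_int: "integrable (?C k) (c k)" and c_eq: "(\<integral>s. c k s \<partial>?C k) = (\<integral>x. U k x \<partial>factorial_moment k)" for k
    using integral_factorial_moment[OF U_int, of k] unfolding c_def Ut by simp_all
  \<comment> \<open>Summed over all tuples of labels, so the bound does not depend on the cut-off
    \<open>m\<close>; this is the domination in Tannery's theorem.\<close>
  have c_norm: "(\<integral>\<^sup>+s. ennreal (norm (c k s)) \<partial>?C k) \<le> ennreal (fact k * w.majorant k)" for k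
  proof -
    have "(\<integral>\<^sup>+s. ennreal (norm (c k s)) \<partial>?C k) \<le> (\<integral>\<^sup>+s. \<integral>\<^sup>+\<omega>. of_bool (active k s \<omega>) * ennreal (norm (U k (tuple k s \<omega>))) \<partial>P \<partial>?C k)"
    proof (rule nn_integral_mono)
      fix s
      have "ennreal (norm (c k s)) \<le> (\<integral>\<^sup>+\<omega>. ennreal (norm (of_bool (active k s \<omega>) * U k (tuple k s \<omega>))) \<partial>P)"
      proof (cases "integrable P (\<lambda>\<omega>. of_bool (active k s \<omega>) * U k (tuple k s \<omega>))")
        case True
        then show ?thesis unfolding c_def Ut[symmetric] by (rule integral_norm_bound_ennreal)
      next
        case False
        then show ?thesis unfolding c_def Ut[symmetric] by (simp add: not_integrable_integral_eq)
      qed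
      also have "\<dots> = (\<integral>\<^sup>+\<omega>. of_bool (active k s \<omega>) * ennreal (norm (U k (tuple k s \<omega>))) \<partial>P)"
        by (intro nn_integral_cong) (simp add: of_bool_def)
      finally show "ennreal (norm (c k s)) \<le> \<dots>" .
    qed
    also have "\<dots> = (\<integral>\<^sup>+x. ennreal (norm (U k x)) \<partial>factorial_moment k)"
      by (rule nn_integral_factorial_moment[symmetric]) measurable
    also note nnU
    finally show ?thesis .
  qed
  define Sk where "Sk = (\<lambda>k m. \<Sum>s\<in>inj_tuples k {..<m::nat}. c k s)"
  have Sk_bound: "norm (Sk k m) \<le> fact k * w.majorant k" for k m
  proof -
    have "ennreal (norm (Sk k m)) \<le> ennreal (\<Sum>s\<in>inj_tuples k {..<m}. norm (c k s))"
      unfolding Sk_def by (intro ennreal_leI norm_sum)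
    also have "\<dots> = (\<integral>\<^sup>+s. ennreal (norm (c k s)) \<partial>count_space (inj_tuples k {..<m}))"
      by (subst nn_integral_count_space_finite) (simp_all add: finite_inj_tuples)
    also have "\<dots> = (\<integral>\<^sup>+s. ennreal (norm (c k s)) * indicator (inj_tuples k {..<m}) s \<partial>count_space (inj_tuples k {..<m}))"
      by (intro nn_integral_cong) simp
    also have "\<dots> = (\<integral>\<^sup>+s. ennreal (norm (c k s)) * indicator (inj_tuples k {..<m}) s \<partial>?C k)"
      by (rule nn_integral_count_space_eq) (use inj_tuples_mono[of "{..<m}" UNIV k] in auto)
    also have "\<dots> \<le> (\<integral>\<^sup>+s. ennreal (norm (c k s)) \<partial>?C k)"
      by (intro nn_integral_mono) (simp add: indicator_def)
    also note c_norm
    finally show ?thesis using majorant_nonneg by simp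
  qed
  have Sk_lim: "(\<lambda>m. Sk k m) \<longlonglongrightarrow> (\<integral>x. U k x \<partial>factorial_moment k)" for k
  proof -
    \<comment> \<open>A finite partial sum written as an integral over all tuples, so that dominated
      convergence applies.\<close>
    have eq: "Sk k m = (\<integral>s. indicator (inj_tuples k {..<m}) s *\<^sub>R c k s \<partial>?C k)" for m
    proof -
      have sub: "inj_tuples k {..<m} \<subseteq> inj_tuples k UNIV" by (rule inj_tuples_mono) simp
      have "(\<integral>s. indicator (inj_tuples k {..<m}) s *\<^sub>R c k s \<partial>?C k) =
        (\<integral>s. c k s \<partial>count_space (inj_tuples k {..<m}))"
        using sub by (subst integral_restrict_space[symmetric]) (auto simp: restrict_count_space inf_absorb1 inf_absorb2)
      also have "\<dots> = Sk k m"
        unfolding Sk_def by (rule lebesgue_integral_count_space_finite) (simp add: finite_inj_tuples)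
      finally show ?thesis ..
    qed
    show ?thesis unfolding eq c_eq[symmetric]
    proof (rule integral_dominated_convergence[where w="\<lambda>s. norm (c k s)"])
      show "integrable (?C k) (\<lambda>s. norm (c k s))" using c_int by simp
      show "AE s in ?C k. (\<lambda>m. indicator (inj_tuples k {..<m}) s *\<^sub>R c k s) \<longlonglongrightarrow> c k s"
      proof (rule AE_I2)
        fix s :: "nat \<Rightarrow> nat" assume "s \<in> space (?C k)"
        then have s: "s \<in> inj_tuples k UNIV" by simp
        have "\<forall>\<^sub>F m in sequentially. indicator (inj_tuples k {..<m}) s *\<^sub>R c k s = c k s"
          using eventually_gt_at_top[of "\<Sum>i<k. s i"]
        proof eventually_elim
          case (elim m)
          have "s i < m" if "i < k" for i
          proof -
            have "s i \<le> (\<Sum>i<k. s i)" by (rule member_le_sum) (use that in auto)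
            then show ?thesis using elim by simp
          qed
          then have "s \<in> inj_tuples k {..<m}" using s by (auto simp: inj_tuples_def PiE_iff)
          then show ?case by simp
        qed
        then show "(\<lambda>m. indicator (inj_tuples k {..<m}) s *\<^sub>R c k s) \<longlonglongrightarrow> c k s" by (rule tendsto_eventually)
      qed
      show "AE s in ?C k. norm (indicator (inj_tuples k {..<m}) s *\<^sub>R c k s) \<le> norm (c k s)" for m
        by (rule AE_I2) (simp add: indicator_def)
    qed simp_all
  qed
  \<comment> \<open>The determinant is almost everywhere real and nonnegative, so the density built
    from \<open>Re\<close> may be replaced by the determinant itself.\<close>
  have fm_det: "(\<integral>x. U k x \<partial>factorial_moment k) = (\<integral>x. (\<Prod>i<k. V (x i)) * correlation_det \<kappa> k x \<partial>PiM {..<k} (\<lambda>_. lborel))" for k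
  proof -
    have ae: "AE x in PiM {..<k} (\<lambda>_. lborel). Im (correlation_det \<kappa> k x) = 0 \<and> 0 \<le> Re (correlation_det \<kappa> k x)"
    proof (cases "k = 0")
      case True
      then show ?thesis by (simp add: w.correlation_det_eq)
    next
      case False
      then have k: "1 \<le> k" by simp
      show ?thesis
        by (rule dpp[unfolded dpp_def, THEN conjunct2, THEN conjunct2, THEN conjunct2, THEN conjunct2, THEN spec[of _ k],
            THEN mp, OF k, THEN conjunct1])
    qed
    have "(\<integral>x. U k x \<partial>factorial_moment k) = (\<integral>x. Re (correlation_det \<kappa> k x) *\<^sub>R U k x \<partial>PiM {..<k} (\<lambda>_. lborel))"
      unfolding factorial_moment_eq
    proof (rule integral_density)
      show "(\<lambda>x. Re (correlation_det \<kappa> k x)) \<in> borel_measurable (PiM {..<k} (\<lambda>_. lborel))"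
        by (rule measurable_compose[OF w.correlation_det_measurable borel_measurable_Re])
      show "AE x in PiM {..<k} (\<lambda>_. lborel). 0 \<le> Re (correlation_det \<kappa> k x)" using ae by eventually_elim simp
    qed simp
    also have "\<dots> = (\<integral>x. (\<Prod>i<k. V (x i)) * correlation_det \<kappa> k x \<partial>PiM {..<k} (\<lambda>_. lborel))"
    proof (rule integral_cong_AE)
      show "AE x in PiM {..<k} (\<lambda>_. lborel). Re (correlation_det \<kappa> k x) *\<^sub>R U k x = (\<Prod>i<k. V (x i)) * correlation_det \<kappa> k x"
        using ae
      proof eventually_elim
        case (elim x)
        then have "correlation_det \<kappa> k x = complex_of_real (Re (correlation_det \<kappa> k x))" by (simp add: complex_eq_iff)
        then show ?case by (metis U_def mult.commute scaleR_conv_of_real)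
      qed
      show "(\<lambda>x. Re (correlation_det \<kappa> k x) *\<^sub>R U k x) \<in> borel_measurable (PiM {..<k} (\<lambda>_. lborel))"
        by (intro borel_measurable_scaleR measurable_compose[OF w.correlation_det_measurable borel_measurable_Re] U_meas')
      show "(\<lambda>x. (\<Prod>i<k. V (x i)) * correlation_det \<kappa> k x) \<in> borel_measurable (PiM {..<k} (\<lambda>_. lborel))"
        using U_meas'[of k] unfolding U_def by (intro borel_measurable_times w.correlation_det_measurable)
    qed
    finally show ?thesis .
  qed

  have "V \<in> borel_measurable lborel" by simp
  then obtain D where D: "norm (D - 1) \<le> e\<^sup>2 / (1 - e)"
    and sums: "(\<lambda>k. (\<integral>x. (\<Prod>i<k. V (x i)) * correlation_det \<kappa> k x \<partial>PiM {..<k} (\<lambda>_. lborel)) / fact k)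
      sums (D * exp (\<integral>x. V x * \<kappa> x x \<partial>lborel))"
    using w.fredholm_series[OF _ order_refl e] by blast
  have "(\<lambda>m. \<integral>\<omega>. (\<Prod>n<m. 1 + a n \<omega>) \<partial>P) \<longlonglongrightarrow> D * exp (\<integral>x. V x * \<kappa> x x \<partial>lborel)"
  proof -
    have "(\<lambda>m. \<Sum>k. Sk k m / fact k) \<longlonglongrightarrow> (\<Sum>k. (\<integral>x. U k x \<partial>factorial_moment k) / fact k)"
    proof (rule tannerys_theorem[THEN conjunct2, THEN conjunct2])
      show "(\<lambda>m. Sk k m / fact k) \<longlonglongrightarrow> (\<integral>x. U k x \<partial>factorial_moment k) / fact k" for k
        by (intro tendsto_divide Sk_lim tendsto_const) simp
      have "norm (Sk k m / fact k) \<le> w.majorant k" for k m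
        using Sk_bound[of k m] by (simp add: norm_divide divide_le_eq mult.commute)
      then show "\<forall>\<^sub>F (k, m) in at_top \<times>\<^sub>F sequentially. norm (Sk k m / fact k) \<le> w.majorant k"
        by (intro always_eventually) auto
      show "summable w.majorant" by (rule w.summable_majorant[OF e])
    qed simp
    moreover have "(\<Sum>k. (\<integral>x. U k x \<partial>factorial_moment k) / fact k) = D * exp (\<integral>x. V x * \<kappa> x x \<partial>lborel)"
      unfolding fm_det by (rule sums_unique[OF sums, symmetric])
    \<comment> \<open>No more than \<open>m\<close> distinct labels can be chosen below
      \<open>m\<close>, so the series is the finite expansion of \<open>step1\<close>.\<close>
    moreover have "(\<Sum>k. Sk k m / fact k) = (\<integral>\<omega>. (\<Prod>n<m. 1 + a n \<omega>) \<partial>P)" for m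
    proof -
      have "inj_tuples k {..<m} = {}" if "k > m" for k
      proof -
        have "\<not> (s ` {..<k} \<subseteq> {..<m} \<and> inj_on s {..<k})" for s :: "nat \<Rightarrow> nat"
          using card_inj_on_le[of s "{..<k}" "{..<m}"] that by auto
        then show ?thesis by (auto simp: inj_tuples_def PiE_iff)
      qed
      then have "Sk k m / fact k = 0" if "k \<notin> {..m}" for k using that by (simp add: Sk_def)
      then have "(\<Sum>k. Sk k m / fact k) = (\<Sum>k\<le>m. Sk k m / fact k)" by (intro suminf_finite) auto
      then show ?thesis unfolding step1 Sk_def .
    qed
    ultimately show ?thesis by simp
  qed
  moreover have "(\<lambda>m. \<integral>\<omega>. (\<Prod>n<m. 1 + a n \<omega>) \<partial>P) \<longlonglongrightarrow> (\<integral>\<omega>. iexp (marked_sum g \<omega>) \<partial>P)"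
  proof (rule integral_dominated_convergence[where w="\<lambda>_. 1"])
    let ?g = "\<lambda>n \<omega>. of_bool (enat n < N \<omega>) * g (X n \<omega>, R n \<omega>)"
    have pe: "(\<Prod>n<m. 1 + a n \<omega>) = iexp (\<Sum>n<m. ?g n \<omega>)" for m \<omega>
    proof -
      have "1 + a n \<omega> = iexp (?g n \<omega>)" for n by (simp add: a_def v_def)
      then show ?thesis by (simp only: of_real_sum sum_distrib_left exp_sum[OF finite_lessThan])
    qed
    show "AE \<omega> in P. (\<lambda>m. \<Prod>n<m. 1 + a n \<omega>) \<longlonglongrightarrow> iexp (marked_sum g \<omega>)"
      using AE_marked_summable[OF g_meas g]
    proof eventually_elim
      case (elim \<omega>)
      have "(\<lambda>m. \<Sum>n<m. ?g n \<omega>) \<longlonglongrightarrow> marked_sum g \<omega>"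
        unfolding marked_sum_def by (intro summable_LIMSEQ summable_norm_cancel[OF elim])
      then show ?case unfolding pe by (intro tendsto_intros)
    qed
    show "AE \<omega> in P. norm (\<Prod>n<m. 1 + a n \<omega>) \<le> 1" for m
      unfolding pe by simp
    show "(\<lambda>\<omega>. iexp (marked_sum g \<omega>)) \<in> borel_measurable P" by measurable
    show "(\<lambda>\<omega>. \<Prod>n<m. 1 + a n \<omega>) \<in> borel_measurable P" for m by measurable
    show "integrable P (\<lambda>_. 1 :: real)" by simp
  qed
  ultimately have "(\<integral>\<omega>. iexp (marked_sum g \<omega>) \<partial>P) = D * exp (\<integral>x. V x * K 0 \<partial>lborel)"
    using LIMSEQ_unique by fastforce
  with D show thesis by (rule that)
qed

end

section \<open>Ball masses and heavy-tailed radii\<close>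

lemma ennreal_power2_le_imp_le:
  fixes a b :: ennreal
  assumes "a\<^sup>2 \<le> b\<^sup>2"
  shows "a \<le> b"
proof (cases b)
  case (real r)
  then show ?thesis using ennreal_le_if_power2_le[of a r] assms by (simp add: ennreal_power)
qed simp

text \<open>Minkowski's integral inequality, squared. The square of the inner integral becomes a
  double integral over \<open>r\<close> and \<open>s\<close>, and Cauchy-Schwarz in \<open>x\<close>
  bounds the mixed term by \<open>b r * b s\<close>.\<close>

lemma nn_integral_minkowski:
  fixes g :: "'x \<times> 'y \<Rightarrow> ennreal" and b :: "'y \<Rightarrow> ennreal"
  assumes "sigma_finite_measure M" "sigma_finite_measure L"
    and [measurable]: "g \<in> borel_measurable (M \<Otimes>\<^sub>M L)" "b \<in> borel_measurable L"
    and b: "AE r in L. (\<integral>\<^sup>+x. (g (x, r))\<^sup>2 \<partial>M) \<le> (b r)\<^sup>2"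
  shows "(\<integral>\<^sup>+x. (\<integral>\<^sup>+r. g (x, r) \<partial>L)\<^sup>2 \<partial>M) \<le> (\<integral>\<^sup>+r. b r \<partial>L)\<^sup>2"
proof -
  interpret M: sigma_finite_measure M by fact
  interpret L: sigma_finite_measure L by fact
  interpret pr: pair_sigma_finite M L by standard
  have "(\<integral>\<^sup>+x. (\<integral>\<^sup>+r. g (x, r) \<partial>L)\<^sup>2 \<partial>M) = (\<integral>\<^sup>+x. \<integral>\<^sup>+r. g (x, r) * (\<integral>\<^sup>+s. g (x, s) \<partial>L) \<partial>L \<partial>M)"
    unfolding power2_eq_square by (intro nn_integral_cong nn_integral_multc[symmetric]) measurable
  also have "\<dots> = (\<integral>\<^sup>+r. \<integral>\<^sup>+x. g (x, r) * (\<integral>\<^sup>+s. g (x, s) \<partial>L) \<partial>M \<partial>L)"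
    by (rule pr.Fubini'[symmetric]) measurable
  also have "\<dots> = (\<integral>\<^sup>+r. \<integral>\<^sup>+x. \<integral>\<^sup>+s. g (x, r) * g (x, s) \<partial>L \<partial>M \<partial>L)"
    by (intro nn_integral_cong nn_integral_cmult[symmetric]) measurable
  also have "\<dots> = (\<integral>\<^sup>+r. \<integral>\<^sup>+s. \<integral>\<^sup>+x. g (x, r) * g (x, s) \<partial>M \<partial>L \<partial>L)"
  proof (rule nn_integral_cong)
    fix r assume [measurable]: "r \<in> space L"
    show "(\<integral>\<^sup>+x. \<integral>\<^sup>+s. g (x, r) * g (x, s) \<partial>L \<partial>M) = (\<integral>\<^sup>+s. \<integral>\<^sup>+x. g (x, r) * g (x, s) \<partial>M \<partial>L)"
      by (rule pr.Fubini'[symmetric]) measurable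
  qed
  also have "\<dots> \<le> (\<integral>\<^sup>+r. \<integral>\<^sup>+s. b r * b s \<partial>L \<partial>L)"
  proof (rule nn_integral_mono_AE)
    show "AE r in L. (\<integral>\<^sup>+s. \<integral>\<^sup>+x. g (x, r) * g (x, s) \<partial>M \<partial>L) \<le> (\<integral>\<^sup>+s. b r * b s \<partial>L)"
      using b AE_space
    proof eventually_elim
      case (elim r)
      note r = elim
      show ?case
      proof (rule nn_integral_mono_AE)
        show "AE s in L. (\<integral>\<^sup>+x. g (x, r) * g (x, s) \<partial>M) \<le> b r * b s"
          using b AE_space
        proof eventually_elim
          case (elim s)
          note [measurable] = elim(2) r(2)
          have "(\<integral>\<^sup>+x. g (x, r) * g (x, s) \<partial>M)\<^sup>2 \<le> (\<integral>\<^sup>+x. (g (x, r))\<^sup>2 \<partial>M) * (\<integral>\<^sup>+x. (g (x, s))\<^sup>2 \<partial>M)"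
            by (rule Cauchy_Schwarz_nn_integral) measurable
          also have "\<dots> \<le> (b r)\<^sup>2 * (b s)\<^sup>2" using elim r by (intro mult_mono) auto
          also have "\<dots> = (b r * b s)\<^sup>2" by (rule power_mult_distrib[symmetric])
          finally show ?case by (rule ennreal_power2_le_imp_le)
        qed
      qed
    qed
  qed
  also have "\<dots> = (\<integral>\<^sup>+r. b r \<partial>L)\<^sup>2"
    by (simp add: nn_integral_cmult nn_integral_multc power2_eq_square)
  finally show ?thesis .
qed

section \<open>Power weights and the growth condition\<close>

lemma nn_integral_powr_near_0:
  assumes "-1 < (a::real)"
  shows "(\<integral>\<^sup>+r. indicator {0..1} r * ennreal (r powr a) \<partial>lborel) = ennreal (1 / (a + 1))"
proof -
  have "((\<lambda>x. x powr a) has_integral (1 powr (a+1) / (a+1))) {0..1}"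
    using assms by (intro has_integral_powr_from_0) auto
  from nn_integral_has_integral_lebesgue[OF _ this]
  have "(\<integral>\<^sup>+r. ennreal (indicator {0..1} r * r powr a) \<partial>lborel) = ennreal (1 / (a + 1))" by simp
  then show ?thesis by (simp add: ennreal_mult' ennreal_indicator)
qed

lemma nn_integral_powr_near_infinity:
  assumes "(a::real) < -1"
  shows "(\<integral>\<^sup>+r. indicator {1..} r * ennreal (r powr a) \<partial>lborel) = ennreal (- 1 / (a + 1))"
proof -
  have "((\<lambda>x. x powr a) has_integral (- (1 powr (a+1)) / (a+1))) {1..}"
    using assms by (intro has_integral_powr_to_inf) auto
  from nn_integral_has_integral_lebesgue[OF _ this]
  have "(\<integral>\<^sup>+r. ennreal (indicator {1..} r * r powr a) \<partial>lborel) = ennreal (- 1 / (a + 1))" by simp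
  then show ?thesis by (simp add: ennreal_mult' ennreal_indicator)
qed

text \<open>The minimum is \<open>r powr q\<close> below 1 and \<open>r powr p\<close> above, so
  raising \<open>p\<close> and lowering \<open>q\<close> both enlarge it. This brings two growth
  conditions to common exponents.\<close>

lemma min_powr_mono:
  fixes r :: real
  assumes "0 \<le> r" "p \<le> p'" "q' \<le> q" "p' \<le> q'"
  shows "min (r powr p) (r powr q) \<le> min (r powr p') (r powr q')"
proof (cases "r \<le> 1")
  case True
  have "r powr q \<le> r powr q'" "r powr q \<le> r powr p'"
    using assms True by (auto intro!: powr_mono')
  then show ?thesis by auto
next
  case False
  have "r powr p \<le> r powr p'" "r powr p \<le> r powr q'"
    using assms False by (auto intro!: powr_mono)
  then show ?thesis by auto
qed

text \<open>The growth condition of \<open>M_beta_plus\<close>, in a form that is closed under linear combinations.\<close>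

definition tame :: "real \<Rightarrow> ('a::euclidean_space \<times> real \<Rightarrow> real) \<Rightarrow> bool" where
  "tame \<beta> G \<longleftrightarrow> G \<in> borel_measurable (borel \<Otimes>\<^sub>M borel) \<and>
     (\<exists>p q C. 0 < p \<and> p < \<beta> \<and> \<beta> < q \<and> q \<le> 2 * real DIM('a) \<and> 0 \<le> C \<and>
        (\<forall>r\<ge>0. (\<integral>\<^sup>+x. ennreal ((G (x, r))\<^sup>2) \<partial>lborel) \<le> ennreal (C * min (r powr p) (r powr q)))) \<and>
     (\<exists>C\<ge>0. \<forall>r\<ge>0. (\<integral>\<^sup>+x. ennreal \<bar>G (x, r)\<bar> \<partial>lborel) \<le> ennreal (C * r powr real DIM('a)))"

lemma tame_measurable: "tame \<beta> G \<Longrightarrow> G \<in> borel_measurable (borel \<Otimes>\<^sub>M borel)"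
  by (simp add: tame_def)

lemma tame_linear_combination:
  fixes G H :: "'a::euclidean_space \<times> real \<Rightarrow> real"
  assumes "tame \<beta> G" "tame \<beta> H"
  shows "tame \<beta> (\<lambda>z. a * G z + b * H z)"
proof -
  have [measurable]: "G \<in> borel_measurable (borel \<Otimes>\<^sub>M borel)" "H \<in> borel_measurable (borel \<Otimes>\<^sub>M borel)"
    using assms by (auto intro: tame_measurable)
  obtain p q C where G: "0 < p" "p < \<beta>" "\<beta> < q" "q \<le> 2 * real DIM('a)" "0 \<le> C"
    "\<And>r. 0 \<le> r \<Longrightarrow> (\<integral>\<^sup>+x. ennreal ((G (x, r))\<^sup>2) \<partial>lborel) \<le> ennreal (C * min (r powr p) (r powr q))"
    using assms(1) unfolding tame_def by blast
  obtain p' q' C' where H: "0 < p'" "p' < \<beta>" "\<beta> < q'" "q' \<le> 2 * real DIM('a)" "0 \<le> C'"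
    "\<And>r. 0 \<le> r \<Longrightarrow> (\<integral>\<^sup>+x. ennreal ((H (x, r))\<^sup>2) \<partial>lborel) \<le> ennreal (C' * min (r powr p') (r powr q'))"
    using assms(2) unfolding tame_def by blast
  obtain A where A: "0 \<le> A" "\<And>r. 0 \<le> r \<Longrightarrow> (\<integral>\<^sup>+x. ennreal \<bar>G (x, r)\<bar> \<partial>lborel) \<le> ennreal (A * r powr real DIM('a))"
    using assms(1) unfolding tame_def by blast
  obtain B where B: "0 \<le> B" "\<And>r. 0 \<le> r \<Longrightarrow> (\<integral>\<^sup>+x. ennreal \<bar>H (x, r)\<bar> \<partial>lborel) \<le> ennreal (B * r powr real DIM('a))"
    using assms(2) unfolding tame_def by blast
  \<comment> \<open>The larger lower exponent is still below \<open>\<beta>\<close> and the smaller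
    upper exponent still above it. The factors 2 in \<open>D\<close> come from
    \<open>(x + y)\<^sup>2 \<le> 2 * x\<^sup>2 + 2 * y\<^sup>2\<close>.\<close>
  define P where "P = max p p'"
  define R where "R = min q q'"
  define D where "D = 2 * a\<^sup>2 * C + 2 * b\<^sup>2 * C'"
  have "(\<integral>\<^sup>+x. ennreal ((a * G (x, r) + b * H (x, r))\<^sup>2) \<partial>lborel) \<le> ennreal (D * min (r powr P) (r powr R))" if r: "0 \<le> r" for r
  proof -
    have "(\<integral>\<^sup>+x. ennreal ((a * G (x, r) + b * H (x, r))\<^sup>2) \<partial>lborel) \<le>
       (\<integral>\<^sup>+x. ennreal (2 * a\<^sup>2) * ennreal ((G (x, r))\<^sup>2) + ennreal (2 * b\<^sup>2) * ennreal ((H (x, r))\<^sup>2) \<partial>lborel)"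
    proof (rule nn_integral_mono)
      fix x
      have "(a * G (x, r) + b * H (x, r))\<^sup>2 \<le> 2 * a\<^sup>2 * (G (x, r))\<^sup>2 + 2 * b\<^sup>2 * (H (x, r))\<^sup>2"
        using zero_le_power2[of "a * G (x, r) - b * H (x, r)"]
        by (simp add: power2_sum power2_diff power_mult_distrib)
      then show "ennreal ((a * G (x, r) + b * H (x, r))\<^sup>2) \<le> ennreal (2 * a\<^sup>2) * ennreal ((G (x, r))\<^sup>2) + ennreal (2 * b\<^sup>2) * ennreal ((H (x, r))\<^sup>2)"
        by (simp add: ennreal_mult[symmetric] ennreal_plus[symmetric] del: ennreal_plus)
    qed
    also have "\<dots> = ennreal (2 * a\<^sup>2) * (\<integral>\<^sup>+x. ennreal ((G (x, r))\<^sup>2) \<partial>lborel) + ennreal (2 * b\<^sup>2) * (\<integral>\<^sup>+x. ennreal ((H (x, r))\<^sup>2) \<partial>lborel)"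
      by (simp add: nn_integral_add nn_integral_cmult)
    also have "\<dots> \<le> ennreal (2 * a\<^sup>2) * ennreal (C * min (r powr P) (r powr R)) + ennreal (2 * b\<^sup>2) * ennreal (C' * min (r powr P) (r powr R))"
    proof (intro add_mono mult_left_mono)
      have "C * min (r powr p) (r powr q) \<le> C * min (r powr P) (r powr R)"
        by (intro mult_left_mono min_powr_mono) (use r G H in \<open>auto simp: P_def R_def\<close>)
      then show "(\<integral>\<^sup>+x. ennreal ((G (x, r))\<^sup>2) \<partial>lborel) \<le> ennreal (C * min (r powr P) (r powr R))"
        using G(6)[OF r] order_trans ennreal_leI by blast
      have "C' * min (r powr p') (r powr q') \<le> C' * min (r powr P) (r powr R)"
        by (intro mult_left_mono min_powr_mono) (use r G H in \<open>auto simp: P_def R_def\<close>)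
      then show "(\<integral>\<^sup>+x. ennreal ((H (x, r))\<^sup>2) \<partial>lborel) \<le> ennreal (C' * min (r powr P) (r powr R))"
        using H(6)[OF r] order_trans ennreal_leI by blast
    qed simp_all
    also have "\<dots> = ennreal (D * min (r powr P) (r powr R))"
      using G(5) H(5) unfolding D_def
      by (simp add: ennreal_mult[symmetric] ennreal_plus[symmetric] algebra_simps del: ennreal_plus)
    finally show ?thesis .
  qed
  moreover have "0 < P" "P < \<beta>" "\<beta> < R" "R \<le> 2 * real DIM('a)" "0 \<le> D"
    using G(1-5) H(1-5) by (auto simp: P_def R_def D_def)
  moreover have "(\<integral>\<^sup>+x. ennreal \<bar>a * G (x, r) + b * H (x, r)\<bar> \<partial>lborel) \<le> ennreal ((\<bar>a\<bar> * A + \<bar>b\<bar> * B) * r powr real DIM('a))"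
    if r: "0 \<le> r" for r
  proof -
    have "(\<integral>\<^sup>+x. ennreal \<bar>a * G (x, r) + b * H (x, r)\<bar> \<partial>lborel) \<le>
       (\<integral>\<^sup>+x. ennreal \<bar>a\<bar> * ennreal \<bar>G (x, r)\<bar> + ennreal \<bar>b\<bar> * ennreal \<bar>H (x, r)\<bar> \<partial>lborel)"
    proof (rule nn_integral_mono)
      fix x
      have "\<bar>a * G (x, r) + b * H (x, r)\<bar> \<le> \<bar>a\<bar> * \<bar>G (x, r)\<bar> + \<bar>b\<bar> * \<bar>H (x, r)\<bar>"
        by (metis abs_mult abs_triangle_ineq)
      then show "ennreal \<bar>a * G (x, r) + b * H (x, r)\<bar> \<le> ennreal \<bar>a\<bar> * ennreal \<bar>G (x, r)\<bar> + ennreal \<bar>b\<bar> * ennreal \<bar>H (x, r)\<bar>"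
        by (simp add: ennreal_mult[symmetric] ennreal_plus[symmetric] del: ennreal_plus)
    qed
    also have "\<dots> = ennreal \<bar>a\<bar> * (\<integral>\<^sup>+x. ennreal \<bar>G (x, r)\<bar> \<partial>lborel) + ennreal \<bar>b\<bar> * (\<integral>\<^sup>+x. ennreal \<bar>H (x, r)\<bar> \<partial>lborel)"
      by (simp add: nn_integral_add nn_integral_cmult)
    also have "\<dots> \<le> ennreal \<bar>a\<bar> * ennreal (A * r powr real DIM('a)) + ennreal \<bar>b\<bar> * ennreal (B * r powr real DIM('a))"
      by (intro add_mono mult_left_mono A B r) auto
    also have "\<dots> = ennreal ((\<bar>a\<bar> * A + \<bar>b\<bar> * B) * r powr real DIM('a))"
      using A(1) B(1) by (simp add: ennreal_mult[symmetric] ennreal_plus[symmetric] algebra_simps del: ennreal_plus)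
    finally show ?thesis .
  qed
  moreover have "0 \<le> \<bar>a\<bar> * A + \<bar>b\<bar> * B" using A B by simp
  moreover have "(\<lambda>z. a * G z + b * H z) \<in> borel_measurable (borel \<Otimes>\<^sub>M borel)" by measurable
  ultimately show ?thesis unfolding tame_def by blast
qed

text \<open>The relation \<open>dist x y \<le> r\<close> is a measurable subset of the product, and
  the mass of a ball is the mass of its section.\<close>

lemma measurable_ball_measure:
  fixes \<mu> :: "'a::euclidean_space measure"
  assumes [simp, measurable_cong]: "sets \<mu> = sets borel" and "finite_measure \<mu>"
  shows "(\<lambda>(x, r). measure \<mu> (cball x r)) \<in> borel_measurable (borel \<Otimes>\<^sub>M borel)"
proof -
  interpret finite_measure \<mu> by fact
  have s: "{p \<in> space ((borel \<Otimes>\<^sub>M borel) \<Otimes>\<^sub>M \<mu>). dist (fst (fst p)) (snd p) \<le> snd (fst p)} \<in>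
      sets ((borel \<Otimes>\<^sub>M borel) \<Otimes>\<^sub>M \<mu> :: (('a \<times> real) \<times> 'a) measure)"
    by measurable
  have "space \<mu> = UNIV" using sets_eq_imp_space_eq[OF assms(1)] by simp
  then have "Pair z -` {p \<in> space ((borel \<Otimes>\<^sub>M borel) \<Otimes>\<^sub>M \<mu>). dist (fst (fst p)) (snd p) \<le> snd (fst p)} = cball (fst z) (snd z)" for z
    by (auto simp: space_pair_measure cball_def)
  with measurable_emeasure_Pair[OF s]
  have "(\<lambda>z. emeasure \<mu> (cball (fst z) (snd z))) \<in> borel_measurable (borel \<Otimes>\<^sub>M borel)" by simp
  then have "(\<lambda>z. enn2real (emeasure \<mu> (cball (fst z) (snd z)))) \<in> borel_measurable (borel \<Otimes>\<^sub>M borel)" by measurable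
  then show ?thesis by (simp add: measure_def split_beta')
qed

lemma tame_ball_measure:
  fixes \<mu> :: "'a::euclidean_space measure"
  assumes "\<mu> \<in> M_beta_plus \<beta>"
  shows "tame \<beta> (\<lambda>(x, r). measure \<mu> (cball x r))"
proof -
  have sets[simp, measurable_cong]: "sets \<mu> = sets borel" and fin: "finite_measure \<mu>"
    using assms by (auto simp: M_beta_plus_def)
  interpret finite_measure \<mu> by fact
  have sp: "space \<mu> = UNIV" using sets_eq_imp_space_eq[OF sets] by simp
  obtain p q C where C: "0 < p" "p < \<beta>" "\<beta> < q" "q \<le> 2 * real DIM('a)" "0 < C"
    "\<And>r. 0 \<le> r \<Longrightarrow> (\<integral>\<^sup>+x. ennreal ((measure \<mu> (cball x r))\<^sup>2) \<partial>lborel) \<le> ennreal (C * min (r powr p) (r powr q))"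
    using assms unfolding M_beta_plus_def by blast
  \<comment> \<open>By Fubini the integral of the ball masses over all centres is the total mass of
    \<open>\<mu>\<close> times the volume of a ball of radius \<open>r\<close>; this gives the
    first-moment clause of \<open>tame\<close>.\<close>
  define A where "A = measure \<mu> UNIV * unit_ball_vol (real DIM('a))"
  have A0: "0 \<le> A" by (simp add: A_def)
  have A: "(\<integral>\<^sup>+x. ennreal \<bar>measure \<mu> (cball x r)\<bar> \<partial>lborel) \<le> ennreal (A * r powr real DIM('a))" if r: "0 \<le> r" for r
  proof -
    interpret L: pair_sigma_finite "lborel :: 'a measure" \<mu> by standard
    have "(\<integral>\<^sup>+x. ennreal \<bar>measure \<mu> (cball x r)\<bar> \<partial>lborel) = (\<integral>\<^sup>+x. \<integral>\<^sup>+y. of_bool (dist x y \<le> r) \<partial>\<mu> \<partial>lborel)"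
    proof (rule nn_integral_cong)
      fix x :: 'a
      have "(\<integral>\<^sup>+y. of_bool (dist x y \<le> r) \<partial>\<mu>) = (\<integral>\<^sup>+y. indicator (cball x r) y \<partial>\<mu>)"
        by (intro nn_integral_cong) (simp add: indicator_def)
      then show "ennreal \<bar>measure \<mu> (cball x r)\<bar> = (\<integral>\<^sup>+y. of_bool (dist x y \<le> r) \<partial>\<mu>)"
        by (simp add: emeasure_eq_measure)
    qed
    also have "\<dots> = (\<integral>\<^sup>+y. \<integral>\<^sup>+x. of_bool (dist x y \<le> r) \<partial>lborel \<partial>\<mu>)"
      by (rule L.Fubini'[symmetric]) measurable
    also have "\<dots> = (\<integral>\<^sup>+y. ennreal (unit_ball_vol (real DIM('a)) * r ^ DIM('a)) \<partial>\<mu>)"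
    proof (rule nn_integral_cong)
      fix y :: 'a
      have "(\<integral>\<^sup>+x. of_bool (dist x y \<le> r) \<partial>lborel) = (\<integral>\<^sup>+x. indicator (cball y r) x \<partial>lborel)"
        by (intro nn_integral_cong) (simp add: indicator_def dist_commute)
      then show "(\<integral>\<^sup>+x. of_bool (dist x y \<le> r) \<partial>lborel) = ennreal (unit_ball_vol (real DIM('a)) * r ^ DIM('a))"
        using emeasure_cball[OF r, of y] by simp
    qed
    also have "\<dots> = ennreal (A * r ^ DIM('a))"
      using r by (simp add: A_def sp emeasure_eq_measure ennreal_mult[symmetric] mult_ac)
    also have "r ^ DIM('a) = r powr real DIM('a)"
      using r by (cases "r = 0") (simp_all add: powr_realpow)
    finally show ?thesis by simp
  qed
  show ?thesis unfolding tame_def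
  proof (intro conjI)
    show "(\<lambda>(x, r). measure \<mu> (cball x r)) \<in> borel_measurable (borel \<Otimes>\<^sub>M borel)"
      by (rule measurable_ball_measure[OF sets fin])
  qed (unfold split_conv, use C less_imp_le[OF C(5)] in blast, use A A0 in blast)
qed

locale radius_law =
  fixes \<beta> C\<^sub>\<beta> C\<^sub>0 d :: real and f :: "real \<Rightarrow> real"
  assumes d_pos: "0 < d" and d_less: "d < \<beta>"
    and f_measurable[measurable]: "f \<in> borel_measurable borel"
    and f_nonneg: "\<And>r. 0 \<le> r \<Longrightarrow> 0 \<le> f r"
    and f_total: "(\<integral>\<^sup>+r\<in>{0..}. ennreal (f r) \<partial>lborel) = 1"
    and tail_pos: "0 < C\<^sub>\<beta>" and f_tail: "f \<sim>[at_top] (\<lambda>r. C\<^sub>\<beta> * r powr (- \<beta> - 1))"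
    and f_bound: "\<And>r. 0 \<le> r \<Longrightarrow> r powr (\<beta> + 1) * f r \<le> C\<^sub>0"
begin

abbreviation scaled_law :: "real \<Rightarrow> real measure" where
  "scaled_law \<rho> \<equiv> density lborel (scaled_radius_density f \<rho>)"

lemma scaled_radius_density_measurable[measurable]: "scaled_radius_density f \<rho> \<in> borel_measurable borel"
  unfolding scaled_radius_density_def[abs_def] by measurable

lemma C\<^sub>0_nonneg: "0 \<le> C\<^sub>0"
  using f_bound[of 1] f_nonneg[of 1] by simp

lemma f_le: "0 < r \<Longrightarrow> f r \<le> C\<^sub>0 * r powr (- \<beta> - 1)"
proof -
  assume r: "0 < r"
  have "f r = r powr (- \<beta> - 1) * (r powr (\<beta> + 1) * f r)"
    using r by (simp add: mult.assoc[symmetric] powr_add[symmetric])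
  also have "\<dots> \<le> r powr (- \<beta> - 1) * C\<^sub>0"
    using f_bound[of r] r by (intro mult_left_mono) auto
  finally show ?thesis by (simp add: mult.commute)
qed

lemma AE_scaled_law_nonneg: "AE r in scaled_law \<rho>. 0 \<le> r"
  by (subst AE_density) (auto simp: scaled_radius_density_def indicator_def)

text \<open>The 1 is the total mass of \<open>f\<close>; the other term is \<open>C\<^sub>0\<close>
  times the integral of \<open>s powr (d - \<beta> - 1)\<close> over
  \<open>s \<ge> 1\<close>.\<close>

definition moment_bound :: real where "moment_bound = 1 + C\<^sub>0 / (\<beta> - d)"

lemma moment_bound_nonneg: "0 \<le> moment_bound"
  using C\<^sub>0_nonneg d_less by (simp add: moment_bound_def)

text \<open>After the substitution \<open>r = \<rho> * s\<close>, the power \<open>s powr a\<close>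
  is at most 1 below 1, and beyond it the tail bound leaves \<open>s powr (d - \<beta> - 1)\<close>,
  integrable because \<open>d < \<beta>\<close>. One constant serves all orders
  \<open>a \<le> d\<close>.\<close>

lemma scaled_moment_le:
  assumes \<rho>: "0 < \<rho>" and a: "0 \<le> a" "a \<le> d"
  shows "(\<integral>\<^sup>+r. ennreal (r powr a) \<partial>scaled_law \<rho>) \<le> ennreal (\<rho> powr a * moment_bound)"
proof -
  let ?F = "\<lambda>r. scaled_radius_density f \<rho> r * ennreal (r powr a)"
  have "(\<integral>\<^sup>+r. ennreal (r powr a) \<partial>scaled_law \<rho>) = (\<integral>\<^sup>+r. ?F r \<partial>lborel)"
    by (rule nn_integral_density) measurable
  also have "\<dots> = ennreal \<bar>\<rho>\<bar> * (\<integral>\<^sup>+s. ?F (0 + \<rho> * s) \<partial>lborel)"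
    by (rule nn_integral_real_affine) (measurable, use \<rho> in simp)
  also have "\<dots> = (\<integral>\<^sup>+s. ennreal \<bar>\<rho>\<bar> * ?F (0 + \<rho> * s) \<partial>lborel)"
    by (rule nn_integral_cmult[symmetric]) measurable
  also have "\<dots> \<le> (\<integral>\<^sup>+s. ennreal (\<rho> powr a) * (ennreal (f s) * indicator {0..} s + ennreal C\<^sub>0 * (indicator {1..} s * ennreal (s powr (d - \<beta> - 1)))) \<partial>lborel)"
  proof (rule nn_integral_mono)
    fix s :: real
    show "ennreal \<bar>\<rho>\<bar> * ?F (0 + \<rho> * s) \<le> ennreal (\<rho> powr a) * (ennreal (f s) * indicator {0..} s + ennreal C\<^sub>0 * (indicator {1..} s * ennreal (s powr (d - \<beta> - 1))))"
    proof (cases "0 \<le> s")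
      case False
      then have "\<rho> * s < 0" using \<rho> by (simp add: mult_pos_neg)
      then have "?F (0 + \<rho> * s) = 0" by (simp add: scaled_radius_density_def indicator_def)
      then show ?thesis by (simp only: mult_zero_right zero_le)
    next
      case True
      have le: "f s * s powr a \<le> f s + C\<^sub>0 * (indicator {1..} s * s powr (d - \<beta> - 1))"
      proof (cases "s < 1")
        case True
        have "s powr a \<le> 1" using \<open>0 \<le> s\<close> True a by (intro powr_le1) auto
        then show ?thesis using True f_nonneg[OF \<open>0 \<le> s\<close>] by (simp add: mult_left_le)
      next
        case False
        then have s: "1 \<le> s" by simp
        have "f s * s powr a \<le> (C\<^sub>0 * s powr (- \<beta> - 1)) * s powr d"
          using s a f_le[of s] C\<^sub>0_nonneg f_nonneg[of s] by (intro mult_mono powr_mono) auto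
        also have "\<dots> = C\<^sub>0 * s powr (- \<beta> - 1 + d)" by (simp only: mult.assoc powr_add)
        also have "- \<beta> - 1 + d = d - \<beta> - 1" by simp
        finally show ?thesis using s f_nonneg[of s] by simp
      qed
      have "ennreal \<bar>\<rho>\<bar> * ?F (0 + \<rho> * s) = ennreal (\<rho> powr a * (f s * s powr a))"
        using \<rho> True f_nonneg[OF True]
        by (simp add: scaled_radius_density_def ennreal_mult[symmetric] powr_mult)
      also have "\<dots> \<le> ennreal (\<rho> powr a * (f s + C\<^sub>0 * (indicator {1..} s * s powr (d - \<beta> - 1))))"
        using le by (intro ennreal_leI mult_left_mono) auto
      also have "\<dots> = ennreal (\<rho> powr a) * (ennreal (f s) * indicator {0..} s + ennreal C\<^sub>0 * (indicator {1..} s * ennreal (s powr (d - \<beta> - 1))))"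
        using True f_nonneg[OF True] C\<^sub>0_nonneg by (simp add: ennreal_mult ennreal_plus indicator_def)
      finally show ?thesis .
    qed
  qed
  also have "\<dots> = ennreal (\<rho> powr a) * (1 + ennreal C\<^sub>0 * ennreal (- 1 / (d - \<beta> - 1 + 1)))"
    using nn_integral_powr_near_infinity[of "d - \<beta> - 1"] d_less
    by (simp add: nn_integral_cmult nn_integral_add f_total)
  also have "\<dots> = ennreal (\<rho> powr a * moment_bound)"
  proof -
    have "- 1 / (d - \<beta> - 1 + 1) = 1 / (\<beta> - d)" using d_less by (simp add: field_simps)
    then have "1 + ennreal C\<^sub>0 * ennreal (- 1 / (d - \<beta> - 1 + 1)) = ennreal moment_bound"
      using C\<^sub>0_nonneg d_less by (simp add: moment_bound_def ennreal_mult[symmetric] ennreal_plus[symmetric] ennreal_1[symmetric] del: ennreal_plus ennreal_1)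
    then show ?thesis using moment_bound_nonneg by (simp add: ennreal_mult)
  qed
  finally show ?thesis .
qed

lemma scaled_law_prob_space: "0 < \<rho> \<Longrightarrow> prob_space (scaled_law \<rho>)"
proof
  assume \<rho>: "0 < \<rho>"
  have "emeasure (scaled_law \<rho>) (space (scaled_law \<rho>)) = (\<integral>\<^sup>+r. scaled_radius_density f \<rho> r \<partial>lborel)"
    by (subst emeasure_density) simp_all
  also have "\<dots> = ennreal \<bar>\<rho>\<bar> * (\<integral>\<^sup>+s. scaled_radius_density f \<rho> (0 + \<rho> * s) \<partial>lborel)"
    by (rule nn_integral_real_affine) (measurable, use \<rho> in simp)
  also have "\<dots> = (\<integral>\<^sup>+s. ennreal \<bar>\<rho>\<bar> * scaled_radius_density f \<rho> (0 + \<rho> * s) \<partial>lborel)"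
    by (rule nn_integral_cmult[symmetric]) measurable
  also have "\<dots> = (\<integral>\<^sup>+r\<in>{0..}. ennreal (f r) \<partial>lborel)"
  proof (rule nn_integral_cong)
    fix s :: real
    show "ennreal \<bar>\<rho>\<bar> * scaled_radius_density f \<rho> (0 + \<rho> * s) = ennreal (f s) * indicator {0..} s"
      using \<rho> f_nonneg[of s] by (auto simp: scaled_radius_density_def indicator_def ennreal_mult[symmetric] zero_le_mult_iff)
  qed
  finally show "emeasure (scaled_law \<rho>) (space (scaled_law \<rho>)) = 1" by (simp add: f_total)
qed

text \<open>The integral over \<open>x\<close> is done first: it leaves a multiple of
  \<open>r powr d\<close>, and this moment of the radius is finite because
  \<open>d < \<beta>\<close>.\<close>

lemma tame_first_moment:
  fixes G :: "'a::euclidean_space \<times> real \<Rightarrow> real"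
  assumes G: "tame \<beta> G" and d: "d = real DIM('a)" and \<rho>: "0 < \<rho>"
  shows "(\<integral>\<^sup>+x. \<integral>\<^sup>+r. ennreal \<bar>G (x, r) / n\<bar> \<partial>scaled_law \<rho> \<partial>lborel) < \<infinity>"
proof -
  note [measurable] = tame_measurable[OF G]
  interpret S: prob_space "scaled_law \<rho>" by (rule scaled_law_prob_space[OF \<rho>])
  interpret L: pair_sigma_finite "lborel :: 'a measure" "scaled_law \<rho>" by standard
  obtain A where A: "0 \<le> A" "\<And>r. 0 \<le> r \<Longrightarrow> (\<integral>\<^sup>+x. ennreal \<bar>G (x, r)\<bar> \<partial>lborel) \<le> ennreal (A * r powr d)"
    using G unfolding tame_def d by blast
  have "(\<integral>\<^sup>+x. \<integral>\<^sup>+r. ennreal \<bar>G (x, r) / n\<bar> \<partial>scaled_law \<rho> \<partial>lborel) =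
      (\<integral>\<^sup>+r. \<integral>\<^sup>+x. ennreal \<bar>G (x, r) / n\<bar> \<partial>lborel \<partial>scaled_law \<rho>)"
    by (rule L.Fubini'[symmetric]) measurable
  also have "\<dots> \<le> (\<integral>\<^sup>+r. ennreal (1 / \<bar>n\<bar>) * (ennreal A * ennreal (r powr d)) \<partial>scaled_law \<rho>)"
  proof (rule nn_integral_mono_AE)
    show "AE r in scaled_law \<rho>. (\<integral>\<^sup>+x. ennreal \<bar>G (x, r) / n\<bar> \<partial>lborel) \<le> ennreal (1 / \<bar>n\<bar>) * (ennreal A * ennreal (r powr d))"
      using AE_scaled_law_nonneg
    proof eventually_elim
      case (elim r)
      have "(\<integral>\<^sup>+x. ennreal \<bar>G (x, r) / n\<bar> \<partial>lborel) = (\<integral>\<^sup>+x. ennreal (1 / \<bar>n\<bar>) * ennreal \<bar>G (x, r)\<bar> \<partial>lborel)"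
        by (intro nn_integral_cong) (simp add: ennreal_mult[symmetric])
      also have "\<dots> = ennreal (1 / \<bar>n\<bar>) * (\<integral>\<^sup>+x. ennreal \<bar>G (x, r)\<bar> \<partial>lborel)"
        by (rule nn_integral_cmult) measurable
      also have "\<dots> \<le> ennreal (1 / \<bar>n\<bar>) * (ennreal A * ennreal (r powr d))"
        using A(2)[OF elim] A(1) by (intro mult_left_mono) (simp_all add: ennreal_mult)
      finally show ?case .
    qed
  qed
  also have "\<dots> = ennreal (1 / \<bar>n\<bar>) * (ennreal A * (\<integral>\<^sup>+r. ennreal (r powr d) \<partial>scaled_law \<rho>))"
    by (simp add: nn_integral_cmult)
  also have "\<dots> \<le> ennreal (1 / \<bar>n\<bar>) * (ennreal A * ennreal (\<rho> powr d * moment_bound))"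
    using d_pos by (intro mult_left_mono scaled_moment_le \<rho>) auto
  also have "\<dots> < \<infinity>" by (simp add: ennreal_mult_less_top)
  finally show ?thesis .
qed

text \<open>Minkowski moves the square norm in \<open>x\<close> under the integral over the radii,
  where it is at most \<open>sqrt C * r powr (q / 2) / n\<close>. The radius law has this moment
  because \<open>q / 2 \<le> d\<close>: here the bound \<open>q \<le> 2 * d\<close> of the growth
  condition enters. Scaling of the moment gives \<open>\<rho> powr (q / 2)\<close>, hence
  \<open>\<rho> powr q\<close> after squaring.\<close>

lemma tame_hilbert_schmidt:
  fixes G :: "'a::euclidean_space \<times> real \<Rightarrow> real"
  assumes G: "tame \<beta> G" and d: "d = real DIM('a)"
  obtains C q where "0 \<le> C" "\<beta> < q"
    "\<And>\<rho> n. 0 < \<rho> \<Longrightarrow> 0 < n \<Longrightarrow>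
      (\<integral>\<^sup>+x. ennreal ((norm (\<integral>r. (iexp (G (x, r) / n) - 1) \<partial>scaled_law \<rho>))\<^sup>2) \<partial>lborel) \<le> ennreal (C * \<rho> powr q / n\<^sup>2)"
proof -
  note Gm[measurable] = tame_measurable[OF G]
  obtain p q C where C: "0 < p" "p < \<beta>" "\<beta> < q" "q \<le> 2 * d" "0 \<le> C"
    "\<And>r. 0 \<le> r \<Longrightarrow> (\<integral>\<^sup>+x. ennreal ((G (x, r))\<^sup>2) \<partial>lborel) \<le> ennreal (C * min (r powr p) (r powr q))"
    using G unfolding tame_def d by blast
  have "(\<integral>\<^sup>+x. ennreal ((norm (\<integral>r. (iexp (G (x, r) / n) - 1) \<partial>scaled_law \<rho>))\<^sup>2) \<partial>lborel) \<le>
      ennreal (C * moment_bound\<^sup>2 * \<rho> powr q / n\<^sup>2)" if \<rho>: "0 < \<rho>" and n: "0 < n" for \<rho> n :: real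
  proof -
    interpret S: prob_space "scaled_law \<rho>" by (rule scaled_law_prob_space[OF \<rho>])
    let ?g = "\<lambda>z. ennreal \<bar>G z / n\<bar>"
    let ?b = "\<lambda>r. ennreal (sqrt C / n) * ennreal (r powr (q / 2))"
    have "(\<integral>\<^sup>+x. ennreal ((norm (\<integral>r. (iexp (G (x, r) / n) - 1) \<partial>scaled_law \<rho>))\<^sup>2) \<partial>lborel) \<le>
        (\<integral>\<^sup>+x. (\<integral>\<^sup>+r. ?g (x, r) \<partial>scaled_law \<rho>)\<^sup>2 \<partial>lborel)"
    proof (rule nn_integral_mono)
      fix x :: 'a
      have nb: "norm (iexp y - 1) \<le> \<bar>y\<bar>" for y using iexp_approx1[of y 0] by simp
      have "integrable (scaled_law \<rho>) (\<lambda>r. iexp (G (x, r) / n) - 1)"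
      proof (rule S.integrable_const_bound[where B=2])
        show "AE r in scaled_law \<rho>. norm (iexp (G (x, r) / n) - 1) \<le> 2"
        proof (rule AE_I2)
          fix r show "norm (iexp (G (x, r) / n) - 1) \<le> 2"
            using norm_triangle_ineq4[of "iexp (G (x, r) / n)" 1] by simp
        qed
      qed measurable
      then have "ennreal (norm (\<integral>r. (iexp (G (x, r) / n) - 1) \<partial>scaled_law \<rho>)) \<le>
          (\<integral>\<^sup>+r. ennreal (norm (iexp (G (x, r) / n) - 1)) \<partial>scaled_law \<rho>)"
        by (rule integral_norm_bound_ennreal)
      also have "\<dots> \<le> (\<integral>\<^sup>+r. ?g (x, r) \<partial>scaled_law \<rho>)"
        by (intro nn_integral_mono ennreal_leI nb)
      finally show "ennreal ((norm (\<integral>r. (iexp (G (x, r) / n) - 1) \<partial>scaled_law \<rho>))\<^sup>2) \<le> (\<integral>\<^sup>+r. ?g (x, r) \<partial>scaled_law \<rho>)\<^sup>2"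
        by (simp only: ennreal_power[OF norm_ge_zero, symmetric] power_mono zero_le)
    qed
    also have "\<dots> \<le> (\<integral>\<^sup>+r. ?b r \<partial>scaled_law \<rho>)\<^sup>2"
    proof (rule nn_integral_minkowski)
      show "AE r in scaled_law \<rho>. (\<integral>\<^sup>+x. (?g (x, r))\<^sup>2 \<partial>lborel) \<le> (?b r)\<^sup>2"
        using AE_scaled_law_nonneg
      proof eventually_elim
        case (elim r)
        have "(\<integral>\<^sup>+x. (?g (x, r))\<^sup>2 \<partial>lborel) = (\<integral>\<^sup>+x. ennreal (1 / n\<^sup>2) * ennreal ((G (x, r))\<^sup>2) \<partial>lborel)"
          by (intro nn_integral_cong) (simp add: ennreal_power ennreal_mult[symmetric] power_divide)
        also have "\<dots> = ennreal (1 / n\<^sup>2) * (\<integral>\<^sup>+x. ennreal ((G (x, r))\<^sup>2) \<partial>lborel)"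
          by (rule nn_integral_cmult) measurable
        also have "\<dots> \<le> ennreal (1 / n\<^sup>2) * ennreal (C * r powr q)"
        proof (intro mult_left_mono)
          have "C * min (r powr p) (r powr q) \<le> C * r powr q" using C(5) by (intro mult_left_mono) auto
          then show "(\<integral>\<^sup>+x. ennreal ((G (x, r))\<^sup>2) \<partial>lborel) \<le> ennreal (C * r powr q)"
            using C(6)[OF elim] order_trans ennreal_leI by blast
        qed simp
        also have "\<dots> = (?b r)\<^sup>2"
        proof -
          have "(r powr (q / 2))\<^sup>2 = r powr q"
            by (cases "r = 0") (simp_all add: power2_eq_square powr_add[symmetric])
          then show ?thesis using C(5) n
            by (simp add: ennreal_mult[symmetric] ennreal_power power_mult_distrib power_divide)
        qed
        finally show ?case .
      qed
      show "?g \<in> borel_measurable (lborel \<Otimes>\<^sub>M scaled_law \<rho>)" by measurable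
      show "?b \<in> borel_measurable (scaled_law \<rho>)" by measurable
      show "sigma_finite_measure (scaled_law \<rho>)" by unfold_locales
    qed (rule lborel.sigma_finite_measure_axioms)
    also have "(\<integral>\<^sup>+r. ?b r \<partial>scaled_law \<rho>) = ennreal (sqrt C / n) * (\<integral>\<^sup>+r. ennreal (r powr (q / 2)) \<partial>scaled_law \<rho>)"
      by (rule nn_integral_cmult) measurable
    also have "\<dots>\<^sup>2 \<le> (ennreal (sqrt C / n) * ennreal (\<rho> powr (q / 2) * moment_bound))\<^sup>2"
    proof (intro power_mono mult_left_mono scaled_moment_le \<rho>)
      show "0 \<le> q / 2" "q / 2 \<le> d" using C d_pos d_less by auto
    qed simp_all
    also have "\<dots> = ennreal (C * moment_bound\<^sup>2 * \<rho> powr q / n\<^sup>2)"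
    proof -
      have "(\<rho> powr (q / 2))\<^sup>2 = \<rho> powr q"
        using \<rho> by (simp add: power2_eq_square powr_add[symmetric])
      then show ?thesis using C(5) n moment_bound_nonneg
        by (simp add: ennreal_mult[symmetric] ennreal_power power_mult_distrib power_divide mult_ac)
    qed
    finally show ?thesis .
  qed
  then show thesis using C(3,5) by (intro that[of "C * moment_bound\<^sup>2" q]) auto
qed

text \<open>The density of the control measure up to its constant. At radius 0 the value is 0, by
  the convention for \<open>powr\<close>.\<close>

definition tail_weight :: "real \<Rightarrow> real" where
  "tail_weight r = indicator {0..} r * r powr (- \<beta> - 1)"

lemma tail_weight_measurable[measurable]: "tail_weight \<in> borel_measurable borel"
  unfolding tail_weight_def[abs_def] by measurable

lemma tail_weight_nonneg: "0 \<le> tail_weight r" by (simp add: tail_weight_def indicator_def)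

text \<open>Near 0 the exponent \<open>q - \<beta> - 1\<close> exceeds -1 and near infinity
  \<open>p - \<beta> - 1\<close> is below -1, so the two halves of the growth condition make both
  ends integrable.\<close>

lemma tame_control_finite:
  fixes G :: "'a::euclidean_space \<times> real \<Rightarrow> real"
  assumes G: "tame \<beta> G"
  shows "integrable lborel (\<lambda>z. (G z)\<^sup>2 * tail_weight (snd z))"
proof (rule integrableI_nonneg)
  have Gm'[measurable]: "G \<in> borel_measurable borel" using tame_measurable[OF G] by (simp add: borel_prod)
  have snd_measurable[measurable]: "snd \<in> (borel :: ('a \<times> real) measure) \<rightarrow>\<^sub>M borel"
    by (intro borel_measurable_continuous_onI continuous_on_snd continuous_on_id)
  obtain p q C where C: "0 < p" "p < \<beta>" "\<beta> < q" "0 \<le> C"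
    "\<And>r. 0 \<le> r \<Longrightarrow> (\<integral>\<^sup>+x. ennreal ((G (x, r))\<^sup>2) \<partial>lborel) \<le> ennreal (C * min (r powr p) (r powr q))"
    using G unfolding tame_def by blast
  let ?F = "\<lambda>z. ennreal ((G z)\<^sup>2 * tail_weight (snd z))"
  have "(\<integral>\<^sup>+z. ?F z \<partial>lborel) = (\<integral>\<^sup>+z. ?F z \<partial>(lborel \<Otimes>\<^sub>M lborel))" by (simp only: lborel_prod)
  also have "\<dots> = (\<integral>\<^sup>+r. \<integral>\<^sup>+x. ?F (x, r) \<partial>lborel \<partial>lborel)"
    by (rule lborel_pair.nn_integral_snd[symmetric]) (unfold lborel_prod, measurable)
  also have "\<dots> \<le> (\<integral>\<^sup>+r. ennreal C * (indicator {0..1} r * ennreal (r powr (q - \<beta> - 1)) + indicator {1..} r * ennreal (r powr (p - \<beta> - 1))) \<partial>lborel)"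
  proof (rule nn_integral_mono)
    fix r :: real
    show "(\<integral>\<^sup>+x. ?F (x, r) \<partial>lborel) \<le> ennreal C * (indicator {0..1} r * ennreal (r powr (q - \<beta> - 1)) + indicator {1..} r * ennreal (r powr (p - \<beta> - 1)))"
    proof (cases "0 < r")
      case False
      then have "tail_weight r = 0" by (auto simp: tail_weight_def indicator_def)
      then show ?thesis by simp
    next
      case True
      have "(\<integral>\<^sup>+x. ?F (x, r) \<partial>lborel) = (\<integral>\<^sup>+x. ennreal ((G (x, r))\<^sup>2) \<partial>lborel) * ennreal (tail_weight r)"
        by (subst nn_integral_multc[symmetric]) (simp_all add: ennreal_mult tail_weight_nonneg)
      also have "\<dots> \<le> ennreal (C * min (r powr p) (r powr q)) * ennreal (tail_weight r)"
        using C(5)[of r] True by (intro mult_right_mono) auto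
      also have "\<dots> = ennreal (C * (min (r powr p) (r powr q) * r powr (- \<beta> - 1)))"
        using True C by (simp add: tail_weight_def ennreal_mult[symmetric] mult.assoc)
      also have "\<dots> \<le> ennreal (C * (indicator {0..1} r * r powr (q - \<beta> - 1) + indicator {1..} r * r powr (p - \<beta> - 1)))"
      proof (intro ennreal_leI mult_left_mono C(4))
        have e: "r powr q * r powr (- \<beta> - 1) = r powr (q - \<beta> - 1)" "r powr p * r powr (- \<beta> - 1) = r powr (p - \<beta> - 1)"
          by (simp_all add: powr_add[symmetric] algebra_simps)
        show "min (r powr p) (r powr q) * r powr (- \<beta> - 1) \<le> indicator {0..1} r * r powr (q - \<beta> - 1) + indicator {1..} r * r powr (p - \<beta> - 1)"
        proof (cases "r \<le> 1")
          case True
          have "min (r powr p) (r powr q) * r powr (- \<beta> - 1) \<le> r powr q * r powr (- \<beta> - 1)" by (intro mult_right_mono) auto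
          then show ?thesis using e True \<open>0 < r\<close> by (auto simp: indicator_def)
        next
          case False
          have "min (r powr p) (r powr q) * r powr (- \<beta> - 1) \<le> r powr p * r powr (- \<beta> - 1)" by (intro mult_right_mono) auto
          then show ?thesis using e False by (auto simp: indicator_def)
        qed
      qed
      also have "\<dots> = ennreal C * (indicator {0..1} r * ennreal (r powr (q - \<beta> - 1)) + indicator {1..} r * ennreal (r powr (p - \<beta> - 1)))"
        using C(4) by (simp add: ennreal_mult ennreal_plus ennreal_indicator)
      finally show ?thesis .
    qed
  qed
  also have "\<dots> = ennreal C * (ennreal (1 / (q - \<beta>)) + ennreal (- 1 / (p - \<beta>)))"
    using nn_integral_powr_near_0[of "q - \<beta> - 1"] nn_integral_powr_near_infinity[of "p - \<beta> - 1"] C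
    by (simp add: nn_integral_cmult nn_integral_add)
  also have "\<dots> < \<infinity>" by (simp add: ennreal_mult_less_top)
  finally show "(\<integral>\<^sup>+z. ?F z \<partial>lborel) < \<infinity>" .
  show "(\<lambda>z. (G z)\<^sup>2 * tail_weight (snd z)) \<in> borel_measurable lborel" by measurable
qed (simp add: tail_weight_nonneg)

section \<open>The limit of the exponent\<close>

lemma density_scaling_limit:
  assumes r: "0 < r" and \<rho>: "\<And>k. 0 < \<rho> k" "\<rho> \<longlonglongrightarrow> 0"
  shows "(\<lambda>k. \<rho> k powr (- \<beta>) * (f (r / \<rho> k) / \<rho> k)) \<longlonglongrightarrow> C\<^sub>\<beta> * r powr (- \<beta> - 1)"
proof -
  have "((\<lambda>x. f x / (C\<^sub>\<beta> * x powr (- \<beta> - 1))) \<longlongrightarrow> 1) at_top"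
  proof (rule Lim_transform_eventually[OF asymp_equivD[OF f_tail]])
    \<comment> \<open>Asymptotic equivalence counts 0 / 0 as 1; the denominator is positive for
      \<open>x > 0\<close>, so the plain quotient has the same limit.\<close>
    show "\<forall>\<^sub>F x in at_top. (if f x = 0 \<and> C\<^sub>\<beta> * x powr (- \<beta> - 1) = 0 then 1 else f x / (C\<^sub>\<beta> * x powr (- \<beta> - 1))) = f x / (C\<^sub>\<beta> * x powr (- \<beta> - 1))"
      by (rule eventually_mono[OF eventually_gt_at_top[of 0]]) (use tail_pos in auto)
  qed
  moreover have "filterlim (\<lambda>k. r / \<rho> k) at_top sequentially"
  proof -
    have "filterlim \<rho> (at_right 0) sequentially"
      using \<rho> by (intro tendsto_imp_filterlim_at_right) auto
    then have "filterlim (\<lambda>k. inverse (\<rho> k)) at_top sequentially"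
      by (rule filterlim_compose[OF filterlim_inverse_at_top_right])
    then have "filterlim (\<lambda>k. r * inverse (\<rho> k)) at_top sequentially"
      by (rule filterlim_tendsto_pos_mult_at_top[OF tendsto_const r])
    then show ?thesis by (simp add: divide_inverse)
  qed
  ultimately have "(\<lambda>k. f (r / \<rho> k) / (C\<^sub>\<beta> * (r / \<rho> k) powr (- \<beta> - 1))) \<longlonglongrightarrow> 1"
    by (rule filterlim_compose)
  then have "(\<lambda>k. f (r / \<rho> k) / (C\<^sub>\<beta> * (r / \<rho> k) powr (- \<beta> - 1)) * (C\<^sub>\<beta> * r powr (- \<beta> - 1))) \<longlonglongrightarrow> 1 * (C\<^sub>\<beta> * r powr (- \<beta> - 1))"
    by (intro tendsto_mult tendsto_const)
  moreover have "f (r / \<rho> k) / (C\<^sub>\<beta> * (r / \<rho> k) powr (- \<beta> - 1)) * (C\<^sub>\<beta> * r powr (- \<beta> - 1)) = \<rho> k powr (- \<beta>) * (f (r / \<rho> k) / \<rho> k)" for k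
  proof -
    have "(r / \<rho> k) powr (- \<beta> - 1) = r powr (- \<beta> - 1) / \<rho> k powr (- \<beta> - 1)"
      using r \<rho>(1)[of k] by (simp add: powr_divide)
    moreover have "\<rho> k powr (- \<beta> - 1) = \<rho> k powr (- \<beta>) / \<rho> k"
      using \<rho>(1)[of k] by (simp add: powr_diff)
    moreover have "r powr (- \<beta> - 1) \<noteq> 0" using r by simp
    ultimately show ?thesis using tail_pos \<rho>(1)[of k] by (simp add: field_simps)
  qed
  ultimately show ?thesis by simp
qed

text \<open>Taylor expansion with the cubic remainder: for fixed \<open>y\<close>, the factor
  \<open>n\<^sup>2\<close> leaves an error of order \<open>\<bar>y\<bar> ^ 3 / n\<close>.\<close>

lemma second_order_limit:
  fixes y :: real
  assumes n: "filterlim n at_top sequentially"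
  shows "(\<lambda>k. complex_of_real ((n k)\<^sup>2) * (iexp (y / n k) - 1 - \<i> * complex_of_real (y / n k))) \<longlonglongrightarrow> complex_of_real (- (y\<^sup>2) / 2)"
proof (rule LIM_zero_cancel, rule Lim_null_comparison)
  show "\<forall>\<^sub>F k in sequentially. norm (complex_of_real ((n k)\<^sup>2) * (iexp (y / n k) - 1 - \<i> * complex_of_real (y / n k)) - complex_of_real (- (y\<^sup>2) / 2)) \<le> \<bar>y\<bar> ^ 3 / n k"
    using filterlim_at_top_dense[THEN iffD1, OF n, rule_format, of 0]
  proof eventually_elim
    case (elim k)
    let ?R = "iexp (y / n k) - (\<Sum>j\<le>2. (\<i> * complex_of_real (y / n k)) ^ j / fact j)"
    have "complex_of_real ((n k)\<^sup>2) * (iexp (y / n k) - 1 - \<i> * complex_of_real (y / n k)) - complex_of_real (- (y\<^sup>2) / 2) = complex_of_real ((n k)\<^sup>2) * ?R"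
      using elim by (simp add: numeral_2_eq_2 power_mult_distrib power2_eq_square field_simps)
    also have "norm \<dots> \<le> (n k)\<^sup>2 * (\<bar>y / n k\<bar> ^ Suc 2 / fact (Suc 2))"
      using iexp_approx1[of "y / n k" 2] by (simp only: norm_mult norm_of_real abs_power2 mult_left_mono zero_le_power2)
    also have "\<dots> \<le> \<bar>y\<bar> ^ 3 / n k"
    proof -
      have "(n k)\<^sup>2 * (\<bar>y / n k\<bar> ^ Suc 2 / fact (Suc 2)) = (\<bar>y\<bar> ^ 3 / n k) / 6"
        using elim by (simp add: power_divide fact_numeral power2_eq_square power3_eq_cube)
      also have "\<dots> \<le> \<bar>y\<bar> ^ 3 / n k"
      proof -
        have "0 \<le> \<bar>y\<bar> ^ 3 / n k" using elim by simp
        then show ?thesis by simp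
      qed
      finally show ?thesis .
    qed
    finally show ?case .
  qed
  have "(\<lambda>k. inverse (n k)) \<longlonglongrightarrow> 0" by (rule tendsto_inverse_0_at_top[OF n])
  then have "(\<lambda>k. \<bar>y\<bar> ^ 3 * inverse (n k)) \<longlonglongrightarrow> \<bar>y\<bar> ^ 3 * 0" by (intro tendsto_mult tendsto_const)
  then show "(\<lambda>k. \<bar>y\<bar> ^ 3 / n k) \<longlonglongrightarrow> 0" by (simp add: divide_inverse)
qed

proposition exponent_limit:
  fixes G :: "'a::euclidean_space \<times> real \<Rightarrow> real"
  assumes G: "tame \<beta> G" and \<rho>: "\<And>k. 0 < \<rho> k" "\<rho> \<longlonglongrightarrow> 0" and n: "\<And>k. 0 < n k" "filterlim n at_top sequentially"
  shows "(\<lambda>k. \<integral>z. (\<rho> k powr (- \<beta>) * (indicator {0..} (snd z) * (f (snd z / \<rho> k) / \<rho> k))) *\<^sub>R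
      (complex_of_real ((n k)\<^sup>2) * (iexp (G z / n k) - 1 - \<i> * complex_of_real (G z / n k))) \<partial>lborel)
    \<longlonglongrightarrow> (\<integral>z. complex_of_real (- (C\<^sub>\<beta> / 2) * ((G z)\<^sup>2 * tail_weight (snd z))) \<partial>lborel)"
proof (rule integral_dominated_convergence[where w="\<lambda>z. C\<^sub>0 * ((G z)\<^sup>2 * tail_weight (snd z))"])
  have Gm'[measurable]: "G \<in> borel_measurable borel" using tame_measurable[OF G] by (simp add: borel_prod)
  have snd_measurable[measurable]: "snd \<in> (borel :: ('a \<times> real) measure) \<rightarrow>\<^sub>M borel"
    by (intro borel_measurable_continuous_onI continuous_on_snd continuous_on_id)
  show "integrable lborel (\<lambda>z. C\<^sub>0 * ((G z)\<^sup>2 * tail_weight (snd z)))"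
    by (intro integrable_mult_right tame_control_finite G)
  show "(\<lambda>z. complex_of_real (- (C\<^sub>\<beta> / 2) * ((G z)\<^sup>2 * tail_weight (snd z)))) \<in> borel_measurable lborel" by measurable
  show "(\<lambda>z. (\<rho> k powr (- \<beta>) * (indicator {0..} (snd z) * (f (snd z / \<rho> k) / \<rho> k))) *\<^sub>R
      (complex_of_real ((n k)\<^sup>2) * (iexp (G z / n k) - 1 - \<i> * complex_of_real (G z / n k)))) \<in> borel_measurable lborel" for k
    by measurable
  \<comment> \<open>Radius 0 is excluded: \<open>tail_weight\<close> is 0 there while
    \<open>f 0\<close> may be positive, so both the limit and the domination could fail.\<close>
  have ae: "AE z in (lborel :: ('a \<times> real) measure). snd z \<noteq> 0"
  proof -
    have "AE x in (lborel :: 'a measure). AE r in (lborel :: real measure). snd (x, r) \<noteq> 0"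
      using AE_lborel_singleton[of "0::real"] by simp
    then have "AE z in ((lborel :: 'a measure) \<Otimes>\<^sub>M (lborel :: real measure)). snd z \<noteq> 0"
      by (intro lborel_pair.AE_pair_measure) measurable
    then show ?thesis by (simp only: lborel_prod)
  qed
  show "AE z in lborel. (\<lambda>k. (\<rho> k powr (- \<beta>) * (indicator {0..} (snd z) * (f (snd z / \<rho> k) / \<rho> k))) *\<^sub>R
      (complex_of_real ((n k)\<^sup>2) * (iexp (G z / n k) - 1 - \<i> * complex_of_real (G z / n k))))
    \<longlonglongrightarrow> complex_of_real (- (C\<^sub>\<beta> / 2) * ((G z)\<^sup>2 * tail_weight (snd z)))"
    using ae
  proof eventually_elim
    case (elim z)
    show ?case
    proof (cases "snd z < 0")
      case True
      then show ?thesis by (simp add: tail_weight_def)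
    next
      case False
      with elim have r: "0 < snd z" by simp
      have "(\<lambda>k. (\<rho> k powr (- \<beta>) * (f (snd z / \<rho> k) / \<rho> k)) *\<^sub>R
          (complex_of_real ((n k)\<^sup>2) * (iexp (G z / n k) - 1 - \<i> * complex_of_real (G z / n k))))
        \<longlonglongrightarrow> (C\<^sub>\<beta> * snd z powr (- \<beta> - 1)) *\<^sub>R complex_of_real (- ((G z)\<^sup>2) / 2)"
        by (intro tendsto_scaleR density_scaling_limit[OF r \<rho>] second_order_limit n)
      moreover have "(C\<^sub>\<beta> * snd z powr (- \<beta> - 1)) *\<^sub>R complex_of_real (- ((G z)\<^sup>2) / 2) =
          complex_of_real (- (C\<^sub>\<beta> / 2) * ((G z)\<^sup>2 * tail_weight (snd z)))"
        using r by (simp add: tail_weight_def scaleR_conv_of_real)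
      moreover have "indicator {0..} (snd z) = (1 :: real)" using r by simp
      ultimately show ?thesis by (simp only: mult_1)
    qed
  qed
  show "AE z in lborel. norm ((\<rho> k powr (- \<beta>) * (indicator {0..} (snd z) * (f (snd z / \<rho> k) / \<rho> k))) *\<^sub>R
      (complex_of_real ((n k)\<^sup>2) * (iexp (G z / n k) - 1 - \<i> * complex_of_real (G z / n k))))
    \<le> C\<^sub>0 * ((G z)\<^sup>2 * tail_weight (snd z))" for k
    using ae
  proof eventually_elim
    case (elim z)
    show ?case
    proof (cases "snd z < 0")
      case True
      then show ?thesis by (simp add: tail_weight_def)
    next
      case False
      with elim have r: "0 < snd z" by simp
      have h: "0 \<le> \<rho> k powr (- \<beta>) * (f (snd z / \<rho> k) / \<rho> k)" "\<rho> k powr (- \<beta>) * (f (snd z / \<rho> k) / \<rho> k) \<le> C\<^sub>0 * snd z powr (- \<beta> - 1)"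
      proof -
        have \<rho>k: "0 < \<rho> k" by (rule \<rho>)
        show "0 \<le> \<rho> k powr (- \<beta>) * (f (snd z / \<rho> k) / \<rho> k)" using \<rho>k r f_nonneg[of "snd z / \<rho> k"] by simp
        have "f (snd z / \<rho> k) \<le> C\<^sub>0 * (snd z / \<rho> k) powr (- \<beta> - 1)" by (rule f_le) (use \<rho>k r in simp)
        also have "(snd z / \<rho> k) powr (- \<beta> - 1) = snd z powr (- \<beta> - 1) * (\<rho> k powr \<beta> * \<rho> k)"
        proof -
          have "\<rho> k powr (- \<beta> - 1) * (\<rho> k powr \<beta> * \<rho> k) = 1"
            using \<rho>k by (simp add: powr_diff powr_minus field_simps)
          then show ?thesis using r \<rho>k by (simp add: powr_divide field_simps)
        qed
        finally have "f (snd z / \<rho> k) \<le> C\<^sub>0 * (snd z powr (- \<beta> - 1) * (\<rho> k powr \<beta> * \<rho> k))" .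
        then have "\<rho> k powr (- \<beta>) * (f (snd z / \<rho> k) / \<rho> k) \<le> \<rho> k powr (- \<beta>) * (C\<^sub>0 * (snd z powr (- \<beta> - 1) * (\<rho> k powr \<beta> * \<rho> k)) / \<rho> k)"
          using \<rho>k by (intro mult_left_mono divide_right_mono) auto
        also have "\<dots> = C\<^sub>0 * snd z powr (- \<beta> - 1)" using \<rho>k by (simp add: powr_minus field_simps)
        finally show "\<rho> k powr (- \<beta>) * (f (snd z / \<rho> k) / \<rho> k) \<le> C\<^sub>0 * snd z powr (- \<beta> - 1)" .
      qed
      have nk: "0 < n k" by (rule n)
      \<comment> \<open>The quadratic Taylor bound: the factor \<open>n\<^sup>2\<close> cancels, so
        the dominating function does not depend on \<open>k\<close>.\<close>
      have "norm (iexp (G z / n k) - 1 - \<i> * complex_of_real (G z / n k)) \<le> \<bar>G z / n k\<bar>\<^sup>2 / 2"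
        using iexp_approx1[of "G z / n k" 1] by (simp add: numeral_2_eq_2 diff_diff_eq)
      then have "(n k)\<^sup>2 * norm (iexp (G z / n k) - 1 - \<i> * complex_of_real (G z / n k)) \<le> (n k)\<^sup>2 * (\<bar>G z / n k\<bar>\<^sup>2 / 2)"
        by (intro mult_left_mono) auto
      also have "\<dots> = (G z)\<^sup>2 / 2" using nk by (simp add: power_divide)
      also have "\<dots> \<le> (G z)\<^sup>2" by simp
      finally have b: "norm (complex_of_real ((n k)\<^sup>2) * (iexp (G z / n k) - 1 - \<i> * complex_of_real (G z / n k))) \<le> (G z)\<^sup>2"
        by (simp only: norm_mult norm_of_real abs_power2)
      have "(\<rho> k powr (- \<beta>) * (f (snd z / \<rho> k) / \<rho> k)) * norm (complex_of_real ((n k)\<^sup>2) * (iexp (G z / n k) - 1 - \<i> * complex_of_real (G z / n k)))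
        \<le> (C\<^sub>0 * snd z powr (- \<beta> - 1)) * (G z)\<^sup>2"
        using C\<^sub>0_nonneg by (intro mult_mono h b) auto
      moreover have "indicator {0..} (snd z) = (1 :: real)" using r by simp
      moreover have "(C\<^sub>0 * snd z powr (- \<beta> - 1)) * (G z)\<^sup>2 = C\<^sub>0 * ((G z)\<^sup>2 * tail_weight (snd z))"
        using r by (simp add: tail_weight_def)
      ultimately show ?thesis by (simp only: norm_scaleR abs_of_nonneg[OF h(1)] mult_1)
    qed
  qed
qed

end

section \<open>Multivariate characteristic functions\<close>

no_notation Matrix.vec_index (infixl \<open>$\<close> 100)

text \<open>The linear span of the characters, to which convergence of characteristic functions
  extends by linearity. It turns out to be closed under products, which makes room for polynomials
  in sines.\<close>

inductive trig_polynomial :: "('a::real_inner \<Rightarrow> complex) \<Rightarrow> bool" where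
  exp: "trig_polynomial (\<lambda>x. iexp (t \<bullet> x))"
| scale: "trig_polynomial F \<Longrightarrow> trig_polynomial (\<lambda>x. c * F x)"
| add: "trig_polynomial F \<Longrightarrow> trig_polynomial G \<Longrightarrow> trig_polynomial (\<lambda>x. F x + G x)"

lemma trig_polynomial_const: "trig_polynomial (\<lambda>x. c)"
  using trig_polynomial.scale[OF trig_polynomial.exp[of 0], of c] by simp

lemma trig_polynomial_mult_exp: "trig_polynomial F \<Longrightarrow> trig_polynomial (\<lambda>x. iexp (t \<bullet> x) * F x)"
proof (induction rule: trig_polynomial.induct)
  case (exp s)
  have "iexp (t \<bullet> x) * iexp (s \<bullet> x) = iexp ((t + s) \<bullet> x)" for x
    by (simp add: inner_add_left exp_add[symmetric] algebra_simps)
  then show ?case using trig_polynomial.exp[of "t + s"] by simp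
next
  case (scale F c)
  then show ?case using trig_polynomial.scale[OF scale.IH, of c] by (simp add: mult.left_commute)
next
  case (add F G)
  then show ?case using trig_polynomial.add[OF add.IH] by (simp add: distrib_left)
qed

lemma trig_polynomial_mult: "trig_polynomial F \<Longrightarrow> trig_polynomial G \<Longrightarrow> trig_polynomial (\<lambda>x. F x * G x)"
proof (induction rule: trig_polynomial.induct)
  case (exp t)
  then show ?case by (rule trig_polynomial_mult_exp)
next
  case (scale F c)
  then show ?case using trig_polynomial.scale[OF scale.IH, of c] by (simp add: mult.assoc)
next
  case (add F1 F2)
  then show ?case using trig_polynomial.add[OF add.IH] by (simp add: distrib_right)
qed

lemma trig_polynomial_sum:
  "finite I \<Longrightarrow> (\<And>i. i \<in> I \<Longrightarrow> trig_polynomial (F i)) \<Longrightarrow> trig_polynomial (\<lambda>x. \<Sum>i\<in>I. F i x)"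
  by (induction I rule: finite_induct) (auto intro: trig_polynomial_const trig_polynomial.add)

lemma trig_polynomial_sin:
  fixes L :: real and j :: "'n::finite"
  shows "trig_polynomial (\<lambda>x :: real ^ 'n. complex_of_real (sin (x $ j / L)))"
proof -
  have e: "(axis j (c :: real)) \<bullet> x = c * x $ j" for c and x :: "real ^ 'n"
    by (simp add: inner_axis' )
  have "complex_of_real (sin (x $ j / L)) =
      (1 / (2 * \<i>)) * iexp (axis j (1 / L) \<bullet> x) + (- 1 / (2 * \<i>)) * iexp (axis j (- 1 / L) \<bullet> x)" for x :: "real ^ 'n"
    unfolding e sin_of_real[symmetric] sin_exp_eq by (simp add: field_simps)
  moreover have "trig_polynomial (\<lambda>x :: real ^ 'n. (1 / (2 * \<i>)) * iexp (axis j (1 / L) \<bullet> x) + (- 1 / (2 * \<i>)) * iexp (axis j (- 1 / L) \<bullet> x))"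
    by (intro trig_polynomial.intros)
  ultimately show ?thesis by simp
qed

text \<open>Polynomials, as supplied by Stone-Weierstrass, are unbounded; evaluated at sines of the
  coordinates they become bounded functions whose expectations are known to converge.\<close>

lemma trig_polynomial_of_polynomial:
  fixes g :: "real ^ 'n \<Rightarrow> real" and L :: real
  assumes "real_polynomial_function g"
  shows "trig_polynomial (\<lambda>x. complex_of_real (g (\<chi> j. sin (x $ j / L))))"
  using assms
proof (induction rule: real_polynomial_function.induct)
  case (linear h)
  interpret bounded_linear h by fact
  have h_eq: "h v = (\<Sum>j\<in>UNIV. v $ j * h (axis j 1))" for v
  proof -
    have "h v = h (\<Sum>j\<in>UNIV. v $ j *\<^sub>R axis j 1)" by (simp add: basis_expansion scalar_mult_eq_scaleR[symmetric])
    also have "\<dots> = (\<Sum>j\<in>UNIV. v $ j * h (axis j 1))" by (simp add: sum scaleR)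
    finally show ?thesis .
  qed
  have "complex_of_real (h (\<chi> j. sin (x $ j / L))) = (\<Sum>j\<in>UNIV. complex_of_real (h (axis j 1)) * complex_of_real (sin (x $ j / L)))" for x
    by (subst h_eq) (simp add: mult.commute)
  moreover have "trig_polynomial (\<lambda>x. \<Sum>j\<in>UNIV. complex_of_real (h (axis j 1)) * complex_of_real (sin (x $ j / L)))"
    by (intro trig_polynomial_sum trig_polynomial.scale trig_polynomial_sin) simp
  ultimately show ?case by simp
next
  case (const c)
  then show ?case by (rule trig_polynomial_const)
next
  case (add g h)
  then show ?case using trig_polynomial.add[OF add.IH] by simp
next
  case (mult g h)
  then show ?case using trig_polynomial_mult[OF mult.IH] by simp
qed

lemma trig_polynomial_continuous: "trig_polynomial F \<Longrightarrow> continuous_on UNIV F"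
  by (induction rule: trig_polynomial.induct) (auto intro!: continuous_intros)

lemma trig_polynomial_measurable:
  "trig_polynomial F \<Longrightarrow> F \<in> borel_measurable borel"
  by (intro borel_measurable_continuous_onI trig_polynomial_continuous)

lemma trig_polynomial_bounded: "trig_polynomial F \<Longrightarrow> \<exists>B. \<forall>x. norm (F x) \<le> B"
proof (induction rule: trig_polynomial.induct)
  case (exp t)
  then show ?case by (intro exI[of _ 1]) simp
next
  case (scale F c)
  then obtain B where "\<And>x. norm (F x) \<le> B" by blast
  then show ?case by (intro exI[of _ "norm c * B"]) (simp add: norm_mult mult_left_mono)
next
  case (add F G)
  then obtain A B where "\<And>x. norm (F x) \<le> A" "\<And>x. norm (G x) \<le> B" by blast
  then show ?case by (intro exI[of _ "A + B"]) (meson add_mono norm_triangle_ineq order_trans)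
qed

text \<open>The setting of the multivariate continuity theorem of Levy, with the limit law given and
  with probability spaces that may change with \<open>k\<close>. Tightness is not assumed: it comes
  coordinate by coordinate from the one-dimensional theorem.\<close>

locale characteristic_convergence = Q: prob_space Q for Q :: "'v measure" +
  fixes P :: "nat \<Rightarrow> 'w measure" and X :: "nat \<Rightarrow> 'w \<Rightarrow> real ^ 'n" and Y :: "'v \<Rightarrow> real ^ 'n"
  assumes P_prob: "\<And>k. prob_space (P k)"
    and X_measurable[measurable]: "\<And>k. X k \<in> borel_measurable (P k)"
    and Y_measurable[measurable]: "Y \<in> borel_measurable Q"
    and char_tendsto: "\<And>t. (\<lambda>k. \<integral>\<omega>. iexp (t \<bullet> X k \<omega>) \<partial>P k) \<longlonglongrightarrow> (\<integral>\<omega>. iexp (t \<bullet> Y \<omega>) \<partial>Q)"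
begin

lemma integral_trig_polynomial_tendsto:
  assumes "trig_polynomial F"
  shows "(\<lambda>k. \<integral>\<omega>. F (X k \<omega>) \<partial>P k) \<longlonglongrightarrow> (\<integral>\<omega>. F (Y \<omega>) \<partial>Q)"
  using assms
proof (induction rule: trig_polynomial.induct)
  case (exp t)
  show ?case by (rule char_tendsto)
next
  case (scale F c)
  then show ?case by (simp add: tendsto_mult_left)
next
  case (add F G)
  have iX: "integrable (P k) (\<lambda>\<omega>. H (X k \<omega>))" if H: "trig_polynomial H" for H k
  proof -
    interpret prob_space "P k" by (rule P_prob)
    obtain B where B: "\<And>x. norm (H x) \<le> B" using trig_polynomial_bounded[OF H] by blast
    show ?thesis
      by (rule integrable_const_bound[of _ B]) (use B measurable_compose[OF X_measurable trig_polynomial_measurable[OF H]] in auto)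
  qed
  have iY: "integrable Q (\<lambda>\<omega>. H (Y \<omega>))" if H: "trig_polynomial H" for H
  proof -
    obtain B where B: "\<And>x. norm (H x) \<le> B" using trig_polynomial_bounded[OF H] by blast
    show ?thesis
      by (rule Q.integrable_const_bound[of _ B]) (use B measurable_compose[OF Y_measurable trig_polynomial_measurable[OF H]] in auto)
  qed
  show ?case
    using tendsto_add[OF add.IH] by (simp add: iX iY add.hyps)
qed

text \<open>A continuous stand-in for the indicator of \<open>\<bar>x\<bar> > a\<close>, so that
  weak convergence of the coordinates passes to its integrals.\<close>

definition tail_test :: "real \<Rightarrow> real \<Rightarrow> real" where
  "tail_test a x = min 1 (max 0 (\<bar>x\<bar> - a))"

lemma tail_test_bounds: "0 \<le> tail_test a x" "tail_test a x \<le> 1" "\<bar>x\<bar> \<ge> a + 1 \<Longrightarrow> tail_test a x = 1"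
  by (auto simp: tail_test_def)

lemma tail_test_continuous: "continuous_on UNIV (tail_test a)"
  unfolding tail_test_def[abs_def] by (intro continuous_intros)

lemma tail_test_measurable[measurable]: "tail_test a \<in> borel_measurable borel"
  by (intro borel_measurable_continuous_onI tail_test_continuous)

lemma component_measurable[measurable]:
  "(\<lambda>\<omega>. X k \<omega> $ j) \<in> borel_measurable (P k)" "(\<lambda>\<omega>. Y \<omega> $ j) \<in> borel_measurable Q"
proof -
  have "(\<lambda>x. x $ j) \<in> borel_measurable (borel :: (real ^ 'n) measure)"
    by (intro borel_measurable_continuous_onI continuous_intros)
  then show "(\<lambda>\<omega>. X k \<omega> $ j) \<in> borel_measurable (P k)" "(\<lambda>\<omega>. Y \<omega> $ j) \<in> borel_measurable Q"
    using measurable_compose[OF X_measurable] measurable_compose[OF Y_measurable] by blast+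
qed

text \<open>The characteristic function of a coordinate is the joint one along
  \<open>axis j s\<close>, so the one-dimensional Levy theorem applies to each coordinate.\<close>

lemma tail_test_tendsto:
  "(\<lambda>k. \<integral>\<omega>. tail_test a (X k \<omega> $ j) \<partial>P k) \<longlonglongrightarrow> (\<integral>\<omega>. tail_test a (Y \<omega> $ j) \<partial>Q)"
proof -
  let ?M = "\<lambda>k. distr (P k) borel (\<lambda>\<omega>. X k \<omega> $ j)" and ?M' = "distr Q borel (\<lambda>\<omega>. Y \<omega> $ j)"
  have rM: "real_distribution (?M k)" for k
  proof -
    interpret prob_space "P k" by (rule P_prob)
    show ?thesis by (rule real_distribution_distr) measurable
  qed
  have rM': "real_distribution ?M'" by (rule Q.real_distribution_distr) measurable
  have e: "axis j s \<bullet> x = s * x $ j" for s and x :: "real ^ 'n" by (simp add: inner_axis')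
  have "weak_conv_m ?M ?M'"
  proof (rule levy_continuity[OF rM rM'])
    fix s
    have "char (?M k) s = (\<integral>\<omega>. iexp (axis j s \<bullet> X k \<omega>) \<partial>P k)" for k
      unfolding char_def e by (subst integral_distr) simp_all
    moreover have "char ?M' s = (\<integral>\<omega>. iexp (axis j s \<bullet> Y \<omega>) \<partial>Q)"
      unfolding char_def e by (subst integral_distr) simp_all
    ultimately show "(\<lambda>k. char (?M k) s) \<longlonglongrightarrow> char ?M' s" using char_tendsto[of "axis j s"] by simp
  qed
  then have "(\<lambda>k. integral\<^sup>L (?M k) (tail_test a)) \<longlonglongrightarrow> integral\<^sup>L ?M' (tail_test a)"
  proof (rule weak_conv_imp_integral_bdd_continuous_conv[OF rM rM'])
    show "isCont (tail_test a) x" for x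
      using tail_test_continuous by (simp add: continuous_on_eq_continuous_at)
    show "norm (tail_test a x) \<le> 1" for x using tail_test_bounds[of a x] by simp
  qed
  then show ?thesis by (simp add: integral_distr)
qed

lemma tail_test_small:
  assumes "0 < \<delta>"
  obtains a where "0 \<le> a" "\<And>j. (\<integral>\<omega>. tail_test a (Y \<omega> $ j) \<partial>Q) < \<delta>"
proof -
  have "(\<lambda>m::nat. \<integral>\<omega>. tail_test (real m) (Y \<omega> $ j) \<partial>Q) \<longlonglongrightarrow> (\<integral>\<omega>. 0 \<partial>Q)" for j
  proof (rule integral_dominated_convergence[where w="\<lambda>_. 1"])
    show "AE \<omega> in Q. (\<lambda>m. tail_test (real m) (Y \<omega> $ j)) \<longlonglongrightarrow> 0"
    proof (rule AE_I2)
      fix \<omega>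
      obtain m0 :: nat where m0: "\<bar>Y \<omega> $ j\<bar> \<le> real m0" using real_arch_simple by blast
      have "\<forall>\<^sub>F m in sequentially. tail_test (real m) (Y \<omega> $ j) = 0"
        using eventually_ge_at_top[of m0] by eventually_elim (use m0 in \<open>simp add: tail_test_def\<close>)
      then show "(\<lambda>m. tail_test (real m) (Y \<omega> $ j)) \<longlonglongrightarrow> 0" by (rule tendsto_eventually)
    qed
    show "AE \<omega> in Q. norm (tail_test (real m) (Y \<omega> $ j)) \<le> 1" for m
      using tail_test_bounds by simp
  qed simp_all
  then have "\<forall>\<^sub>F m in sequentially. (\<integral>\<omega>. tail_test (real m) (Y \<omega> $ j) \<partial>Q) < \<delta>" for j
    using assms by (intro order_tendstoD(2)[where y=0]) simp_all
  then have "\<forall>\<^sub>F m in sequentially. \<forall>j\<in>UNIV. (\<integral>\<omega>. tail_test (real m) (Y \<omega> $ j) \<partial>Q) < \<delta>"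
    by (intro eventually_ball_finite) auto
  then obtain m :: nat where "\<And>j. (\<integral>\<omega>. tail_test (real m) (Y \<omega> $ j) \<partial>Q) < \<delta>"
    by (auto simp: eventually_sequentially)
  then show thesis by (intro that[of "real m"]) auto
qed

text \<open>
  On a cube, \<open>u\<close> is a continuous function of the \<open>sin (x $ j / L)\<close>, hence uniformly close to a
  polynomial in them; such a polynomial stays bounded by about \<open>sup \<bar>u\<bar>\<close> off the cube too, so that
  only the mass of the tails matters there.
\<close>

lemma trig_approximation:
  fixes u :: "real ^ 'n \<Rightarrow> real"
  assumes u: "continuous_on UNIV u" and B: "\<And>x. \<bar>u x\<bar> \<le> B" and \<epsilon>: "0 < \<epsilon>" and a: "0 \<le> a"
  obtains v where "trig_polynomial (\<lambda>x. complex_of_real (v x))"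
    "\<And>x. \<bar>u x - v x\<bar> \<le> \<epsilon> + (2 * B + \<epsilon>) * (\<Sum>j\<in>UNIV. tail_test a (x $ j))"
proof -
  \<comment> \<open>\<open>L\<close> maps \<open>[- pi / 2, pi / 2]\<close>, where
    \<open>arcsin\<close> inverts \<open>sin\<close>, onto \<open>[- (a + 1), a + 1]\<close>.
    Outside the cube with this side some \<open>tail_test a (x $ j)\<close> equals 1.\<close>
  define L where "L = 2 * (a + 1) / pi"
  have L: "0 < L" "L * (pi / 2) = a + 1" using a by (simp_all add: L_def)
  let ?S = "cbox (\<chi> j. -1) (\<chi> j. 1) :: (real ^ 'n) set"
  let ?w = "\<lambda>z :: real ^ 'n. u (\<chi> j. L * arcsin (z $ j))"
  have S: "z \<in> ?S \<longleftrightarrow> (\<forall>j. -1 \<le> z $ j \<and> z $ j \<le> 1)" for z by (simp add: mem_box_cart)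
  have "continuous_on ?S ?w"
  proof (rule continuous_on_compose2[OF u])
    show "continuous_on ?S (\<lambda>z. \<chi> j. L * arcsin (z $ j))"
      by (intro continuous_on_vec_lambda continuous_intros) (auto simp: S)
  qed simp
  then obtain p where p: "real_polynomial_function p" "\<And>z. z \<in> ?S \<Longrightarrow> \<bar>?w z - p z\<bar> < \<epsilon>"
    using Stone_Weierstrass_real_polynomial_function[of ?S ?w \<epsilon>] \<epsilon> by auto
  define v where "v = (\<lambda>x :: real ^ 'n. p (\<chi> j. sin (x $ j / L)))"
  have "\<bar>u x - v x\<bar> \<le> \<epsilon> + (2 * B + \<epsilon>) * (\<Sum>j\<in>UNIV. tail_test a (x $ j))" for x
  proof -
    have B0: "0 \<le> B" using B[of 0] by linarith
    have nn: "0 \<le> (\<Sum>j\<in>UNIV. tail_test a (x $ j))" by (intro sum_nonneg tail_test_bounds)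
    have w: "\<bar>?w (\<chi> j. sin (x $ j / L)) - v x\<bar> < \<epsilon>"
      unfolding v_def by (rule p(2)) (simp add: S)
    show ?thesis
    proof (cases "\<forall>j. \<bar>x $ j\<bar> \<le> a + 1")
      case True
      have "L * arcsin (sin (x $ j / L)) = x $ j" for j
      proof -
        have "\<bar>x $ j\<bar> \<le> L * (pi / 2)" unfolding L(2) using True by blast
        then have "- (pi / 2) * L \<le> x $ j" "x $ j \<le> (pi / 2) * L" by (simp_all add: abs_le_iff mult.commute)
        then have "- (pi / 2) \<le> x $ j / L" "x $ j / L \<le> pi / 2"
          by (simp_all only: pos_le_divide_eq[OF L(1)] pos_divide_le_eq[OF L(1)])
        then have "arcsin (sin (x $ j / L)) = x $ j / L" by (rule arcsin_sin)
        then show ?thesis using L(1) by simp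
      qed
      then have "?w (\<chi> j. sin (x $ j / L)) = u x" by (simp add: vec_nth_inverse)
      then have "\<bar>u x - v x\<bar> \<le> \<epsilon>" using w by simp
      moreover have "0 \<le> (2 * B + \<epsilon>) * (\<Sum>j\<in>UNIV. tail_test a (x $ j))" using nn B0 \<epsilon> by simp
      ultimately show ?thesis by linarith
    next
      case False
      \<comment> \<open>Off the cube \<open>v x\<close> is still within \<open>\<epsilon>\<close> of
        some value of \<open>u\<close>, so \<open>u x\<close> and \<open>v x\<close> differ by at
        most \<open>2 * B + \<epsilon>\<close>, which one summand of the tail sum pays for.\<close>
      then obtain i where "a + 1 < \<bar>x $ i\<bar>" by (auto simp: not_le)
      then have i: "a + 1 \<le> \<bar>x $ i\<bar>" by simp
      have "1 = tail_test a (x $ i)" using tail_test_bounds(3)[OF i] by simp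
      also have "\<dots> \<le> (\<Sum>j\<in>UNIV. tail_test a (x $ j))"
        by (rule member_le_sum) (auto intro: tail_test_bounds)
      finally have "(2 * B + \<epsilon>) * 1 \<le> (2 * B + \<epsilon>) * (\<Sum>j\<in>UNIV. tail_test a (x $ j))"
        using B0 \<epsilon> by (intro mult_left_mono) auto
      moreover have "\<bar>u x - v x\<bar> \<le> 2 * B + \<epsilon>"
        using w B[of x] B[of "\<chi> j. L * arcsin ((\<chi> j. sin (x $ j / L)) $ j)"] by linarith
      ultimately have "\<bar>u x - v x\<bar> \<le> (2 * B + \<epsilon>) * (\<Sum>j\<in>UNIV. tail_test a (x $ j))" by simp
      then show ?thesis using \<epsilon> by simp
    qed
  qed
  moreover have "trig_polynomial (\<lambda>x. complex_of_real (v x))"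
    unfolding v_def by (rule trig_polynomial_of_polynomial[OF p(1)])
  ultimately show thesis by (rule that[rotated])
qed

theorem integral_bounded_continuous_tendsto:
  fixes u :: "real ^ 'n \<Rightarrow> real"
  assumes u: "continuous_on UNIV u" and bdd: "bounded (range u)"
  shows "(\<lambda>k. \<integral>\<omega>. u (X k \<omega>) \<partial>P k) \<longlonglongrightarrow> (\<integral>\<omega>. u (Y \<omega>) \<partial>Q)"
proof (rule LIMSEQ_I)
  fix r :: real assume r: "0 < r"
  obtain B0 where B0: "\<And>x. \<bar>u x\<bar> \<le> B0" using bdd by (auto simp: bounded_iff)
  define B where "B = max B0 1"
  have B: "\<bar>u x\<bar> \<le> B" "1 \<le> B" for x using B0[of x] by (auto simp: B_def)
  let ?n = "real CARD('n)"
  have n: "1 \<le> ?n" using zero_less_card_finite[where 'a='n] by linarith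
  \<comment> \<open>\<open>\<epsilon>\<close> accounts for \<open>r / 8\<close>, and the tails,
    \<open>(2 * B + 1) * CARD('n) * \<delta>\<close>, for another \<open>r / 8\<close>. Replacing
    \<open>u\<close> by \<open>v\<close> thus costs at most \<open>r / 4\<close>, under the laws of
    \<open>X k\<close> for large \<open>k\<close> and of \<open>Y\<close> alike.\<close>
  define \<epsilon> where "\<epsilon> = min 1 (r / 8)"
  have \<epsilon>: "0 < \<epsilon>" "\<epsilon> \<le> 1" "\<epsilon> \<le> r / 8" using r by (auto simp: \<epsilon>_def)
  define \<delta> where "\<delta> = r / (8 * (2 * B + 1) * ?n)"
  have \<delta>: "0 < \<delta>" using r B n by (simp add: \<delta>_def)
  obtain a where a: "0 \<le> a" "\<And>j. (\<integral>\<omega>. tail_test a (Y \<omega> $ j) \<partial>Q) < \<delta>" using tail_test_small[OF \<delta>] by blast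
  obtain v where v: "trig_polynomial (\<lambda>x. complex_of_real (v x))"
    "\<And>x. \<bar>u x - v x\<bar> \<le> \<epsilon> + (2 * B + \<epsilon>) * (\<Sum>j\<in>UNIV. tail_test a (x $ j))"
    using trig_approximation[OF u B(1) \<epsilon>(1) a(1)] by blast
  have um[measurable]: "u \<in> borel_measurable borel" by (rule borel_measurable_continuous_onI[OF u])
  have vm[measurable]: "v \<in> borel_measurable borel"
    using measurable_compose[OF trig_polynomial_measurable[OF v(1)] borel_measurable_Re] by simp
  obtain V where V: "\<And>x. \<bar>v x\<bar> \<le> V" using trig_polynomial_bounded[OF v(1)] by auto
  have close: "\<bar>(\<integral>\<omega>. u (Z \<omega>) \<partial>R) - (\<integral>\<omega>. v (Z \<omega>) \<partial>R)\<bar> \<le> r / 4"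
    if "prob_space R" and [measurable]: "Z \<in> borel_measurable R" "\<And>j. (\<lambda>\<omega>. Z \<omega> $ j) \<in> borel_measurable R"
      and small: "\<And>j. (\<integral>\<omega>. tail_test a (Z \<omega> $ j) \<partial>R) < \<delta>" for R :: "'z measure" and Z :: "'z \<Rightarrow> real ^ 'n"
  proof -
    interpret R: prob_space R by fact
    have iu: "integrable R (\<lambda>\<omega>. u (Z \<omega>))" by (rule R.integrable_const_bound[of _ B]) (use B in auto)
    have iv: "integrable R (\<lambda>\<omega>. v (Z \<omega>))" by (rule R.integrable_const_bound[of _ V]) (use V in auto)
    have it: "integrable R (\<lambda>\<omega>. tail_test a (Z \<omega> $ j))" for j
      by (rule R.integrable_const_bound[of _ 1]) (use tail_test_bounds in auto)
    have "\<bar>(\<integral>\<omega>. u (Z \<omega>) \<partial>R) - (\<integral>\<omega>. v (Z \<omega>) \<partial>R)\<bar> = \<bar>\<integral>\<omega>. u (Z \<omega>) - v (Z \<omega>) \<partial>R\<bar>"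
      by (simp add: iu iv)
    also have "\<dots> \<le> (\<integral>\<omega>. \<bar>u (Z \<omega>) - v (Z \<omega>)\<bar> \<partial>R)" by (rule integral_abs_bound)
    also have "\<dots> \<le> (\<integral>\<omega>. \<epsilon> + (2 * B + \<epsilon>) * (\<Sum>j\<in>UNIV. tail_test a (Z \<omega> $ j)) \<partial>R)"
      by (intro integral_mono v(2) integrable_abs Bochner_Integration.integrable_diff Bochner_Integration.integrable_add
          integrable_mult_right Bochner_Integration.integrable_sum iu iv it) simp
    also have "\<dots> = \<epsilon> + (2 * B + \<epsilon>) * (\<Sum>j\<in>UNIV. \<integral>\<omega>. tail_test a (Z \<omega> $ j) \<partial>R)"
      by (simp add: it R.prob_space)
    also have "\<dots> \<le> \<epsilon> + (2 * B + 1) * (\<Sum>j\<in>(UNIV :: 'n set). \<delta>)"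
    proof (intro add_left_mono mult_mono)
      show "(\<Sum>j\<in>UNIV. \<integral>\<omega>. tail_test a (Z \<omega> $ j) \<partial>R) \<le> (\<Sum>j\<in>(UNIV :: 'n set). \<delta>)"
        by (intro sum_mono less_imp_le small)
      show "0 \<le> (\<Sum>j\<in>UNIV. \<integral>\<omega>. tail_test a (Z \<omega> $ j) \<partial>R)"
        by (intro sum_nonneg Bochner_Integration.integral_nonneg tail_test_bounds)
    qed (use \<epsilon> B(2) in auto)
    also have "(2 * B + 1) * (\<Sum>j\<in>(UNIV :: 'n set). \<delta>) = r / 8"
    proof -
      have "c * (m * (r / (8 * c * m))) = r / 8" if "0 < c" "0 < m" for c m :: real
        using that by (simp add: field_simps)
      from this[of "2 * B + 1" ?n] show ?thesis using B(2) n by (simp add: \<delta>_def)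
    qed
    finally show ?thesis using \<epsilon> by linarith
  qed
  have vlim: "(\<lambda>k. \<integral>\<omega>. v (X k \<omega>) \<partial>P k) \<longlonglongrightarrow> (\<integral>\<omega>. v (Y \<omega>) \<partial>Q)"
    using tendsto_Re[OF integral_trig_polynomial_tendsto[OF v(1)]] by simp
  have "\<forall>\<^sub>F k in sequentially. \<forall>j\<in>UNIV. (\<integral>\<omega>. tail_test a (X k \<omega> $ j) \<partial>P k) < \<delta>"
    by (intro eventually_ball_finite ballI order_tendstoD(2)[OF tail_test_tendsto] a(2)) simp
  moreover have "\<forall>\<^sub>F k in sequentially. dist (\<integral>\<omega>. v (X k \<omega>) \<partial>P k) (\<integral>\<omega>. v (Y \<omega>) \<partial>Q) < r / 4"
    using vlim r by (intro tendstoD) auto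
  ultimately have "\<forall>\<^sub>F k in sequentially. norm ((\<integral>\<omega>. u (X k \<omega>) \<partial>P k) - (\<integral>\<omega>. u (Y \<omega>) \<partial>Q)) < r"
  proof eventually_elim
    case (elim k)
    have "\<bar>(\<integral>\<omega>. u (X k \<omega>) \<partial>P k) - (\<integral>\<omega>. v (X k \<omega>) \<partial>P k)\<bar> \<le> r / 4"
      by (rule close[OF P_prob X_measurable component_measurable(1)]) (use elim in auto)
    moreover have "\<bar>(\<integral>\<omega>. u (Y \<omega>) \<partial>Q) - (\<integral>\<omega>. v (Y \<omega>) \<partial>Q)\<bar> \<le> r / 4"
      by (rule close[OF Q.prob_space_axioms Y_measurable component_measurable(2) a(2)])
    ultimately show ?case using elim(2) r unfolding dist_real_def real_norm_def by linarith
  qed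
  then show "\<exists>no. \<forall>k\<ge>no. norm ((\<integral>\<omega>. u (X k \<omega>) \<partial>P k) - (\<integral>\<omega>. u (Y \<omega>) \<partial>Q)) < r"
    by (simp add: eventually_sequentially)
qed

end

section \<open>The Gaussian limit of the ball field\<close>

lemma (in prob_space) gaussian_characteristic:
  assumes "centered_gaussian M Y v" "0 \<le> v"
  shows "expectation (\<lambda>\<omega>. iexp (Y \<omega>)) = complex_of_real (exp (- v / 2))"
proof (cases "v = 0")
  case True
  then have [measurable]: "Y \<in> borel_measurable M" and "AE \<omega> in M. Y \<omega> = 0"
    using assms(1) by (auto simp: centered_gaussian_def)
  then have "expectation (\<lambda>\<omega>. iexp (Y \<omega>)) = expectation (\<lambda>\<omega>. 1)"
    by (intro integral_cong_AE) auto
  then show ?thesis using True by (simp add: prob_space)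
next
  case False
  define \<sigma> where "\<sigma> = sqrt v"
  have \<sigma>: "0 < \<sigma>" "\<sigma>\<^sup>2 = v" using False assms(2) by (simp_all add: \<sigma>_def)
  have [measurable]: "Y \<in> borel_measurable M" and "distributed M lborel Y (\<lambda>x. ennreal (normal_density 0 \<sigma> x))"
    using assms(1) False by (auto simp: centered_gaussian_def \<sigma>_def)
  then have Z: "distributed M lborel (\<lambda>\<omega>. (Y \<omega> - 0) / \<sigma>) (\<lambda>x. ennreal (std_normal_density x))"
    using normal_standard_normal_convert[OF \<sigma>(1), of Y 0] by simp
  have "distr M borel (\<lambda>\<omega>. Y \<omega> / \<sigma>) = distr M lborel (\<lambda>\<omega>. Y \<omega> / \<sigma>)" by (rule distr_cong) auto
  also have "\<dots> = density lborel (\<lambda>x. ennreal (std_normal_density x))" using Z by (simp add: distributed_def)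
  finally have eq: "distr M borel (\<lambda>\<omega>. Y \<omega> / \<sigma>) = std_normal_distribution" .
  have "expectation (\<lambda>\<omega>. iexp (Y \<omega>)) = expectation (\<lambda>\<omega>. iexp (\<sigma> * (Y \<omega> / \<sigma>)))" using \<sigma> by simp
  also have "\<dots> = char (distr M borel (\<lambda>\<omega>. Y \<omega> / \<sigma>)) \<sigma>"
    unfolding char_def by (subst integral_distr) simp_all
  also have "\<dots> = complex_of_real (exp (- v / 2))"
    unfolding eq char_std_normal_distribution using \<sigma> by simp
  finally show ?thesis .
qed

lemma gaussian_random_measure_sum:
  assumes M2: "centered_gaussian_random_measure Q m I"
    and g: "\<And>j. j \<in> J \<Longrightarrow> square_integrable m (g j)" and J: "finite J"
  shows "square_integrable m (\<lambda>z. \<Sum>j\<in>J. t j * g j z) \<and>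
    (AE \<omega> in Q. I (\<lambda>z. \<Sum>j\<in>J. t j * g j z) \<omega> = (\<Sum>j\<in>J. t j * I (g j) \<omega>))"
  using J g
proof (induction J rule: finite_induct)
  case empty
  have sq: "square_integrable m (\<lambda>_. 0)" by (simp add: square_integrable_def)
  \<comment> \<open>Linearity with both coefficients zero: the stochastic integral of the zero
    function vanishes almost surely.\<close>
  then have "AE \<omega> in Q. I (\<lambda>z. 0 * (0 :: real) + 0 * 0) \<omega> = 0 * I (\<lambda>_. 0) \<omega> + 0 * I (\<lambda>_. 0) \<omega>"
    using M2 unfolding centered_gaussian_random_measure_def by blast
  then show ?case using sq by simp
next
  case (insert i J)
  let ?h = "\<lambda>z. \<Sum>j\<in>J. t j * g j z"
  have IH: "square_integrable m ?h" "AE \<omega> in Q. I ?h \<omega> = (\<Sum>j\<in>J. t j * I (g j) \<omega>)"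
    and gi: "square_integrable m (g i)"
    using insert by auto
  note [measurable] = IH(1)[unfolded square_integrable_def, THEN conjunct1] gi[unfolded square_integrable_def, THEN conjunct1]
  have "square_integrable m (\<lambda>z. t i * g i z + 1 * ?h z)"
    unfolding square_integrable_def
  proof
    show "integrable m (\<lambda>z. (t i * g i z + 1 * ?h z)\<^sup>2)"
    proof (rule Bochner_Integration.integrable_bound)
      show "integrable m (\<lambda>z. 2 * (t i)\<^sup>2 * (g i z)\<^sup>2 + 2 * (?h z)\<^sup>2)"
        using IH(1) gi by (simp add: square_integrable_def)
      have sq: "(x + y)\<^sup>2 \<le> 2 * x\<^sup>2 + 2 * y\<^sup>2" for x y :: real
        using zero_le_power2[of "x - y"] by (simp add: power2_sum power2_diff)
      have "(t i * a + 1 * b)\<^sup>2 \<le> 2 * (t i)\<^sup>2 * a\<^sup>2 + 2 * b\<^sup>2" for a b :: real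
        using sq[of "t i * a" b] by (simp add: power_mult_distrib)
      then show "AE z in m. norm ((t i * g i z + 1 * ?h z)\<^sup>2) \<le> norm (2 * (t i)\<^sup>2 * (g i z)\<^sup>2 + 2 * (?h z)\<^sup>2)"
        by (intro AE_I2) (simp only: real_norm_def abs_power2, simp)
    qed measurable
  qed measurable
  moreover have "AE \<omega> in Q. I (\<lambda>z. t i * g i z + 1 * ?h z) \<omega> = t i * I (g i) \<omega> + 1 * I ?h \<omega>"
    using M2 IH(1) gi unfolding centered_gaussian_random_measure_def by blast
  then have "AE \<omega> in Q. I (\<lambda>z. t i * g i z + 1 * ?h z) \<omega> = t i * I (g i) \<omega> + (\<Sum>j\<in>J. t j * I (g j) \<omega>)"
    using IH(2) by eventually_elim simp
  ultimately show ?case using insert.hyps by simp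
qed

section \<open>The centered field at a fixed scale\<close>

context radius_law
begin

text \<open>The real-valued form of \<open>scaled_radius_density\<close>, for scaling complex
  integrands by \<open>*\<^sub>R\<close>.\<close>

definition radius_weight :: "real \<Rightarrow> real \<Rightarrow> real" where
  "radius_weight \<rho> r = indicator {0..} r * (f (r / \<rho>) / \<rho>)"

lemma radius_weight_measurable[measurable]: "radius_weight \<rho> \<in> borel_measurable borel"
  unfolding radius_weight_def[abs_def] by measurable

lemma radius_weight_nonneg: "0 < \<rho> \<Longrightarrow> 0 \<le> radius_weight \<rho> r"
  using f_nonneg[of "r / \<rho>"] by (cases "0 \<le> r") (simp_all add: radius_weight_def)

lemma scaled_radius_density_eq: "0 < \<rho> \<Longrightarrow> scaled_radius_density f \<rho> r = ennreal (radius_weight \<rho> r)"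
  by (simp add: scaled_radius_density_def radius_weight_def indicator_def)

lemma integral_pair_scaled_law:
  fixes h :: "'a::euclidean_space \<times> real \<Rightarrow> complex"
  assumes \<rho>: "0 < \<rho>" and h: "h \<in> borel_measurable (borel \<Otimes>\<^sub>M borel)"
  shows "(\<integral>z. h z \<partial>(lborel \<Otimes>\<^sub>M scaled_law \<rho>)) = (\<integral>z. radius_weight \<rho> (snd z) *\<^sub>R h z \<partial>lborel)"
proof -
  interpret S: prob_space "scaled_law \<rho>" by (rule scaled_law_prob_space[OF \<rho>])
  have [measurable]: "h \<in> borel_measurable (lborel :: ('a \<times> real) measure)"
    using h by (simp add: borel_prod)
  have sm[measurable]: "(snd :: 'a \<times> real \<Rightarrow> real) \<in> lborel \<rightarrow>\<^sub>M borel"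
    by (simp, intro borel_measurable_continuous_onI continuous_on_snd continuous_on_id)
  have "density (lborel :: 'a measure) (\<lambda>_. 1) \<Otimes>\<^sub>M scaled_law \<rho> =
      density (lborel \<Otimes>\<^sub>M lborel) (\<lambda>(x, r). 1 * scaled_radius_density f \<rho> r)"
    by (rule pair_measure_density) (measurable, unfold_locales)
  then have "(lborel :: 'a measure) \<Otimes>\<^sub>M scaled_law \<rho> = density lborel (\<lambda>z. ennreal (radius_weight \<rho> (snd z)))"
    by (simp add: density_1 lborel_prod scaled_radius_density_eq[OF \<rho>] split_beta')
  then show ?thesis
    by (simp only:, intro integral_density) (measurable, simp add: radius_weight_nonneg[OF \<rho>])
qed

end

locale scaled_model = marked_dpp P N X \<phi> K R "scaled_radius_density f \<rho>" + radius_law \<beta> C\<^sub>\<beta> C\<^sub>0 "real DIM('a)" f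
  for P :: "'w measure" and N and X :: "nat \<Rightarrow> 'w \<Rightarrow> 'a::euclidean_space" and \<phi> K R
    and \<beta> C\<^sub>\<beta> C\<^sub>0 :: real and f :: "real \<Rightarrow> real" and \<rho> :: real +
  fixes \<Phi> :: "'w \<Rightarrow> ('a \<times> real) set"
  assumes \<rho>_pos: "0 < \<rho>"
    and marked_points_eq: "\<And>\<omega>. \<omega> \<in> space P \<Longrightarrow> \<Phi> \<omega> = (\<lambda>n. (X n \<omega>, R n \<omega>)) ` {n. enat n < N \<omega>}"
begin

lemma mark_law_eq: "mark_law = scaled_law \<rho>" by (simp add: mark_law_def)

sublocale LS: pair_sigma_finite "lborel :: 'a measure" "scaled_law \<rho>"
  by (intro pair_sigma_finite.intro lborel.sigma_finite_measure_axioms mark.sigma_finite_measure_axioms[unfolded mark_law_eq])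

lemma integrable_pair_scaled_law:
  fixes h :: "'a \<times> real \<Rightarrow> 'c::{banach, second_countable_topology}"
  assumes [measurable]: "h \<in> borel_measurable (borel \<Otimes>\<^sub>M borel)" "G \<in> borel_measurable (borel \<Otimes>\<^sub>M borel)"
    and le: "\<And>z. norm (h z) \<le> \<bar>G z\<bar>"
    and fin: "(\<integral>\<^sup>+x. \<integral>\<^sup>+r. ennreal \<bar>G (x, r)\<bar> \<partial>scaled_law \<rho> \<partial>lborel) < \<infinity>"
  shows "integrable (lborel \<Otimes>\<^sub>M scaled_law \<rho>) h"
proof (rule integrableI_bounded)
  have "(\<integral>\<^sup>+z. ennreal (norm (h z)) \<partial>(lborel \<Otimes>\<^sub>M scaled_law \<rho>)) \<le> (\<integral>\<^sup>+z. ennreal \<bar>G z\<bar> \<partial>(lborel \<Otimes>\<^sub>M scaled_law \<rho>))"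
    by (intro nn_integral_mono ennreal_leI le)
  also have "\<dots> = (\<integral>\<^sup>+x. \<integral>\<^sup>+r. ennreal \<bar>G (x, r)\<bar> \<partial>scaled_law \<rho> \<partial>lborel)"
    by (rule LS.M2.nn_integral_fst[symmetric]) measurable
  finally show "(\<integral>\<^sup>+z. ennreal (norm (h z)) \<partial>(lborel \<Otimes>\<^sub>M scaled_law \<rho>)) < \<infinity>" using fin by (rule le_less_trans)
qed measurable

text \<open>Centering multiplies the characteristic function by \<open>exp (- \<i> * c)\<close>. As
  \<open>K 0\<close> is real, this can be merged into the exponent, where it subtracts the linear
  Taylor term of \<open>iexp (G z / n)\<close>. The difference has a limit as \<rho> tends to 0,
  which its two parts need not have.\<close>

proposition normalized_characteristic:
  fixes G :: "'a \<times> real \<Rightarrow> real" and n e :: real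
  assumes G: "tame \<beta> G" and e: "0 \<le> e" "e < 1"
    and hs: "(\<integral>\<^sup>+x. ennreal ((norm (\<integral>r. (iexp (G (x, r) / n) - 1) \<partial>scaled_law \<rho>))\<^sup>2) \<partial>lborel) *
      (\<integral>\<^sup>+x. ennreal ((norm (K x))\<^sup>2) \<partial>lborel) \<le> ennreal (e\<^sup>2)"
  obtains D where "norm (D - 1) \<le> e\<^sup>2 / (1 - e)"
    "(\<integral>\<omega>. iexp (marked_sum (\<lambda>z. G z / n) \<omega> - Re (K 0) * (\<integral>z. G z / n \<partial>(lborel \<Otimes>\<^sub>M scaled_law \<rho>))) \<partial>P) =
      D * exp (K 0 * (\<integral>z. radius_weight \<rho> (snd z) *\<^sub>R (iexp (G z / n) - 1 - \<i> * complex_of_real (G z / n)) \<partial>lborel))"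
proof -
  note [measurable] = tame_measurable[OF G]
  let ?g = "\<lambda>z. G z / n"
  let ?LS = "(lborel :: 'a measure) \<Otimes>\<^sub>M scaled_law \<rho>"
  define V where "V = (\<lambda>x. \<integral>r. (iexp (?g (x, r)) - 1) \<partial>mark_law)"
  have V_meas[measurable]: "V \<in> borel_measurable borel" unfolding V_def by measurable
  have fin: "(\<integral>\<^sup>+x. \<integral>\<^sup>+r. ennreal \<bar>?g (x, r)\<bar> \<partial>scaled_law \<rho> \<partial>lborel) < \<infinity>"
    by (rule tame_first_moment[OF G refl \<rho>_pos])
  have nb: "norm (iexp y - 1) \<le> \<bar>y\<bar>" for y using iexp_approx1[of y 0] by simp
  have int_g: "integrable ?LS (\<lambda>z. complex_of_real (?g z))"
    by (rule integrable_pair_scaled_law[OF _ _ _ fin]) (measurable, simp only: norm_of_real order_refl)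
  have int_e: "integrable ?LS (\<lambda>z. iexp (?g z) - 1)"
    by (rule integrable_pair_scaled_law[OF _ _ _ fin]) (measurable, rule nb)
  have V_fst: "integrable lborel V" "(\<integral>x. V x \<partial>lborel) = (\<integral>z. iexp (?g z) - 1 \<partial>?LS)"
    using LS.integrable_fst'[OF int_e] LS.integral_fst'[OF int_e] by (simp_all add: V_def mark_law_eq)
  \<comment> \<open>Any finite bound will do, since \<open>t\<close> does not occur in the
    conclusion.\<close>
  define t where "t = (\<integral>x. norm (V x) * norm (K 0) \<partial>lborel)"
  have wk: "weighted_kernel lborel \<kappa> (\<lambda>x. norm (V x)) t e"
  proof (rule weighted_kernelI)
    show "0 \<le> t" unfolding t_def by simp
    have "integrable lborel (\<lambda>x. norm (V x) * norm (K 0))" using V_fst(1) by simp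
    then show "(\<integral>\<^sup>+x. ennreal (norm (V x) * norm (K 0)) \<partial>lborel) \<le> ennreal t"
      unfolding t_def by (subst nn_integral_eq_integral) simp_all
    show "(\<integral>\<^sup>+x. ennreal ((norm (V x))\<^sup>2) \<partial>lborel) * (\<integral>\<^sup>+x. ennreal ((norm (K x))\<^sup>2) \<partial>lborel) \<le> ennreal (e\<^sup>2)"
      using hs by (simp only: V_def mark_law_eq)
  qed (use e in simp_all)
  obtain D where D: "norm (D - 1) \<le> e\<^sup>2 / (1 - e)"
    and cf: "(\<integral>\<omega>. iexp (marked_sum ?g \<omega>) \<partial>P) = D * exp (\<integral>x. V x * K 0 \<partial>lborel)"
  proof (rule characteristic_functional[of ?g t e])
    show "?g \<in> borel_measurable (borel \<Otimes>\<^sub>M borel)" by measurable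
    show "(\<integral>\<^sup>+x. \<integral>\<^sup>+r. ennreal (norm (?g (x, r))) \<partial>mark_law \<partial>lborel) < \<infinity>"
      using fin by (simp only: mark_law_eq real_norm_def)
    show "weighted_kernel lborel \<kappa> (\<lambda>x. norm (\<integral>r. (iexp (?g (x, r)) - 1) \<partial>mark_law)) t e"
      using wk unfolding V_def .
  qed (use e in \<open>simp_all add: V_def\<close>)
  define c where "c = Re (K 0) * (\<integral>z. ?g z \<partial>?LS)"
  have K0: "K 0 = complex_of_real (Re (K 0))" using dpp_kernel_diagonal[OF dpp] by (simp add: complex_eq_iff)
  have "\<i> * complex_of_real c = K 0 * (\<integral>z. \<i> * complex_of_real (?g z) \<partial>?LS)"
    unfolding c_def integral_mult_right_zero integral_complex_of_real of_real_mult
    by (subst (2) K0) (simp only: mult.left_commute)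
  moreover have "(\<integral>x. V x * K 0 \<partial>lborel) = K 0 * (\<integral>z. iexp (?g z) - 1 \<partial>?LS)"
    using V_fst by simp
  ultimately have "(\<integral>x. V x * K 0 \<partial>lborel) - \<i> * complex_of_real c = K 0 * (\<integral>z. (iexp (?g z) - 1) - \<i> * complex_of_real (?g z) \<partial>?LS)"
    using int_g int_e by (subst Bochner_Integration.integral_diff) (simp_all only: integrable_mult_right right_diff_distrib)
  also have "\<dots> = K 0 * (\<integral>z. radius_weight \<rho> (snd z) *\<^sub>R (iexp (?g z) - 1 - \<i> * complex_of_real (?g z)) \<partial>lborel)"
    by (subst integral_pair_scaled_law[OF \<rho>_pos]) simp_all
  finally have ex: "(\<integral>x. V x * K 0 \<partial>lborel) - \<i> * complex_of_real c = \<dots>" .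
  have "iexp (marked_sum ?g \<omega> - c) = iexp (marked_sum ?g \<omega>) * exp (- (\<i> * complex_of_real c))" for \<omega>
    by (simp add: exp_add[symmetric] right_diff_distrib)
  then have "(\<integral>\<omega>. iexp (marked_sum ?g \<omega> - c) \<partial>P) = (\<integral>\<omega>. iexp (marked_sum ?g \<omega>) \<partial>P) * exp (- (\<i> * complex_of_real c))"
    by (simp only: integral_mult_left_zero)
  also have "\<dots> = D * exp ((\<integral>x. V x * K 0 \<partial>lborel) - \<i> * complex_of_real c)"
    unfolding cf by (simp add: exp_diff exp_minus divide_inverse)
  finally have "(\<integral>\<omega>. iexp (marked_sum ?g \<omega> - c) \<partial>P) =
      D * exp (K 0 * (\<integral>z. radius_weight \<rho> (snd z) *\<^sub>R (iexp (?g z) - 1 - \<i> * complex_of_real (?g z)) \<partial>lborel))"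
    by (simp only: ex)
  then show thesis unfolding c_def by (rule that[OF D])
qed

text \<open>The points are distinct, so the integral over the marked points can be pulled back to
  the labels. The second branch is the Bochner convention: without absolute summability the integral
  is 0.\<close>

lemma ball_field_eq:
  assumes \<omega>: "\<omega> \<in> space P"
  shows "ball_field \<Phi> \<mu> \<omega> = (if summable (\<lambda>n. norm (of_bool (enat n < N \<omega>) * measure \<mu> (cball (X n \<omega>) (R n \<omega>))))
    then marked_sum (\<lambda>(x, r). measure \<mu> (cball x r)) \<omega> else 0)"
proof -
  let ?A = "{n. enat n < N \<omega>}"
  let ?g = "\<lambda>(x, r). measure \<mu> (cball x r)"
  let ?f = "\<lambda>n. of_bool (enat n < N \<omega>) * measure \<mu> (cball (X n \<omega>) (R n \<omega>))"
  have bij: "bij_betw (\<lambda>n. (X n \<omega>, R n \<omega>)) ?A (\<Phi> \<omega>)"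
    unfolding marked_points_eq[OF \<omega>] using X_inj[OF \<omega>]
    by (intro inj_on_imp_bij_betw) (auto simp: inj_on_def)
  have "ball_field \<Phi> \<mu> \<omega> = (\<integral>n. ?g (X n \<omega>, R n \<omega>) \<partial>count_space ?A)"
    unfolding ball_field_def by (rule integral_bij_count_space[OF bij, symmetric])
  also have "\<dots> = (\<integral>n. ?g (X n \<omega>, R n \<omega>) \<partial>restrict_space (count_space UNIV) ?A)"
    by (simp add: restrict_count_space)
  also have "\<dots> = (\<integral>n. indicator ?A n *\<^sub>R ?g (X n \<omega>, R n \<omega>) \<partial>count_space UNIV)"
    by (rule integral_restrict_space) simp
  also have "\<dots> = (\<integral>n. ?f n \<partial>count_space UNIV)"
    by (intro Bochner_Integration.integral_cong) (simp_all add: indicator_def)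
  also have "\<dots> = (if summable (\<lambda>n. norm (?f n)) then marked_sum ?g \<omega> else 0)"
  proof (cases "summable (\<lambda>n. norm (?f n))")
    case True
    then have "integrable (count_space UNIV) ?f" by (simp only: integrable_count_space_nat_iff)
    then have "(\<integral>n. ?f n \<partial>count_space UNIV) = (\<Sum>n. ?f n)" by (rule integral_count_space_nat)
    then show ?thesis using True by (simp only: marked_sum_def split_conv if_True)
  next
    case False
    then have "\<not> integrable (count_space UNIV) ?f" by (simp only: integrable_count_space_nat_iff not_False_eq_True)
    from not_integrable_integral_eq[OF this] show ?thesis by (simp only: False if_False)
  qed
  finally show ?thesis .
qed

end

lemma summable_norm_iff_suminf_finite:
  fixes a :: "nat \<Rightarrow> real"
  shows "summable (\<lambda>n. norm (a n)) \<longleftrightarrow> (\<Sum>n. ennreal (norm (a n))) \<noteq> \<top>"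
proof
  assume "summable (\<lambda>n. norm (a n))"
  then show "(\<Sum>n. ennreal (norm (a n))) \<noteq> \<top>" by (rule ennreal_suminf_neq_top) (rule norm_ge_zero)
qed (rule summable_suminf_not_top[OF norm_ge_zero])

context scaled_model
begin

text \<open>Absolute summability is expressed as finiteness of a series in
  \<open>[0,\<infinity>]\<close>, which makes the case distinction of \<open>ball_field_eq\<close>
  measurable.\<close>

lemma ball_field_measurable:
  assumes \<mu>: "\<mu> \<in> M_beta_plus \<beta>"
  shows "ball_field \<Phi> \<mu> \<in> borel_measurable P"
proof -
  have gm: "(\<lambda>(x, r). measure \<mu> (cball x r)) \<in> borel_measurable (borel \<Otimes>\<^sub>M borel)"
    by (rule tame_measurable[OF tame_ball_measure[OF \<mu>]])
  have [measurable]: "(\<lambda>\<omega>. measure \<mu> (cball (X n \<omega>) (R n \<omega>))) \<in> borel_measurable P" for n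
    using measurable_compose[OF measurable_Pair[OF X_measurable R_measurable] gm] by simp
  have [measurable]: "marked_sum (\<lambda>(x, r). measure \<mu> (cball x r)) \<in> borel_measurable P"
    by (rule marked_sum_measurable[OF gm])
  show ?thesis
    by (subst measurable_cong[OF ball_field_eq], assumption, unfold summable_norm_iff_suminf_finite) measurable
qed

lemma AE_ball_field:
  assumes \<mu>: "\<mu> \<in> M_beta_plus \<beta>"
  shows "AE \<omega> in P. summable (\<lambda>n. norm (of_bool (enat n < N \<omega>) * measure \<mu> (cball (X n \<omega>) (R n \<omega>)))) \<and>
    ball_field \<Phi> \<mu> \<omega> = marked_sum (\<lambda>(x, r). measure \<mu> (cball x r)) \<omega>"
proof -
  let ?g = "\<lambda>(x, r). measure \<mu> (cball x r)"
  have t: "tame \<beta> ?g" by (rule tame_ball_measure[OF \<mu>])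
  have "(\<integral>\<^sup>+x. \<integral>\<^sup>+r. ennreal (norm (?g (x, r))) \<partial>mark_law \<partial>lborel) < \<infinity>"
    using tame_first_moment[OF t refl \<rho>_pos, of 1] by (simp add: mark_law_eq)
  from AE_marked_summable[OF tame_measurable[OF t] this] AE_space
  show ?thesis
  proof eventually_elim
    case (elim \<omega>)
    have s: "summable (\<lambda>n. norm (of_bool (enat n < N \<omega>) * measure \<mu> (cball (X n \<omega>) (R n \<omega>))))"
      using elim(1) by (simp only: split_conv)
    show ?case using ball_field_eq[OF elim(2), of \<mu>] s by (simp only: if_True simp_thms)
  qed
qed

text \<open>Campbell's formula carried over to the reals: the ball masses are nonnegative, and the
  field agrees with the series off a null set.\<close>

lemma expectation_ball_field:
  assumes \<mu>: "\<mu> \<in> M_beta_plus \<beta>"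
  shows "expectation (ball_field \<Phi> \<mu>) = Re (K 0) * (\<integral>z. (\<lambda>(x, r). measure \<mu> (cball x r)) z \<partial>(lborel \<Otimes>\<^sub>M scaled_law \<rho>))"
proof -
  let ?g = "\<lambda>(x, r). measure \<mu> (cball x r)"
  let ?LS = "(lborel :: 'a measure) \<Otimes>\<^sub>M scaled_law \<rho>"
  have t: "tame \<beta> ?g" by (rule tame_ball_measure[OF \<mu>])
  note gm[measurable] = tame_measurable[OF t]
  have fin: "(\<integral>\<^sup>+x. \<integral>\<^sup>+r. ennreal \<bar>?g (x, r)\<bar> \<partial>scaled_law \<rho> \<partial>lborel) < \<infinity>"
    using tame_first_moment[OF t refl \<rho>_pos, of 1] by simp
  have int: "integrable ?LS ?g"
    by (rule integrable_pair_scaled_law[OF gm gm _ fin]) simp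
  have K0: "0 \<le> Re (K 0)" using dpp_kernel_diagonal[OF dpp] by simp
  have g0: "0 \<le> ?g z" for z by (simp add: split_beta')
  have "(\<integral>\<^sup>+\<omega>. ennreal (ball_field \<Phi> \<mu> \<omega>) \<partial>P) = (\<integral>\<^sup>+\<omega>. (\<Sum>n. of_bool (enat n < N \<omega>) * ennreal (?g (X n \<omega>, R n \<omega>))) \<partial>P)"
  proof (rule nn_integral_cong_AE)
    show "AE \<omega> in P. ennreal (ball_field \<Phi> \<mu> \<omega>) = (\<Sum>n. of_bool (enat n < N \<omega>) * ennreal (?g (X n \<omega>, R n \<omega>)))"
      using AE_ball_field[OF \<mu>]
    proof eventually_elim
      case (elim \<omega>)
      let ?a = "\<lambda>n. of_bool (enat n < N \<omega>) * ?g (X n \<omega>, R n \<omega>)"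
      have a0: "0 \<le> ?a n" for n by (intro mult_nonneg_nonneg g0) simp
      have "summable ?a" using elim by (intro summable_norm_cancel[of ?a]) (simp only: split_conv)
      then have "(\<Sum>n. ennreal (?a n)) = ennreal (marked_sum ?g \<omega>)"
        unfolding marked_sum_def using a0 by (intro suminf_ennreal2) auto
      moreover have "ennreal (?a n) = of_bool (enat n < N \<omega>) * ennreal (?g (X n \<omega>, R n \<omega>))" for n
        by (cases "enat n < N \<omega>") simp_all
      ultimately show ?case using elim by simp
    qed
  qed
  also have "\<dots> = ennreal (Re (K 0)) * (\<integral>\<^sup>+x. \<integral>\<^sup>+r. ennreal (?g (x, r)) \<partial>mark_law \<partial>lborel)"
    by (rule campbell) measurable
  also have "(\<integral>\<^sup>+x. \<integral>\<^sup>+r. ennreal (?g (x, r)) \<partial>mark_law \<partial>lborel) = (\<integral>\<^sup>+z. ennreal (?g z) \<partial>?LS)"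
    unfolding mark_law_eq by (rule LS.M2.nn_integral_fst) measurable
  also have "\<dots> = ennreal (\<integral>z. ?g z \<partial>?LS)"
    by (rule nn_integral_eq_integral[OF int]) (use g0 in auto)
  finally have nn: "(\<integral>\<^sup>+\<omega>. ennreal (ball_field \<Phi> \<mu> \<omega>) \<partial>P) = ennreal (Re (K 0) * (\<integral>z. ?g z \<partial>?LS))"
    using K0 by (simp add: ennreal_mult')
  have nonneg: "0 \<le> ball_field \<Phi> \<mu> \<omega>" for \<omega>
    unfolding ball_field_def by (rule Bochner_Integration.integral_nonneg) (simp add: split_beta')
  have "0 \<le> (\<integral>z. ?g z \<partial>?LS)" by (rule Bochner_Integration.integral_nonneg) (rule g0)
  then show ?thesis
    using integral_eq_nn_integral[OF ball_field_measurable[OF \<mu>]] nonneg K0 by (simp add: nn)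
qed

text \<open>A combination of series is the series of the combination where all of them converge;
  this costs one null set for each of finitely many measures.\<close>

lemma AE_centered_combination:
  fixes \<mu> :: "'n::finite \<Rightarrow> 'a measure"
  defines "g \<equiv> \<lambda>j (x, r). measure (\<mu> j) (cball x r)"
  assumes \<mu>: "\<And>j. \<mu> j \<in> M_beta_plus \<beta>"
  shows "AE \<omega> in P. (\<Sum>j\<in>UNIV. t j * (centered_ball_field P \<Phi> (\<mu> j) \<omega> / n)) =
    marked_sum (\<lambda>z. (\<Sum>j\<in>UNIV. t j * g j z) / n) \<omega> -
    Re (K 0) * (\<integral>z. (\<Sum>j\<in>UNIV. t j * g j z) / n \<partial>(lborel \<Otimes>\<^sub>M scaled_law \<rho>))"
proof -
  let ?LS = "(lborel :: 'a measure) \<Otimes>\<^sub>M scaled_law \<rho>"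
  have tame: "tame \<beta> (g j)" for j unfolding g_def by (rule tame_ball_measure[OF \<mu>])
  have int: "integrable ?LS (g j)" for j
  proof (rule integrable_pair_scaled_law[OF tame_measurable[OF tame] tame_measurable[OF tame]])
    show "(\<integral>\<^sup>+x. \<integral>\<^sup>+r. ennreal \<bar>g j (x, r)\<bar> \<partial>scaled_law \<rho> \<partial>lborel) < \<infinity>"
      using tame_first_moment[OF tame refl \<rho>_pos, of j 1] by simp
  qed simp
  have E: "expectation (ball_field \<Phi> (\<mu> j)) = Re (K 0) * (\<integral>z. g j z \<partial>?LS)" for j
    unfolding g_def by (rule expectation_ball_field[OF \<mu>])
  have "AE \<omega> in P. \<forall>j\<in>UNIV. summable (\<lambda>n. norm (of_bool (enat n < N \<omega>) * g j (X n \<omega>, R n \<omega>))) \<and>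
      ball_field \<Phi> (\<mu> j) \<omega> = marked_sum (g j) \<omega>"
  proof (rule AE_finite_allI)
    show "AE \<omega> in P. summable (\<lambda>n. norm (of_bool (enat n < N \<omega>) * g j (X n \<omega>, R n \<omega>))) \<and>
      ball_field \<Phi> (\<mu> j) \<omega> = marked_sum (g j) \<omega>" for j
      using AE_ball_field[OF \<mu>[of j]] unfolding g_def split_conv .
  qed simp
  then show ?thesis
  proof eventually_elim
    case (elim \<omega>)
    let ?a = "\<lambda>j m. of_bool (enat m < N \<omega>) * g j (X m \<omega>, R m \<omega>)"
    have s: "summable (?a j)" for j using elim by (intro summable_norm_cancel[of "?a j"]) simp
    have "marked_sum (\<lambda>z. (\<Sum>j\<in>UNIV. t j * g j z) / n) \<omega> = (\<Sum>m. \<Sum>j\<in>UNIV. (t j / n) * ?a j m)"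
      unfolding marked_sum_def
      by (intro suminf_cong) (simp add: sum_divide_distrib sum_distrib_left mult_ac)
    also have "\<dots> = (\<Sum>j\<in>UNIV. \<Sum>m. (t j / n) * ?a j m)"
      by (rule suminf_sum) (intro summable_mult s)
    also have "\<dots> = (\<Sum>j\<in>UNIV. (t j / n) * marked_sum (g j) \<omega>)"
      unfolding marked_sum_def by (intro sum.cong refl suminf_mult s)
    finally have 1: "marked_sum (\<lambda>z. (\<Sum>j\<in>UNIV. t j * g j z) / n) \<omega> = \<dots>" .
    have "(\<integral>z. (\<Sum>j\<in>UNIV. t j * g j z) / n \<partial>?LS) = (\<Sum>j\<in>UNIV. (t j / n) * (\<integral>z. g j z \<partial>?LS))"
      by (simp add: int sum_divide_distrib)
    then have "Re (K 0) * (\<integral>z. (\<Sum>j\<in>UNIV. t j * g j z) / n \<partial>?LS) = (\<Sum>j\<in>UNIV. (t j / n) * expectation (ball_field \<Phi> (\<mu> j)))"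
      by (simp add: E sum_distrib_left mult_ac)
    moreover have "(\<Sum>j\<in>UNIV. t j * (centered_ball_field P \<Phi> (\<mu> j) \<omega> / n)) =
        (\<Sum>j\<in>UNIV. (t j / n) * marked_sum (g j) \<omega>) - (\<Sum>j\<in>UNIV. (t j / n) * expectation (ball_field \<Phi> (\<mu> j)))"
      using elim by (simp add: centered_ball_field_def sum_subtractf[symmetric] right_diff_distrib diff_divide_distrib)
    ultimately show ?case using 1 by simp
  qed
qed

end

section \<open>Statements free of the enumeration\<close>

lemma scaled_model_exists:
  fixes K :: "'a::euclidean_space \<Rightarrow> complex"
  assumes law: "radius_law \<beta> C\<^sub>\<beta> C\<^sub>0 (real DIM('a)) f" and \<rho>: "0 < \<rho>"
    and K: "stationary_dpp P \<phi> K" "integrable lborel (\<lambda>x. (norm (K x))\<^sup>2)"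
    and marks: "iid_marking P \<phi> (scaled_radius_density f \<rho>) \<Phi>"
  obtains N X R where "scaled_model P N X \<phi> K R \<beta> C\<^sub>\<beta> C\<^sub>0 f \<rho> \<Phi>"
proof -
  interpret radius_law \<beta> C\<^sub>\<beta> C\<^sub>0 "real DIM('a)" f by fact
  have dpp: "dpp P \<phi> (\<lambda>x y. K (x - y)) lborel" using K(1) by (simp add: stationary_dpp_def)
  then interpret prob_space P by (simp add: dpp_def simple_point_process_def)
  obtain N :: "'b \<Rightarrow> enat" and X :: "nat \<Rightarrow> 'b \<Rightarrow> 'a" and R :: "nat \<Rightarrow> 'b \<Rightarrow> real" where m:
    "N \<in> P \<rightarrow>\<^sub>M count_space UNIV" "\<forall>n. X n \<in> borel_measurable P"
    "\<forall>\<omega>\<in>space P. inj_on (\<lambda>n. X n \<omega>) {n. enat n < N \<omega>} \<and> \<phi> \<omega> = (\<lambda>n. X n \<omega>) ` {n. enat n < N \<omega>} \<and>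
       \<Phi> \<omega> = (\<lambda>n. (X n \<omega>, R n \<omega>)) ` {n. enat n < N \<omega>}"
    "indep_vars (\<lambda>_. borel) R UNIV" "\<forall>n. distributed P lborel (R n) (scaled_radius_density f \<rho>)"
    "indep_set
      (sets (vimage_algebra (space P) (\<lambda>\<omega>. (N \<omega>, \<lambda>n. X n \<omega>)) (count_space UNIV \<Otimes>\<^sub>M (\<Pi>\<^sub>M n\<in>UNIV. borel))))
      (sets (vimage_algebra (space P) (\<lambda>\<omega> n. R n \<omega>) (\<Pi>\<^sub>M n\<in>UNIV. borel)))"
    using marks unfolding iid_marking_def by blast
  have K2: "(\<integral>\<^sup>+x. ennreal ((norm (K x))\<^sup>2) \<partial>lborel) < \<infinity>"
    using K(2) by (simp add: nn_integral_eq_integral)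
  have "scaled_model P N X \<phi> K R \<beta> C\<^sub>\<beta> C\<^sub>0 f \<rho> \<Phi>"
    by unfold_locales (use m dpp K2 \<rho> in simp_all)
  then show thesis by (rule that)
qed

lemma square_integrable_limit_control:
  fixes G :: "'a::euclidean_space \<times> real \<Rightarrow> real"
  assumes law: "radius_law \<beta> C\<^sub>\<beta> C\<^sub>0 (real DIM('a)) f" and G: "tame \<beta> G" and c: "0 \<le> c"
  shows "square_integrable (limit_control_measure c \<beta>) G"
    and "(\<integral>z. (G z)\<^sup>2 \<partial>limit_control_measure c \<beta>) = c * (\<integral>z. (G z)\<^sup>2 * radius_law.tail_weight \<beta> (snd z) \<partial>lborel)"
proof -
  interpret radius_law \<beta> C\<^sub>\<beta> C\<^sub>0 "real DIM('a)" f by fact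
  have Gm[measurable]: "G \<in> borel_measurable borel" using tame_measurable[OF G] by (simp add: borel_prod)
  have sm[measurable]: "(snd :: 'a \<times> real \<Rightarrow> real) \<in> borel \<rightarrow>\<^sub>M borel"
    by (intro borel_measurable_continuous_onI continuous_on_snd continuous_on_id)
  have eq: "limit_control_measure c \<beta> = density lborel (\<lambda>z :: 'a \<times> real. ennreal (c * tail_weight (snd z)))"
    unfolding limit_control_measure_def
    by (intro arg_cong2[where f=density] refl) (auto simp: fun_eq_iff tail_weight_def indicator_def)
  have nn: "AE z in (lborel :: ('a \<times> real) measure). 0 \<le> c * tail_weight (snd z)"
    using c tail_weight_nonneg by simp
  have int: "integrable lborel (\<lambda>z. (c * tail_weight (snd z)) *\<^sub>R (G z)\<^sup>2)"
    using integrable_mult_right[OF tame_control_finite[OF G], of c] by (simp add: mult_ac)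
  show "square_integrable (limit_control_measure c \<beta>) G"
    unfolding square_integrable_def eq by (subst integrable_density) (use nn int in simp_all)
  show "(\<integral>z. (G z)\<^sup>2 \<partial>limit_control_measure c \<beta>) = c * (\<integral>z. (G z)\<^sup>2 * tail_weight (snd z) \<partial>lborel)"
    unfolding eq by (subst integral_density) (use nn in \<open>simp_all add: mult_ac\<close>)
qed

text \<open>\<open>J\<close> is nonempty because tameness of an empty sum, the zero function, would
  itself demand exponents on both sides of \<open>\<beta>\<close>.\<close>

lemma tame_sum:
  fixes g :: "'n \<Rightarrow> 'a::euclidean_space \<times> real \<Rightarrow> real"
  assumes "finite J" "J \<noteq> {}" "\<And>j. j \<in> J \<Longrightarrow> tame \<beta> (g j)"
  shows "tame \<beta> (\<lambda>z. \<Sum>j\<in>J. t j * g j z)"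
  using assms
proof (induction J rule: finite_ne_induct)
  case (singleton j)
  then show ?case using tame_linear_combination[of \<beta> "g j" "g j" "t j" 0] by simp
next
  case (insert j J)
  then show ?case using tame_linear_combination[of \<beta> "g j" "\<lambda>z. \<Sum>j\<in>J. t j * g j z" "t j" 1] by simp
qed

text \<open>Enumeration and marks exist for each \<open>\<rho>\<close> separately. Eliminating them
  leaves a statement about the processes alone, which can be used along a sequence of
  scales.\<close>

lemma centered_field_characteristic:
  fixes K :: "'a::euclidean_space \<Rightarrow> complex" and \<mu> :: "'n::finite \<Rightarrow> 'a measure" and t :: "'n \<Rightarrow> real"
  defines "G \<equiv> \<lambda>z. \<Sum>j\<in>UNIV. t j * (case z of (x, r) \<Rightarrow> measure (\<mu> j) (cball x r))"
  assumes law: "radius_law \<beta> C\<^sub>\<beta> C\<^sub>0 (real DIM('a)) f" and \<rho>: "0 < \<rho>"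
    and K: "stationary_dpp P \<phi> K" "integrable lborel (\<lambda>x. (norm (K x))\<^sup>2)"
    and marks: "iid_marking P \<phi> (scaled_radius_density f \<rho>) \<Phi>"
    and \<mu>: "\<And>j. \<mu> j \<in> M_beta_plus \<beta>" and e: "0 \<le> e" "e < 1"
    and hs: "(\<integral>\<^sup>+x. ennreal ((norm (\<integral>r. (iexp (G (x, r) / n) - 1) \<partial>density lborel (scaled_radius_density f \<rho>)))\<^sup>2) \<partial>lborel) *
      (\<integral>\<^sup>+x. ennreal ((norm (K x))\<^sup>2) \<partial>lborel) \<le> ennreal (e\<^sup>2)"
  obtains D where "norm (D - 1) \<le> e\<^sup>2 / (1 - e)"
    "(\<integral>\<omega>. iexp (\<Sum>j\<in>UNIV. t j * (centered_ball_field P \<Phi> (\<mu> j) \<omega> / n)) \<partial>P) =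
      D * exp (K 0 * (\<integral>z. radius_law.radius_weight f \<rho> (snd z) *\<^sub>R (iexp (G z / n) - 1 - \<i> * complex_of_real (G z / n)) \<partial>lborel))"
proof -
  obtain N X R where "scaled_model P N X \<phi> K R \<beta> C\<^sub>\<beta> C\<^sub>0 f \<rho> \<Phi>"
    using scaled_model_exists[OF law \<rho> K marks] by blast
  then interpret scaled_model P N X \<phi> K R \<beta> C\<^sub>\<beta> C\<^sub>0 f \<rho> \<Phi> .
  have G: "tame \<beta> G"
    unfolding G_def by (intro tame_sum tame_ball_measure \<mu>) auto
  obtain D where D: "norm (D - 1) \<le> e\<^sup>2 / (1 - e)"
    "(\<integral>\<omega>. iexp (marked_sum (\<lambda>z. G z / n) \<omega> - Re (K 0) * (\<integral>z. G z / n \<partial>(lborel \<Otimes>\<^sub>M scaled_law \<rho>))) \<partial>P) =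
      D * exp (K 0 * (\<integral>z. radius_weight \<rho> (snd z) *\<^sub>R (iexp (G z / n) - 1 - \<i> * complex_of_real (G z / n)) \<partial>lborel))"
    using normalized_characteristic[OF G e hs] by blast
  have cm: "centered_ball_field P \<Phi> (\<mu> j) \<in> borel_measurable P" for j
    unfolding centered_ball_field_def using ball_field_measurable[OF \<mu>] by measurable
  define I where "I = Re (K 0) * (\<integral>z. G z / n \<partial>(lborel \<Otimes>\<^sub>M scaled_law \<rho>))"
  have [measurable]: "marked_sum (\<lambda>z. G z / n) \<in> borel_measurable P"
    by (intro marked_sum_measurable borel_measurable_divide tame_measurable[OF G] borel_measurable_const)
  have "(\<integral>\<omega>. iexp (\<Sum>j\<in>UNIV. t j * (centered_ball_field P \<Phi> (\<mu> j) \<omega> / n)) \<partial>P) =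
    (\<integral>\<omega>. iexp (marked_sum (\<lambda>z. G z / n) \<omega> - I) \<partial>P)"
  proof (rule integral_cong_AE)
    have "AE \<omega> in P. (\<Sum>j\<in>UNIV. t j * (centered_ball_field P \<Phi> (\<mu> j) \<omega> / n)) = marked_sum (\<lambda>z. G z / n) \<omega> - I"
      using AE_centered_combination[OF \<mu>, where t=t and n=n] unfolding I_def G_def .
    then show "AE \<omega> in P. iexp (\<Sum>j\<in>UNIV. t j * (centered_ball_field P \<Phi> (\<mu> j) \<omega> / n)) = iexp (marked_sum (\<lambda>z. G z / n) \<omega> - I)"
      by eventually_elim (simp only:)
    have "(\<lambda>\<omega>. \<Sum>j\<in>UNIV. t j * (centered_ball_field P \<Phi> (\<mu> j) \<omega> / n)) \<in> borel_measurable P"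
      by (intro borel_measurable_sum borel_measurable_times borel_measurable_divide borel_measurable_const cm)
    then show "(\<lambda>\<omega>. iexp (\<Sum>j\<in>UNIV. t j * (centered_ball_field P \<Phi> (\<mu> j) \<omega> / n))) \<in> borel_measurable P"
      by measurable
    show "(\<lambda>\<omega>. iexp (marked_sum (\<lambda>z. G z / n) \<omega> - I)) \<in> borel_measurable P" by measurable
  qed
  with D show thesis unfolding I_def by (intro that) (simp_all only:)
qed

lemma centered_field_measurable:
  fixes K :: "'a::euclidean_space \<Rightarrow> complex"
  assumes "radius_law \<beta> C\<^sub>\<beta> C\<^sub>0 (real DIM('a)) f" "0 < \<rho>"
    "stationary_dpp P \<phi> K" "integrable lborel (\<lambda>x. (norm (K x))\<^sup>2)"
    "iid_marking P \<phi> (scaled_radius_density f \<rho>) \<Phi>"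
    and \<mu>: "\<mu> \<in> M_beta_plus \<beta>"
  shows "centered_ball_field P \<Phi> \<mu> \<in> borel_measurable P"
proof -
  obtain N X R where "scaled_model P N X \<phi> K R \<beta> C\<^sub>\<beta> C\<^sub>0 f \<rho> \<Phi>"
    using scaled_model_exists[OF assms(1-5)] by blast
  then interpret scaled_model P N X \<phi> K R \<beta> C\<^sub>\<beta> C\<^sub>0 f \<rho> \<Phi> .
  show ?thesis unfolding centered_ball_field_def using ball_field_measurable[OF \<mu>] by measurable
qed

text \<open>By linearity the combination is almost surely the stochastic integral of
  \<open>G\<close>, so its law is read off from a single variance.\<close>

lemma gaussian_field_characteristic:
  fixes \<mu> :: "'n::finite \<Rightarrow> 'a::euclidean_space measure" and t :: "'n \<Rightarrow> real"
  defines "G \<equiv> \<lambda>z. \<Sum>j\<in>UNIV. t j * (case z of (x, r) \<Rightarrow> measure (\<mu> j) (cball x r))"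
  assumes law: "radius_law \<beta> C\<^sub>\<beta> C\<^sub>0 (real DIM('a)) f" and c: "0 \<le> c"
    and gauss: "centered_gaussian_random_measure Q (limit_control_measure c \<beta>) M2"
    and \<mu>: "\<And>j. \<mu> j \<in> M_beta_plus \<beta>"
  shows "(\<integral>\<omega>. iexp (\<Sum>j\<in>UNIV. t j * gaussian_ball_field M2 (\<mu> j) \<omega>) \<partial>Q) =
    complex_of_real (exp (- (c * (\<integral>z. (G z)\<^sup>2 * radius_law.tail_weight \<beta> (snd z) \<partial>lborel)) / 2))"
    and "gaussian_ball_field M2 (\<mu> j) \<in> borel_measurable Q"
proof -
  interpret Q: prob_space Q using gauss by (simp add: centered_gaussian_random_measure_def)
  let ?m = "limit_control_measure c \<beta> :: ('a \<times> real) measure"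
  let ?g = "\<lambda>j (x, r). measure (\<mu> j) (cball x r)"
  have sq: "square_integrable ?m (?g j)" for j
    by (rule square_integrable_limit_control(1)[OF law tame_ball_measure[OF \<mu>] c])
  have M2: "centered_gaussian Q (M2 h) (\<integral>z. (h z)\<^sup>2 \<partial>?m)" if "square_integrable ?m h" for h
    using gauss that unfolding centered_gaussian_random_measure_def by blast
  have m: "gaussian_ball_field M2 (\<mu> j) \<in> borel_measurable Q" for j
    using M2[OF sq[of j]] unfolding gaussian_ball_field_def centered_gaussian_def by (rule conjunct1)
  then show "gaussian_ball_field M2 (\<mu> j) \<in> borel_measurable Q" .
  have sum: "square_integrable ?m G" "AE \<omega> in Q. M2 G \<omega> = (\<Sum>j\<in>UNIV. t j * gaussian_ball_field M2 (\<mu> j) \<omega>)"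
    using gaussian_random_measure_sum[OF gauss sq, of UNIV t] unfolding G_def gaussian_ball_field_def by simp_all
  have G: "tame \<beta> G"
    unfolding G_def by (intro tame_sum tame_ball_measure \<mu>) auto
  have v: "(\<integral>z. (G z)\<^sup>2 \<partial>?m) = c * (\<integral>z. (G z)\<^sup>2 * radius_law.tail_weight \<beta> (snd z) \<partial>lborel)"
    by (rule square_integrable_limit_control(2)[OF law G c])
  have mG: "M2 G \<in> borel_measurable Q" using M2[OF sum(1)] unfolding centered_gaussian_def by (rule conjunct1)
  have "(\<integral>\<omega>. iexp (\<Sum>j\<in>UNIV. t j * gaussian_ball_field M2 (\<mu> j) \<omega>) \<partial>Q) = (\<integral>\<omega>. iexp (M2 G \<omega>) \<partial>Q)"
  proof (rule integral_cong_AE)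
    show "AE \<omega> in Q. iexp (\<Sum>j\<in>UNIV. t j * gaussian_ball_field M2 (\<mu> j) \<omega>) = iexp (M2 G \<omega>)"
      using sum(2) by eventually_elim simp
  qed (use m mG in measurable)
  also have "\<dots> = complex_of_real (exp (- (\<integral>z. (G z)\<^sup>2 \<partial>?m) / 2))"
    by (rule Q.gaussian_characteristic[OF M2[OF sum(1)]]) simp
  finally show "(\<integral>\<omega>. iexp (\<Sum>j\<in>UNIV. t j * gaussian_ball_field M2 (\<mu> j) \<omega>) \<partial>Q) =
    complex_of_real (exp (- (c * (\<integral>z. (G z)\<^sup>2 * radius_law.tail_weight \<beta> (snd z) \<partial>lborel)) / 2))"
    unfolding v .
qed

text \<open>Convergence is tested along sequences of scales tending to 0 and, by the multivariate
  continuity theorem, on characteristic functions. A linear functional of the vector of fields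
  belongs to a combination \<open>G\<close> of ball masses, which is again tame, so one scalar
  estimate covers all finite-dimensional distributions.\<close>

theorem theorem2p6:
  fixes \<beta> C\<^sub>\<beta> C\<^sub>0 :: real
    and f lam :: "real \<Rightarrow> real"
    and P\<^sub>0 :: "'u measure" and \<phi>\<^sub>0 :: "'u \<Rightarrow> 'a::euclidean_space set" and K :: "'a \<Rightarrow> complex"
    and P :: "real \<Rightarrow> 'w measure" and \<phi> :: "real \<Rightarrow> 'w \<Rightarrow> 'a set"
    and K\<^sub>\<rho> :: "real \<Rightarrow> 'a \<Rightarrow> complex"
    and \<Phi> :: "real \<Rightarrow> 'w \<Rightarrow> ('a \<times> real) set"
    and Q :: "'v measure" and M\<^sub>2 :: "('a \<times> real \<Rightarrow> real) \<Rightarrow> 'v \<Rightarrow> real"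
    and \<mu> :: "'n::finite \<Rightarrow> 'a measure"
  assumes beta: "real DIM('a) < \<beta>" "\<beta> < 2 * real DIM('a)"
    and f_density: "f \<in> borel_measurable borel" "\<And>r. 0 \<le> r \<Longrightarrow> 0 \<le> f r"
      "(\<integral>\<^sup>+r\<in>{0..}. ennreal (f r) \<partial>lborel) = 1"
    and f_tail: "0 < C\<^sub>\<beta>" "f \<sim>[at_top] (\<lambda>r. C\<^sub>\<beta> * r powr (- \<beta> - 1))"
    and f_bound: "\<And>r. 0 \<le> r \<Longrightarrow> r powr (\<beta> + 1) * f r \<le> C\<^sub>0"
    and unscaled: "stationary_dpp P\<^sub>0 \<phi>\<^sub>0 K"
    and scaled: "\<And>\<rho>. 0 < \<rho> \<Longrightarrow> stationary_dpp (P \<rho>) (\<phi> \<rho>) (K\<^sub>\<rho> \<rho>)"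
    and marks: "\<And>\<rho>. 0 < \<rho> \<Longrightarrow>
      iid_marking (P \<rho>) (\<phi> \<rho>) (scaled_radius_density f \<rho>) (\<Phi> \<rho>)"
    and hyp_a: "\<And>\<rho>. 0 < \<rho> \<Longrightarrow> admissible_kernel_operator (\<lambda>x y. K\<^sub>\<rho> \<rho> (x - y))"
    and hyp_b: "\<And>\<rho>. 0 < \<rho> \<Longrightarrow> K\<^sub>\<rho> \<rho> 0 = complex_of_real (lam \<rho>) * K 0"
      "filterlim lam at_top (at_right 0)"
    and hyp_c: "\<forall>\<^sub>F \<rho> in at_right 0. integrable lborel (\<lambda>x. (norm (K\<^sub>\<rho> \<rho> x))\<^sup>2)"
      "(\<lambda>\<rho>. \<integral>x. (norm (K\<^sub>\<rho> \<rho> x))\<^sup>2 \<partial>lborel) \<in> O[at_right 0](lam)"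
    and regime: "filterlim (\<lambda>\<rho>. lam \<rho> * \<rho> powr \<beta>) at_top (at_right 0)"
    and gauss: "centered_gaussian_random_measure Q (limit_control_measure (Re (K 0) * C\<^sub>\<beta>) \<beta>) M\<^sub>2"
    and mu: "\<And>i. \<mu> i \<in> M_beta_plus \<beta>"
  shows "converges_in_distribution P
     (\<lambda>\<rho> \<omega>. \<chi> i. centered_ball_field (P \<rho>) (\<Phi> \<rho>) (\<mu> i) \<omega> / (lam \<rho> * \<rho> powr \<beta>) powr (1 / 2))
     (at_right 0)
     Q (\<lambda>\<omega>. \<chi> i. gaussian_ball_field M\<^sub>2 (\<mu> i) \<omega>)"
proof -
  interpret radius_law \<beta> C\<^sub>\<beta> C\<^sub>0 "real DIM('a)" f
    by unfold_locales (use beta f_density f_tail f_bound in simp_all)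
  have law: "radius_law \<beta> C\<^sub>\<beta> C\<^sub>0 (real DIM('a)) f" by (rule radius_law_axioms)
  interpret Q: prob_space Q using gauss by (simp add: centered_gaussian_random_measure_def)
  have K0: "Im (K 0) = 0" "0 \<le> Re (K 0)"
    using dpp_kernel_diagonal[of P\<^sub>0 \<phi>\<^sub>0 K] unscaled by (simp_all add: stationary_dpp_def)
  define c where "c = Re (K 0) * C\<^sub>\<beta>"
  have c: "0 \<le> c" using K0 tail_pos by (simp add: c_def)
  define nrm where "nrm = (\<lambda>\<rho>. (lam \<rho> * \<rho> powr \<beta>) powr (1 / 2))"
  let ?Z = "\<lambda>\<rho> \<omega>. \<chi> i. centered_ball_field (P \<rho>) (\<Phi> \<rho>) (\<mu> i) \<omega> / nrm \<rho>"
  let ?W = "\<lambda>\<omega>. \<chi> i. gaussian_ball_field M\<^sub>2 (\<mu> i) \<omega>"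
  obtain M where M: "0 < M"
    "\<forall>\<^sub>F \<rho> in at_right 0. norm (\<integral>x. (norm (K\<^sub>\<rho> \<rho> x))\<^sup>2 \<partial>lborel) \<le> M * norm (lam \<rho>)"
    using landau_o.bigE[OF hyp_c(2)] by blast
  have "\<forall>\<^sub>F \<rho> in at_right 0. 0 < lam \<rho>"
    using hyp_b(2) by (simp add: filterlim_at_top_dense)
  with hyp_c(1) M(2) have "\<forall>\<^sub>F \<rho> in at_right 0. integrable lborel (\<lambda>x. (norm (K\<^sub>\<rho> \<rho> x))\<^sup>2) \<and> 0 < lam \<rho> \<and>
      (\<integral>x. (norm (K\<^sub>\<rho> \<rho> x))\<^sup>2 \<partial>lborel) \<le> M * lam \<rho>"
    by eventually_elim simp
  \<comment> \<open>A common range of scales for the bound in (c), the integrability and the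
    positivity of \<open>lam\<close>; the sequences below are taken inside it.\<close>
  then obtain b where b: "0 < b" "\<And>\<rho>. 0 < \<rho> \<Longrightarrow> \<rho> < b \<Longrightarrow> integrable lborel (\<lambda>x. (norm (K\<^sub>\<rho> \<rho> x))\<^sup>2)"
    "\<And>\<rho>. 0 < \<rho> \<Longrightarrow> \<rho> < b \<Longrightarrow> 0 < lam \<rho>"
    "\<And>\<rho>. 0 < \<rho> \<Longrightarrow> \<rho> < b \<Longrightarrow> (\<integral>x. (norm (K\<^sub>\<rho> \<rho> x))\<^sup>2 \<partial>lborel) \<le> M * lam \<rho>"
    unfolding eventually_at_right_field by blast
  have vec_measurable: "(\<lambda>\<omega>. \<chi> i. h i \<omega>) \<in> borel_measurable R"
    if "\<And>i. h i \<in> borel_measurable R" for h :: "'n \<Rightarrow> 'z \<Rightarrow> real" and R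
  proof -
    have "(\<lambda>\<omega>. \<Sum>i\<in>UNIV. h i \<omega> *\<^sub>R (axis i 1 :: real ^ 'n)) \<in> borel_measurable R" using that by measurable
    moreover have "(\<chi> i. h i \<omega>) = (\<Sum>i\<in>UNIV. h i \<omega> *\<^sub>R (axis i 1 :: real ^ 'n))" for \<omega>
      by (simp add: Finite_Cartesian_Product.vec_eq_iff axis_def if_distrib cong: if_cong)
    ultimately show ?thesis by (simp only:)
  qed
  have Z_measurable: "?Z \<rho> \<in> borel_measurable (P \<rho>)" if "0 < \<rho>" "\<rho> < b" for \<rho>
    using centered_field_measurable[OF law that(1) scaled[OF that(1)] b(2)[OF that] marks[OF that(1)] mu]
    by (intro vec_measurable borel_measurable_divide borel_measurable_const)
  have W_measurable: "?W \<in> borel_measurable Q"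
    by (intro vec_measurable gaussian_field_characteristic(2)[OF law c gauss[folded c_def] mu])
  have "((\<lambda>\<rho>. \<integral>\<omega>. u (?Z \<rho> \<omega>) \<partial>P \<rho>) \<longlongrightarrow> (\<integral>\<omega>. u (?W \<omega>) \<partial>Q)) (at_right 0)"
    if u: "continuous_on UNIV u" "bounded (range u)" for u :: "real ^ 'n \<Rightarrow> real"
  proof (rule tendsto_at_right_sequentially[OF b(1)])
    fix S :: "nat \<Rightarrow> real" assume S: "\<And>k. 0 < S k" "\<And>k. S k < b" "S \<longlonglongrightarrow> 0"
    have S0: "filterlim S (at_right 0) sequentially"
      using S by (intro tendsto_imp_filterlim_at_right) auto
    have lam_pos: "0 < lam (S k)" for k using b(3) S by blast
    have nrm_pos: "0 < nrm (S k)" for k using lam_pos[of k] S(1)[of k] by (simp add: nrm_def)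
    have nrm_sq: "(nrm (S k))\<^sup>2 = lam (S k) * S k powr \<beta>" for k
      using lam_pos[of k] S(1)[of k] by (simp add: nrm_def power2_eq_square powr_add[symmetric])
    have nrm_lim: "filterlim (\<lambda>k. nrm (S k)) at_top sequentially"
    proof -
      have "nrm (S k) = sqrt (lam (S k) * S k powr \<beta>)" for k
        using lam_pos[of k] by (simp add: nrm_def powr_half_sqrt)
      moreover have "filterlim (\<lambda>k. sqrt (lam (S k) * S k powr \<beta>)) at_top sequentially"
        by (rule filterlim_compose[OF sqrt_at_top filterlim_compose[OF regime S0]])
      ultimately show ?thesis by simp
    qed
    interpret characteristic_convergence Q "\<lambda>k. P (S k)" "\<lambda>k. ?Z (S k)" ?W
    proof (intro characteristic_convergence.intro characteristic_convergence_axioms.intro)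
      show "prob_space Q" by (rule Q.prob_space_axioms)
      show "prob_space (P (S k))" for k
        using scaled[OF S(1)[of k]] by (simp add: stationary_dpp_def dpp_def simple_point_process_def)
      show "?Z (S k) \<in> borel_measurable (P (S k))" for k by (rule Z_measurable[OF S(1,2)])
      show "?W \<in> borel_measurable Q" by (rule W_measurable)
      fix t :: "real ^ 'n"
      define G where "G = (\<lambda>z :: 'a \<times> real. \<Sum>j\<in>UNIV. t $ j * (case z of (x, r) \<Rightarrow> measure (\<mu> j) (cball x r)))"
      have G_app: "(\<Sum>j\<in>UNIV. t $ j * (case z of (x, r) \<Rightarrow> measure (\<mu> j) (cball x r))) = G z" for z
        by (simp add: G_def)
      have G: "tame \<beta> G" unfolding G_def by (intro tame_sum tame_ball_measure mu) auto
      \<comment> \<open>The Poisson factor after centering; the remaining factor \<open>D\<close> is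
        compared with 1 below.\<close>
      define E where "E = (\<lambda>k. exp (K\<^sub>\<rho> (S k) 0 * (\<integral>z. radius_weight (S k) (snd z) *\<^sub>R
          (iexp (G z / nrm (S k)) - 1 - \<i> * complex_of_real (G z / nrm (S k))) \<partial>lborel)))"
      let ?V = "c * (\<integral>z. (G z)\<^sup>2 * tail_weight (snd z) \<partial>lborel)"
      have W_char: "(\<integral>\<omega>. iexp (t \<bullet> ?W \<omega>) \<partial>Q) = complex_of_real (exp (- ?V / 2))"
        using gaussian_field_characteristic(1)[OF law c gauss[folded c_def] mu, of "\<lambda>j. t $ j"]
        by (simp add: inner_vec_def G_def)
      have E_lim: "E \<longlonglongrightarrow> complex_of_real (exp (- ?V / 2))"
      proof -
        let ?I = "\<lambda>k. \<integral>z. (S k powr (- \<beta>) * radius_weight (S k) (snd z)) *\<^sub>R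
          (complex_of_real ((nrm (S k))\<^sup>2) * (iexp (G z / nrm (S k)) - 1 - \<i> * complex_of_real (G z / nrm (S k)))) \<partial>lborel"
        have "?I \<longlonglongrightarrow> (\<integral>z. complex_of_real (- (C\<^sub>\<beta> / 2) * ((G z)\<^sup>2 * tail_weight (snd z))) \<partial>lborel)"
          using exponent_limit[OF G S(1,3) nrm_pos nrm_lim] unfolding radius_weight_def .
        also have "(\<integral>z. complex_of_real (- (C\<^sub>\<beta> / 2) * ((G z)\<^sup>2 * tail_weight (snd z))) \<partial>lborel) =
            complex_of_real (- (C\<^sub>\<beta> / 2) * (\<integral>z. (G z)\<^sup>2 * tail_weight (snd z) \<partial>lborel))"
          by (simp only: integral_complex_of_real integral_mult_right_zero)
        finally have lim: "(\<lambda>k. K 0 * ?I k) \<longlonglongrightarrow> K 0 * complex_of_real (- (C\<^sub>\<beta> / 2) * (\<integral>z. (G z)\<^sup>2 * tail_weight (snd z) \<partial>lborel))"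
          by (rule tendsto_mult_left)
        have "K 0 = complex_of_real (Re (K 0))" using K0 by (simp add: complex_eq_iff)
        then have "K 0 * complex_of_real y = complex_of_real (Re (K 0) * y)" for y by (simp only: of_real_mult)
        then have val: "K 0 * complex_of_real (- (C\<^sub>\<beta> / 2) * y) = complex_of_real (- (c * y) / 2)" for y
          by (simp add: c_def)
        have scale: "K 0 * ?I k = K\<^sub>\<rho> (S k) 0 * (\<integral>z. radius_weight (S k) (snd z) *\<^sub>R
          (iexp (G z / nrm (S k)) - 1 - \<i> * complex_of_real (G z / nrm (S k))) \<partial>lborel)" for k
        proof -
          have l: "S k powr (- \<beta>) * (nrm (S k))\<^sup>2 = lam (S k)"
            unfolding nrm_sq using S(1)[of k] by (simp add: powr_minus field_simps)
          have "(S k powr (- \<beta>) * w) *\<^sub>R (complex_of_real ((nrm (S k))\<^sup>2) * y) = complex_of_real (lam (S k)) * (w *\<^sub>R y)" for w y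
            unfolding l[symmetric] by (simp add: scaleR_conv_of_real mult_ac)
          then have "?I k = complex_of_real (lam (S k)) * (\<integral>z. radius_weight (S k) (snd z) *\<^sub>R
              (iexp (G z / nrm (S k)) - 1 - \<i> * complex_of_real (G z / nrm (S k))) \<partial>lborel)"
            by (simp only: integral_mult_right_zero)
          then show ?thesis using hyp_b(1)[OF S(1)[of k]] by (simp add: mult_ac)
        qed
        show ?thesis
          unfolding E_def exp_of_real[symmetric] scale[symmetric] val[symmetric] by (rule tendsto_exp[OF lim])
      qed
      obtain C q where C: "0 \<le> C" "\<beta> < q"
        "\<And>\<rho> n. 0 < \<rho> \<Longrightarrow> 0 < n \<Longrightarrow>
          (\<integral>\<^sup>+x. ennreal ((norm (\<integral>r. (iexp (G (x, r) / n) - 1) \<partial>scaled_law \<rho>))\<^sup>2) \<partial>lborel) \<le> ennreal (C * \<rho> powr q / n\<^sup>2)"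
        using tame_hilbert_schmidt[OF G refl] by blast
      \<comment> \<open>The product of \<open>C * \<rho> powr q / n\<^sup>2\<close> and the bound
        \<open>M * lam \<rho>\<close> from (c): as
        \<open>n\<^sup>2 = lam \<rho> * \<rho> powr \<beta>\<close>, the intensity cancels and
        \<open>C * M * \<rho> powr (q - \<beta>)\<close> is left as the square of
        \<open>e\<close>.\<close>
      define e where "e = (\<lambda>k. sqrt (C * M * S k powr (q - \<beta>)))"
      have e0: "0 \<le> e k" for k using C(1) M(1) by (simp add: e_def)
      have e_lim: "e \<longlonglongrightarrow> 0"
      proof -
        have "(\<lambda>k. S k powr (q - \<beta>)) \<longlonglongrightarrow> 0"
          using S(1,3) C(2) by (intro tendsto_zero_powrI[where b="q - \<beta>"]) (auto intro: always_eventually less_imp_le)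
        then have "(\<lambda>k. sqrt (C * M * S k powr (q - \<beta>))) \<longlonglongrightarrow> sqrt (C * M * 0)"
          by (intro tendsto_real_sqrt tendsto_mult_left)
        then show ?thesis by (simp add: e_def[abs_def])
      qed
      \<comment> \<open>The Fredholm bound is available only for those \<open>k\<close> with
        \<open>e k < 1\<close>.\<close>
      have "\<forall>\<^sub>F k in sequentially. e k < 1"
        using order_tendstoD(2)[OF e_lim, of 1] by simp
      then have "\<forall>\<^sub>F k in sequentially. norm ((\<integral>\<omega>. iexp (t \<bullet> ?Z (S k) \<omega>) \<partial>P (S k)) - E k) \<le> (e k)\<^sup>2 / (1 - e k) * norm (E k)"
      proof eventually_elim
        case (elim k)
        have "(\<integral>\<^sup>+x. ennreal ((norm (\<integral>r. (iexp (G (x, r) / nrm (S k)) - 1) \<partial>scaled_law (S k)))\<^sup>2) \<partial>lborel) *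
            (\<integral>\<^sup>+x. ennreal ((norm (K\<^sub>\<rho> (S k) x))\<^sup>2) \<partial>lborel) \<le>
            ennreal (C * S k powr q / (nrm (S k))\<^sup>2) * ennreal (M * lam (S k))"
        proof (intro mult_mono C(3) S(1) nrm_pos)
          have "(\<integral>\<^sup>+x. ennreal ((norm (K\<^sub>\<rho> (S k) x))\<^sup>2) \<partial>lborel) = ennreal (\<integral>x. (norm (K\<^sub>\<rho> (S k) x))\<^sup>2 \<partial>lborel)"
            by (rule nn_integral_eq_integral[OF b(2)[OF S(1,2)]]) simp
          then show "(\<integral>\<^sup>+x. ennreal ((norm (K\<^sub>\<rho> (S k) x))\<^sup>2) \<partial>lborel) \<le> ennreal (M * lam (S k))"
            using b(4)[OF S(1,2)] by (simp add: ennreal_leI)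
        qed simp_all
        also have "\<dots> = ennreal ((C * S k powr q / (nrm (S k))\<^sup>2) * (M * lam (S k)))"
          using C(1) M(1) lam_pos[of k] by (intro ennreal_mult[symmetric]) auto
        also have "(C * S k powr q / (nrm (S k))\<^sup>2) * (M * lam (S k)) = (e k)\<^sup>2"
          unfolding nrm_sq using lam_pos[of k] S(1)[of k] C(1) M(1) by (simp add: e_def powr_diff)
        finally have hs: "(\<integral>\<^sup>+x. ennreal ((norm (\<integral>r. (iexp (G (x, r) / nrm (S k)) - 1) \<partial>scaled_law (S k)))\<^sup>2) \<partial>lborel) *
            (\<integral>\<^sup>+x. ennreal ((norm (K\<^sub>\<rho> (S k) x))\<^sup>2) \<partial>lborel) \<le> ennreal ((e k)\<^sup>2)" .
        obtain D where D: "norm (D - 1) \<le> (e k)\<^sup>2 / (1 - e k)"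
          "(\<integral>\<omega>. iexp (\<Sum>j\<in>UNIV. t $ j * (centered_ball_field (P (S k)) (\<Phi> (S k)) (\<mu> j) \<omega> / nrm (S k))) \<partial>P (S k)) = D * E k"
        proof (rule centered_field_characteristic[where t="\<lambda>j. t $ j" and n="nrm (S k)" and \<mu>=\<mu> and e="e k",
              OF law S(1)[of k] scaled[OF S(1)] b(2)[OF S(1,2)] marks[OF S(1)] mu e0 elim, unfolded G_app, OF hs])
          fix D
          assume "norm (D - 1) \<le> (e k)\<^sup>2 / (1 - e k)"
            "(\<integral>\<omega>. iexp (\<Sum>j\<in>UNIV. t $ j * (centered_ball_field (P (S k)) (\<Phi> (S k)) (\<mu> j) \<omega> / nrm (S k))) \<partial>P (S k)) =
              D * exp (K\<^sub>\<rho> (S k) 0 * (\<integral>z. radius_weight (S k) (snd z) *\<^sub>R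
                (iexp (G z / nrm (S k)) - 1 - \<i> * complex_of_real (G z / nrm (S k))) \<partial>lborel))"
          then show thesis by (intro that) (simp_all only: E_def)
        qed
        have "(\<integral>\<omega>. iexp (t \<bullet> ?Z (S k) \<omega>) \<partial>P (S k)) - E k = (D - 1) * E k"
          using D(2) by (simp add: inner_vec_def left_diff_distrib)
        then show ?case using mult_right_mono[OF D(1) norm_ge_zero] by (simp only: norm_mult)
      qed
      \<comment> \<open>The error is \<open>D - 1\<close> times \<open>E k\<close>, and
        \<open>E k\<close> stays bounded because it converges.\<close>
      moreover have "(\<lambda>k. (e k)\<^sup>2 / (1 - e k) * norm (E k)) \<longlonglongrightarrow> 0\<^sup>2 / (1 - 0) * norm (complex_of_real (exp (- ?V / 2)))"
        by (intro tendsto_intros e_lim E_lim) simp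
      then have "(\<lambda>k. (e k)\<^sup>2 / (1 - e k) * norm (E k)) \<longlonglongrightarrow> 0" by simp
      ultimately have "(\<lambda>k. (\<integral>\<omega>. iexp (t \<bullet> ?Z (S k) \<omega>) \<partial>P (S k)) - E k) \<longlonglongrightarrow> 0"
        by (rule Lim_null_comparison)
      from tendsto_add[OF this E_lim]
      show "(\<lambda>k. \<integral>\<omega>. iexp (t \<bullet> ?Z (S k) \<omega>) \<partial>P (S k)) \<longlonglongrightarrow> (\<integral>\<omega>. iexp (t \<bullet> ?W \<omega>) \<partial>Q)"
        unfolding W_char by simp
    qed
    show "(\<lambda>k. \<integral>\<omega>. u (?Z (S k) \<omega>) \<partial>P (S k)) \<longlonglongrightarrow> (\<integral>\<omega>. u (?W \<omega>) \<partial>Q)"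
      by (rule integral_bounded_continuous_tendsto[OF u])
  qed
  moreover have "\<forall>\<^sub>F \<rho> in at_right 0. ?Z \<rho> \<in> borel_measurable (P \<rho>)"
    unfolding eventually_at_right_field using b(1) Z_measurable by blast
  ultimately show ?thesis
    using W_measurable unfolding converges_in_distribution_def nrm_def by blast
qed

end
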